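(* Let $X\in\mathfrak{sl}_n(\mathbb C)$ be a nilpotent element, $X\neq 0$, whose orbit $\mathcal O_X$ has associated partition $\mathbf d=[d_1^{t_{d_1}},\dots,d_s^{t_{d_s}}]$ of $n$. Let $\{X,H,Y\}$ be an $\mathfrak{sl}_2(\mathbb R)$-triple in $\mathfrak{sl}_n(\mathbb C)$. Let $K$ be a maximal compact subgroup of $\mathcal Z_{\mathrm{SL}_n(\mathbb C)}(X,H,Y)$. Let $\mathcal B$ be the ordered basis of $\mathbb C^n$, and $\Lambda_{\mathcal B}$, $\mathbf D$, $\chi_{\mathbf d}$ the maps, defined in the context. Then $\Lambda_{\mathcal B}(K)$ is given by $$\Lambda_{\mathcal B}(K)=\Big\{\mathbf D(g)\ \Big|\ g\in\prod_{i=1}^s \mathrm U(t_{d_i}),\ \chi_{\mathbf d}(g)=1\Big\}.$$ Moreover, the nilpotent orbit $\mathcal O_X$ in $\mathfrak{sl}_n(\mathbb C)$ is homotopic to (has the homotopy type of) $\mathrm{SU}(n)/\Lambda_{\mathcal B}(K)$.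
   Context: Here $n$ is a positive integer. An $\mathfrak{sl}_2(\mathbb R)$-triple $\{X,H,Y\}$ satisfies $X\neq0$, $[H,X]=2X$, $[H,Y]=-2Y$, $[X,Y]=H$. $\mathcal Z_G(X,H,Y)$ is the subgroup of elements of $G$ fixing $X,H,Y$ under the adjoint action. $\mathcal O_X=\{\mathrm{Ad}(g)X: g\in\mathrm{SL}_n(\mathbb C)\}$. $\mathrm U(t)$ and $\mathrm{SU}(n)$ are the compact unitary and special unitary groups. Let $V=\mathbb C^n$ (column vectors). For $d\ge1$ let $M(d-1)$ be the sum of all $\mathbb R$-subspaces of $V$ of real dimension $d$ that are irreducible $\mathrm{Span}_{\mathbb R}\{X,H,Y\}$-submodules, and $L(d-1)=M(d-1)\cap\ker Y$, which is a $\mathbb C$-subspace; put $t_d=\dim_{\mathbb C}L(d-1)$. Let $d_1<\dots<d_s$ be the integers $d$ with $t_d>0$. Then $\sum_i t_{d_i}d_i=n$, and $\mathbf d=[d_1^{t_{d_1}},\dots,d_s^{t_{d_s}}]$ is the partition associated to $\mathcal O_X$ (it depends only on $\mathcal O_X$). For each $d\in\{d_1,\dots,d_s\}$ an ordered $\mathbb C$-basis $(v^d_1,\dots,v^d_{t_d})$ of $L(d-1)$ is fixed. Let $\mathcal B^l(d)=(X^lv^d_1,\dots,X^lv^d_{t_d})$, an ordered basis of $X^lL(d-1)$, for $0\le l\le d-1$; let $\mathcal B(d)$ be the concatenation of $\mathcal B^0(d),\dots,\mathcal B^{d-1}(d)$ in this order, and let $\mathcal B$ be the concatenation of $\mathcal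 B(d_1),\dots,\mathcal B(d_s)$; $\mathcal B$ is an ordered basis of $V$. $\Lambda_{\mathcal B}:\mathrm{End}_{\mathbb C}(V)\to\mathrm M_n(\mathbb C)$ is the algebra isomorphism sending an endomorphism to its matrix with respect to $\mathcal B$. $\mathbf D:\prod_{i=1}^s\mathrm M_{t_{d_i}}(\mathbb C)\to\mathrm M_n(\mathbb C)$ sends $(A_{d_1},\dots,A_{d_s})$ to the block diagonal matrix $\bigoplus_{j=1}^s(A_{d_j}\oplus\cdots\oplus A_{d_j})$ with $A_{d_j}$ repeated $d_j$ times. $\chi_{\mathbf d}(g_1,\dots,g_s)=\prod_{i=1}^s(\det g_i)^{d_i}$.
   Formalization: For an arbitrary K and arbitrary fixed bases the equality can fail (e.g. partition [2^2]); it is proved when each basis of L(d-1) is orthonormal for a K-invariant Hermitian inner product (such bases exist), and for arbitrary bases after replacing K by a conjugate in the centralizer. *)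

theory Defs
  imports
    "HOL-Analysis.Analysis"
    "HOL-Algebra.Left_Coset"
    "Jordan_Normal_Form.Schur_Decomposition"
begin

text \<open>
  Square matrices of the fixed size \<open>n = CARD('n)\<close> are of type \<open>complex^'n^'n\<close>, which carries the
  usual topology; the order of \<open>'n\<close> identifies \<open>'n\<close> with \<open>{0..<n}\<close> (see \<open>idx\<close>).  The matrices in
  \<open>M\<^sub>t(\<complex>)\<close>, whose size \<open>t\<close> depends on the data, are of type \<open>complex mat\<close>.  Names such as \<open>det\<close> that
  exist for both types are qualified.
\<close>

definition matrix_group :: "(complex^'n^'n) set \<Rightarrow> (complex^'n^'n) monoid" where
  "matrix_group C = \<lparr>carrier = C, mult = (**), one = Finite_Cartesian_Product.mat 1\<rparr>"

definition SL :: "(complex^'n^'n) set" where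
  "SL = {g. Determinants.det g = 1}"

definition conj_transpose :: "complex^'n^'n \<Rightarrow> complex^'n^'n" where
  "conj_transpose A = (\<chi> i j. cnj (A $ j $ i))"

definition SU :: "(complex^'n^'n) set" where
  "SU = {g. g ** conj_transpose g = Finite_Cartesian_Product.mat 1 \<and> Determinants.det g = 1}"

definition unitary_group :: "nat \<Rightarrow> complex mat set" where
  "unitary_group t = {A \<in> carrier_mat t t. A * mat_adjoint A = 1\<^sub>m t}"

definition compact_subgroup :: "(complex^'n^'n) set \<Rightarrow> (complex^'n^'n) set \<Rightarrow> bool" where
  "compact_subgroup K C \<longleftrightarrow> subgroup K (matrix_group C) \<and> compact K"

definition maximal_compact_subgroup :: "(complex^'n^'n) set \<Rightarrow> (complex^'n^'n) set \<Rightarrow> bool" where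
  "maximal_compact_subgroup K C \<longleftrightarrow>
     compact_subgroup K C \<and> (\<forall>K'. compact_subgroup K' C \<and> K \<subseteq> K' \<longrightarrow> K' = K)"

definition coset_space :: "('a::topological_space) monoid \<Rightarrow> 'a set \<Rightarrow> 'a set topology" where
  "coset_space G H = topology (\<lambda>U. U \<subseteq> lcosets\<^bsub>G\<^esub> H \<and>
     openin (top_of_set (carrier G)) {g \<in> carrier G. g <#\<^bsub>G\<^esub> H \<in> U})"

lemma openin_coset_space:
  "openin (coset_space G H) U \<longleftrightarrow> U \<subseteq> lcosets\<^bsub>G\<^esub> H \<and>
     openin (top_of_set (carrier G)) {g \<in> carrier G. g <#\<^bsub>G\<^esub> H \<in> U}"
proof -
  let ?T = "top_of_set (carrier G)"
  let ?pre = "\<lambda>U. {g \<in> carrier G. g <#\<^bsub>G\<^esub> H \<in> U}"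
  let ?L = "\<lambda>U. U \<subseteq> lcosets\<^bsub>G\<^esub> H \<and> openin ?T (?pre U)"
  have "?L (S \<inter> T)" if "?L S" "?L T" for S T
  proof -
    have "?pre (S \<inter> T) = ?pre S \<inter> ?pre T" by auto
    moreover have "openin ?T (?pre S \<inter> ?pre T)"
      using that by (intro openin_Int) simp_all
    ultimately show ?thesis using that by auto
  qed
  moreover have "?L (\<Union>\<K>)" if "\<forall>S\<in>\<K>. ?L S" for \<K>
  proof -
    have "?pre (\<Union>\<K>) = (\<Union>S\<in>\<K>. ?pre S)" by auto
    moreover have "openin ?T (\<Union>S\<in>\<K>. ?pre S)"
      using that by (intro openin_Union) blast
    ultimately show ?thesis using that by (simp add: Sup_le_iff)
  qed
  ultimately have "istopology ?L"
    unfolding istopology_def by blast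
  then show ?thesis
    unfolding coset_space_def by simp
qed

lemma quotient_map_coset_space:
  "quotient_map (top_of_set (carrier G)) (coset_space G H) (\<lambda>g. g <#\<^bsub>G\<^esub> H)"
proof -
  let ?pre = "\<lambda>U. {g \<in> carrier G. g <#\<^bsub>G\<^esub> H \<in> U}"
  have pre: "?pre (lcosets\<^bsub>G\<^esub> H) = carrier G"
    by (auto simp: LCOSETS_def)
  have "openin (top_of_set (carrier G)) (?pre (lcosets\<^bsub>G\<^esub> H))"
    unfolding pre by simp
  then have "openin (coset_space G H) (lcosets\<^bsub>G\<^esub> H)"
    unfolding openin_coset_space by blast
  then have "topspace (coset_space G H) = lcosets\<^bsub>G\<^esub> H"
    by (meson openin_coset_space openin_subset openin_topspace subset_antisym)
  then show ?thesis
    unfolding quotient_map_def by (auto simp: openin_coset_space LCOSETS_def)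
qed

definition sl :: "(complex^'n^'n) set" where
  "sl = {A. Determinants.trace A = 0}"

definition lie_bracket :: "complex^'n^'n \<Rightarrow> complex^'n^'n \<Rightarrow> complex^'n^'n" where
  "lie_bracket A B = A ** B - B ** A"

text \<open>The powers are matrix powers; \<open>A ^ k\<close> would multiply entrywise.\<close>

definition nilpotent_matrix :: "complex^'n^'n \<Rightarrow> bool" where
  "nilpotent_matrix A \<longleftrightarrow> (\<exists>k. (((**) A) ^^ k) (Finite_Cartesian_Product.mat 1) = 0)"

definition sl2_triple :: "complex^'n^'n \<Rightarrow> complex^'n^'n \<Rightarrow> complex^'n^'n \<Rightarrow> bool" where
  "sl2_triple X H Y \<longleftrightarrow> X \<in> sl \<and> H \<in> sl \<and> Y \<in> sl \<and> X \<noteq> 0 \<and>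
     lie_bracket H X = 2 *\<^sub>R X \<and> lie_bracket H Y = (- 2) *\<^sub>R Y \<and> lie_bracket X Y = H"

definition Ad :: "complex^'n^'n \<Rightarrow> complex^'n^'n \<Rightarrow> complex^'n^'n" where
  "Ad g A = g ** A ** matrix_inv g"

definition adjoint_orbit :: "complex^'n^'n \<Rightarrow> (complex^'n^'n) set" where
  "adjoint_orbit X = (\<lambda>g. Ad g X) ` SL"

definition centralizer_triple ::
    "complex^'n^'n \<Rightarrow> complex^'n^'n \<Rightarrow> complex^'n^'n \<Rightarrow> (complex^'n^'n) set" where
  "centralizer_triple X H Y = {g \<in> SL. Ad g X = X \<and> Ad g H = H \<and> Ad g Y = Y}"

text \<open>
  \<open>subspace\<close>, \<open>span\<close>, \<open>dim\<close> of \<open>Real_Vector_Spaces\<close> refer to the real structure of \<open>complex^'n\<close>;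
  \<open>vec.span\<close>, \<open>vec.independent\<close>, \<open>vec.dim\<close> refer to the complex one.
\<close>

definition invariant_subspace :: "(complex^'n^'n) set \<Rightarrow> (complex^'n) set \<Rightarrow> bool" where
  "invariant_subspace S W \<longleftrightarrow> Real_Vector_Spaces.subspace W \<and> (\<forall>A\<in>S. \<forall>w\<in>W. A *v w \<in> W)"

definition irreducible_submodule :: "(complex^'n^'n) set \<Rightarrow> (complex^'n) set \<Rightarrow> bool" where
  "irreducible_submodule S W \<longleftrightarrow> invariant_subspace S W \<and> W \<noteq> {0} \<and>
     (\<forall>W'. invariant_subspace S W' \<and> W' \<subseteq> W \<longrightarrow> W' = {0} \<or> W' = W)"

text \<open>\<open>M_space X H Y d\<close>, \<open>L_space X H Y d\<close> are the spaces \<open>M(d-1)\<close>, \<open>L(d-1)\<close>.\<close>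

definition M_space ::
    "complex^'n^'n \<Rightarrow> complex^'n^'n \<Rightarrow> complex^'n^'n \<Rightarrow> nat \<Rightarrow> (complex^'n) set" where
  "M_space X H Y d = Real_Vector_Spaces.span
     (\<Union>{W. irreducible_submodule (Real_Vector_Spaces.span {X, H, Y}) W \<and>
            Real_Vector_Spaces.dim W = d})"

definition L_space ::
    "complex^'n^'n \<Rightarrow> complex^'n^'n \<Rightarrow> complex^'n^'n \<Rightarrow> nat \<Rightarrow> (complex^'n) set" where
  "L_space X H Y d = M_space X H Y d \<inter> {w. Y *v w = 0}"

definition mult_t ::
    "complex^'n^'n \<Rightarrow> complex^'n^'n \<Rightarrow> complex^'n^'n \<Rightarrow> nat \<Rightarrow> nat" where
  "mult_t X H Y d = vec.dim (L_space X H Y d)"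

text \<open>The list \<open>d\<^sub>1 < \<dots> < d\<^sub>s\<close>; together with \<open>mult_t\<close> it is the partition of \<open>n\<close> attached to the orbit.\<close>

definition part_sizes :: "complex^'n^'n \<Rightarrow> complex^'n^'n \<Rightarrow> complex^'n^'n \<Rightarrow> nat list" where
  "part_sizes X H Y = sorted_list_of_set {d. 1 \<le> d \<and> 0 < mult_t X H Y d}"

definition ordered_basis_of :: "(complex^'n) list \<Rightarrow> (complex^'n) set \<Rightarrow> bool" where
  "ordered_basis_of vs W \<longleftrightarrow>
     distinct vs \<and> vec.independent (set vs) \<and> vec.span (set vs) = W"

definition L_bases :: "complex^'n^'n \<Rightarrow> complex^'n^'n \<Rightarrow> complex^'n^'n \<Rightarrow>
    (nat \<Rightarrow> (complex^'n) list) \<Rightarrow> bool" where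
  "L_bases X H Y v \<longleftrightarrow>
     (\<forall>d \<in> set (part_sizes X H Y). ordered_basis_of (v d) (L_space X H Y d))"

definition basis_B :: "complex^'n^'n \<Rightarrow> complex^'n^'n \<Rightarrow> complex^'n^'n \<Rightarrow>
    (nat \<Rightarrow> (complex^'n) list) \<Rightarrow> (complex^'n) list" where
  "basis_B X H Y v =
     concat (map (\<lambda>d. concat (map (\<lambda>l. map (((*v) X) ^^ l) (v d)) [0..<d])) (part_sizes X H Y))"

definition idx :: "'n::{finite,wellorder} \<Rightarrow> nat" where
  "idx i = card {..<i}"

definition Lambda ::
    "(complex^('n::{finite,wellorder})) list \<Rightarrow> complex^('n::{finite,wellorder})^('n::{finite,wellorder}) \<Rightarrow>
     complex^('n::{finite,wellorder})^('n::{finite,wellorder})" where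
  "Lambda B A = (\<chi> i j. vec.representation (set B) (A *v (B ! idx j)) (B ! idx i))"

definition block_D :: "nat list \<Rightarrow> (nat \<Rightarrow> complex mat) \<Rightarrow> complex^('n::{finite,wellorder})^('n::{finite,wellorder})" where
  "block_D ds g =
     (\<chi> i j. diag_block_mat (concat (map (\<lambda>d. replicate d (g d)) ds)) $$ (idx i, idx j))"

definition chi_d :: "nat list \<Rightarrow> (nat \<Rightarrow> complex mat) \<Rightarrow> complex" where
  "chi_d ds g = (\<Prod>d\<in>set ds. Determinant.det (g d) ^ d)"

definition unitary_block_group ::
    "complex^('n::{finite,wellorder})^('n::{finite,wellorder}) \<Rightarrow> complex^('n::{finite,wellorder})^('n::{finite,wellorder}) \<Rightarrow> complex^('n::{finite,wellorder})^('n::{finite,wellorder}) \<Rightarrow>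
     (complex^('n::{finite,wellorder})^('n::{finite,wellorder})) set" where
  "unitary_block_group X H Y = {block_D (part_sizes X H Y) g | g.
     g \<in> (\<Pi>\<^sub>E d\<in>set (part_sizes X H Y). unitary_group (mult_t X H Y d)) \<and>
     chi_d (part_sizes X H Y) g = 1}"

text \<open>
  \<open>basis_inner vs\<close> is the Hermitian inner product on the complex span of \<open>vs\<close> for which \<open>vs\<close> is
  orthonormal.  For an arbitrary maximal compact subgroup \<open>K\<close> of the centralizer and arbitrary
  bases \<open>v d\<close>, the matrices of the elements of \<open>K\<close> on \<open>L(d-1)\<close> are unitary only up to conjugation.
  They are unitary when \<open>v d\<close> is orthonormal for some \<open>K\<close>-invariant inner product on \<open>L(d-1)\<close>,
  which is what \<open>adapted_bases\<close> says.
\<close>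

definition basis_inner :: "(complex^'n) list \<Rightarrow> complex^'n \<Rightarrow> complex^'n \<Rightarrow> complex" where
  "basis_inner vs x y =
     (\<Sum>b\<in>set vs. vec.representation (set vs) x b * cnj (vec.representation (set vs) y b))"

definition adapted_bases :: "complex^'n^'n \<Rightarrow> complex^'n^'n \<Rightarrow> complex^'n^'n \<Rightarrow>
    (complex^'n^'n) set \<Rightarrow> (nat \<Rightarrow> (complex^'n) list) \<Rightarrow> bool" where
  "adapted_bases X H Y K v \<longleftrightarrow>
     L_bases X H Y v \<and>
     (\<forall>d \<in> set (part_sizes X H Y). \<forall>k \<in> K. \<forall>x \<in> L_space X H Y d. \<forall>y \<in> L_space X H Y d.
        basis_inner (v d) (k *v x) (k *v y) = basis_inner (v d) x y)"

end

theory Submission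
  imports Defs
begin

no_notation Matrix.vec_index (infixl "$" 100) and Matrix.scalar_prod (infix "\<bullet>" 70)
hide_fact (open) Matrix.mat_def Matrix.vec_eq_iff Matrix.orthogonal_def Determinant.det_def
hide_const (open) Matrix.mat Matrix.row Matrix.col Matrix.orthogonal Determinant.det VectorSpace.subspace

text \<open>
  In the basis \<open>\<B>\<close> the matrix \<open>X\<close> becomes a shift, and the centralizer of the triple becomes the
  group of block matrices of determinant 1. A compact subgroup \<open>K\<close> of it preserves a positive
  definite Hermitian form (a point of the convex hull of the \<open>k\<^sup>* k\<close> fixed by \<open>K\<close>), so it is unitary in
  a suitable basis; by maximality it is then the whole group of unitary blocks.

  For the homotopy type: each \<open>N\<close> in the orbit of the shift has a canonical Hermitian form for which
  it is unitarily similar to the shift. Its frames, the bases of shift type whose generators are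
  orthonormal and orthogonal to the part of the kernel filtration cut out by the other basis vectors,
  form a single coset of a unitary group. The form depends continuously on \<open>N\<close>. Deforming it linearly
  to the standard form, and undoing the deformation by a Cholesky factor, retracts the orbit onto the
  \<open>SU(n)\<close>-orbit of the shift.
\<close>

section \<open>Hermitian forms and Cholesky factorization\<close>

text \<open>The stabilizer of a nonzero nilpotent matrix has a unipotent part, so the similarities
  between \<open>N\<close> and the shift carry the standard form to many different forms for the
  same \<open>N\<close>. This is the obstacle to a retraction. Asking generators to be orthogonal to
  a complement that every matrix commuting with the shift preserves removes the unipotent freedom
  and leaves block unitary matrices. The resulting form is picked by a choice operator, so its
  continuity is not visible from a formula; it is regained from uniqueness, boundedness of the
  frames and closedness of their defining conditions.

  The sums \<open>M_space\<close> are built from real irreducible submodules, whereas bases and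
  dimensions of \<open>L_space\<close> are complex. The bridge is the identification of
  \<open>L_space\<close> with the lowest weight vectors of one weight, a complex subspace, by means
  of the Casimir operator. That the vectors of \<B> span everything is complete reducibility,
  derived here from the commutation of powers of \<open>X\<close> and \<open>Y\<close> and from
  their nilpotency.\<close>

definition hinner :: "complex^'n \<Rightarrow> complex^'n \<Rightarrow> complex" where
  "hinner x y = (\<Sum>i\<in>UNIV. cnj (x $ i) * y $ i)"

lemma hinner_add_left: "hinner (x + y) z = hinner x z + hinner y z"
  and hinner_add_right: "hinner x (y + z) = hinner x y + hinner x z"
  and hinner_diff_left: "hinner (x - y) z = hinner x z - hinner y z"
  and hinner_diff_right: "hinner x (y - z) = hinner x y - hinner x z"
  and hinner_scale_left: "hinner (c *s x) y = cnj c * hinner x y"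
  and hinner_scale_right: "hinner x (c *s y) = c * hinner x y"
  and hinner_scaleR_left: "hinner (r *\<^sub>R x) y = r *\<^sub>R hinner x y"
  and hinner_scaleR_right: "hinner x (r *\<^sub>R y) = r *\<^sub>R hinner x y"
  by (simp_all add: hinner_def algebra_simps sum.distrib sum_subtractf sum_distrib_left
      sum_distrib_right scaleR_sum_right)

lemma hinner_zero [simp]: "hinner 0 x = 0" "hinner x 0 = 0"
  by (simp_all add: hinner_def)

lemma hinner_sum_left: "hinner (sum f A) y = (\<Sum>a\<in>A. hinner (f a) y)"
  by (induction A rule: infinite_finite_induct) (simp_all add: hinner_add_left)

lemma hinner_sum_right: "hinner x (sum f A) = (\<Sum>a\<in>A. hinner x (f a))"
  by (induction A rule: infinite_finite_induct) (simp_all add: hinner_add_right)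

lemma cnj_hinner: "cnj (hinner x y) = hinner y x"
  by (simp add: hinner_def mult.commute)

lemma Re_hinner: "Re (hinner x y) = x \<bullet> y"
  by (simp add: hinner_def inner_vec_def inner_complex_def)

lemma hinner_self: "hinner x x = of_real ((norm x)\<^sup>2)"
proof -
  have "Im (hinner x x) = 0"
    using cnj_hinner[of x x] by (simp add: complex_eq_iff)
  then show ?thesis
    by (simp add: complex_eq_iff Re_hinner power2_norm_eq_inner)
qed

lemma hinner_eq_0_iff [simp]: "hinner x x = 0 \<longleftrightarrow> x = 0"
  by (simp add: hinner_self)

lemma hinner_axis_left: "hinner (axis i 1) x = x $ i"
proof -
  have "hinner (axis i 1) x = (\<Sum>j\<in>UNIV. if j = i then x $ j else 0)"
    unfolding hinner_def axis_def by (intro sum.cong) auto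
  then show ?thesis by simp
qed

lemma hinner_axis_axis: "hinner (axis i 1) (axis j 1) = (if i = j then 1 else 0)"
  unfolding hinner_axis_left by (simp add: axis_def)

lemma cmatrix_vector_mult_axis: "(A *v axis j 1) $ i = (A $ i $ j :: complex)"
  by (simp add: matrix_vector_mult_def axis_def if_distrib cong: if_cong)

lemma scaleR_cmatrix_vector_mult: "(r *\<^sub>R A) *v x = r *\<^sub>R ((A :: complex^'n^'m) *v x)"
  by (simp add: matrix_vector_mult_def vec_eq_iff scaleR_sum_right)

lemma matrix_entry_hinner: "A $ i $ j = hinner (axis i 1) (A *v axis j 1)"
  by (simp add: hinner_axis_left cmatrix_vector_mult_axis)

lemma hinner_conj_transpose: "hinner (A *v x) y = hinner x (conj_transpose A *v y)"
proof -
  have "hinner (A *v x) y = (\<Sum>i\<in>UNIV. \<Sum>j\<in>UNIV. cnj (A $ i $ j) * cnj (x $ j) * y $ i)"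
    by (simp add: hinner_def matrix_vector_mult_def sum_distrib_right)
  also have "\<dots> = (\<Sum>j\<in>UNIV. \<Sum>i\<in>UNIV. cnj (A $ i $ j) * cnj (x $ j) * y $ i)"
    by (rule sum.swap)
  also have "\<dots> = hinner x (conj_transpose A *v y)"
    by (simp add: hinner_def matrix_vector_mult_def conj_transpose_def sum_distrib_left mult_ac)
  finally show ?thesis .
qed

lemma conj_transpose_conj_transpose [simp]: "conj_transpose (conj_transpose A) = A"
  by (simp add: conj_transpose_def vec_eq_iff)

lemma conj_transpose_mult: "conj_transpose (A ** B) = conj_transpose B ** conj_transpose A"
  by (simp add: conj_transpose_def matrix_matrix_mult_def vec_eq_iff mult.commute)

lemma conj_transpose_mat_1 [simp]: "conj_transpose (mat 1) = mat 1"
  by (auto simp: conj_transpose_def Finite_Cartesian_Product.mat_def vec_eq_iff)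

lemma conj_transpose_add: "conj_transpose (A + B) = conj_transpose A + conj_transpose B"
  by (simp add: conj_transpose_def vec_eq_iff)

lemma conj_transpose_scaleR: "conj_transpose (r *\<^sub>R A) = r *\<^sub>R conj_transpose A"
  by (simp add: conj_transpose_def vec_eq_iff)

lemma det_conj_transpose: "Determinants.det (conj_transpose A) = cnj (Determinants.det A)"
proof -
  have "Determinants.det (conj_transpose A) = Determinants.det (\<chi> i j. cnj (A $ i $ j))"
    by (subst Determinants.det_transpose [symmetric])
       (simp add: conj_transpose_def transpose_def)
  also have "\<dots> = cnj (Determinants.det A)"
    by (simp add: Determinants.det_def)
  finally show ?thesis .
qed

lemma continuous_on_conj_transpose [continuous_intros]:
  assumes "continuous_on S f"
  shows "continuous_on S (\<lambda>x. conj_transpose (f x))"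
  unfolding conj_transpose_def using assms by (intro continuous_intros)

lemma continuous_on_hinner [continuous_intros]:
  assumes "continuous_on S f" "continuous_on S g"
  shows "continuous_on S (\<lambda>x. hinner (f x) (g x))"
  unfolding hinner_def using assms by (intro continuous_intros)

lemma continuous_on_cvector_scale [continuous_intros]:
  fixes f :: "'a::topological_space \<Rightarrow> complex"
  assumes "continuous_on S f" "continuous_on S g"
  shows "continuous_on S (\<lambda>x. f x *s g x)"
  unfolding vector_scalar_mult_def using assms by (intro continuous_intros)

lemma continuous_on_cmatrix_mult [continuous_intros]:
  fixes f g :: "'a::topological_space \<Rightarrow> complex^'n^'n"
  assumes "continuous_on S f" "continuous_on S g"
  shows "continuous_on S (\<lambda>x. f x ** g x)"
  unfolding matrix_matrix_mult_def using assms by (intro continuous_intros)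

lemma continuous_on_cmatrix_vector_mult [continuous_intros]:
  fixes f :: "'a::topological_space \<Rightarrow> complex^'n^'n"
  assumes "continuous_on S f" "continuous_on S g"
  shows "continuous_on S (\<lambda>x. f x *v g x)"
  unfolding matrix_vector_mult_def using assms by (intro continuous_intros)

definition posdef :: "complex^'n^'n \<Rightarrow> bool" where
  "posdef Q \<longleftrightarrow> conj_transpose Q = Q \<and> (\<forall>x. x \<noteq> 0 \<longrightarrow> 0 < Re (hinner x (Q *v x)))"

lemma posdef_mat_1: "posdef (mat 1)"
  by (simp add: posdef_def Re_hinner)

lemma posdef_convex:
  assumes "posdef P" "posdef Q" "0 \<le> s" "s \<le> 1"
  shows "posdef ((1 - s) *\<^sub>R P + s *\<^sub>R Q)"
proof -
  have "0 < (1 - s) * p + s * q" if "0 < p" "0 < q" for p q :: real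
    using that assms(3,4) by (cases "s = 0") (auto intro: add_nonneg_pos)
  then show ?thesis
    using assms(1,2)
    by (simp add: posdef_def conj_transpose_add conj_transpose_scaleR matrix_vector_mult_add_rdistrib
        hinner_add_right scaleR_cmatrix_vector_mult hinner_scaleR_right)
qed

lemma posdef_mult_conj_transpose:
  fixes g :: "complex^'n^'n"
  assumes "invertible g"
  shows "posdef (g ** conj_transpose g)"
  unfolding posdef_def
proof (intro conjI allI impI)
  fix x :: "complex^'n" assume "x \<noteq> 0"
  obtain g' where "g ** g' = mat 1"
    using assms unfolding invertible_def by blast
  then have *: "conj_transpose g' ** conj_transpose g = mat 1"
    by (simp add: conj_transpose_mult[symmetric])
  have "conj_transpose g *v x \<noteq> 0"
    by (metis * \<open>x \<noteq> 0\<close> matrix_vector_mul_assoc matrix_vector_mul_lid matrix_vector_mult_0_right)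
  moreover have "hinner x ((g ** conj_transpose g) *v x) = hinner (conj_transpose g *v x) (conj_transpose g *v x)"
    by (simp add: matrix_vector_mul_assoc[symmetric] hinner_conj_transpose)
  ultimately show "0 < Re (hinner x ((g ** conj_transpose g) *v x))"
    by (simp add: Re_hinner)
qed (simp add: conj_transpose_mult)

text \<open>Gram-Schmidt on the standard basis for the form \<open>hinner x (Q *v y)\<close>, in the
  order of the index type and without normalization, so that no square root enters the
  recursion.\<close>

function gram_schmidt_vec :: "complex^('n::{finite,wellorder})^('n::{finite,wellorder}) \<Rightarrow> ('n::{finite,wellorder}) \<Rightarrow> complex^('n::{finite,wellorder})" where
  "gram_schmidt_vec Q k = axis k 1 - (\<Sum>j\<in>{..<k}.
     (hinner (gram_schmidt_vec Q j) (Q *v axis k 1) /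
      hinner (gram_schmidt_vec Q j) (Q *v gram_schmidt_vec Q j)) *s gram_schmidt_vec Q j)"
  by auto
termination
  by (relation "inv_image {(x, y). x < y} snd") (auto simp: wf)

declare gram_schmidt_vec.simps [simp del]

lemma gram_schmidt_vec_eq_0_above:
  "k < i \<Longrightarrow> gram_schmidt_vec Q k $ i = 0"
proof (induction k rule: less_induct)
  case (less k)
  then show ?case
    by (subst gram_schmidt_vec.simps) (auto simp: axis_def intro!: sum.neutral)
qed

text \<open>Coordinate \<open>k\<close> equals 1: the correction terms involve earlier vectors only,
  and these vanish at \<open>k\<close>.\<close>

lemma gram_schmidt_vec_nonzero: "gram_schmidt_vec Q k \<noteq> 0"
proof -
  have "gram_schmidt_vec Q k $ k = 1"
    by (subst gram_schmidt_vec.simps) (auto simp: axis_def gram_schmidt_vec_eq_0_above)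
  then show ?thesis by auto
qed

lemma posdef_hinner_ne_0: "posdef Q \<Longrightarrow> x \<noteq> 0 \<Longrightarrow> hinner x (Q *v x) \<noteq> 0"
  unfolding posdef_def by (metis less_irrefl zero_complex.sel(1))

lemma gram_schmidt_vec_orthogonal_less:
  assumes Q: "posdef Q"
  shows "i < k \<Longrightarrow> hinner (gram_schmidt_vec Q i) (Q *v gram_schmidt_vec Q k) = 0"
proof (induction k arbitrary: i rule: less_induct)
  case (less k)
  let ?v = "gram_schmidt_vec Q"
  let ?c = "\<lambda>j. hinner (?v j) (Q *v axis k 1) / hinner (?v j) (Q *v ?v j)"
  \<comment> \<open>For \<open>j > i\<close> this is the induction hypothesis at \<open>j\<close>;
    for \<open>j < i\<close> it is the one at \<open>i\<close>, turned around by Hermitian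
    symmetry.\<close>
  have 0: "hinner (?v i) (Q *v ?v j) = 0" if "j < k" "j \<noteq> i" for j
  proof (cases "j < i")
    case True
    then have "hinner (?v j) (Q *v ?v i) = 0" using less by blast
    then show ?thesis
      using Q unfolding posdef_def
      by (metis cnj_hinner hinner_conj_transpose complex_cnj_zero)
  qed (use less that in auto)
  have "hinner (?v i) (Q *v ?v k) = hinner (?v i) (Q *v axis k 1) - (\<Sum>j\<in>{..<k}. ?c j * hinner (?v i) (Q *v ?v j))"
    by (subst (2) gram_schmidt_vec.simps)
       (simp add: matrix_vector_mult_diff_distrib hinner_diff_right hinner_sum_right
         linear_sum[OF matrix_vector_mul_linear] vector_scalar_commute hinner_scale_right)
  also have "(\<Sum>j\<in>{..<k}. ?c j * hinner (?v i) (Q *v ?v j)) = (\<Sum>j\<in>{..<k}. if j = i then hinner (?v i) (Q *v axis k 1) else 0)"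
    using 0 posdef_hinner_ne_0[OF Q gram_schmidt_vec_nonzero, of Q i] by (intro sum.cong) auto
  finally show ?case using less.prems by simp
qed

lemma gram_schmidt_vec_orthogonal:
  assumes "posdef Q" "i \<noteq> k"
  shows "hinner (gram_schmidt_vec Q i) (Q *v gram_schmidt_vec Q k) = 0"
proof (cases "i < k")
  case False
  then have "hinner (gram_schmidt_vec Q k) (Q *v gram_schmidt_vec Q i) = 0"
    using assms gram_schmidt_vec_orthogonal_less by (metis neqE)
  then show ?thesis
      using assms unfolding posdef_def
      by (metis cnj_hinner hinner_conj_transpose complex_cnj_zero)
qed (use assms gram_schmidt_vec_orthogonal_less in auto)

lemma continuous_on_gram_schmidt_vec:
  "continuous_on {Q. posdef Q} (\<lambda>Q. gram_schmidt_vec Q k)"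
proof (induction k rule: less_induct)
  case (less k)
  show ?case
    by (subst gram_schmidt_vec.simps)
       (intro continuous_intros less.IH; simp add: posdef_hinner_ne_0 gram_schmidt_vec_nonzero)
qed

text \<open>The columns are the normalized Gram-Schmidt vectors, so for positive definite
  \<open>Q\<close> this is the inverse of the upper triangular Cholesky factor \<open>R\<close> in
  \<open>Q = conj_transpose R ** R\<close>. Unlike a Hermitian square root it has an explicit
  formula, which makes its continuity in \<open>Q\<close> elementary.\<close>

definition chol :: "complex^('n::{finite,wellorder})^('n::{finite,wellorder}) \<Rightarrow> complex^('n::{finite,wellorder})^('n::{finite,wellorder})" where
  "chol Q = (\<chi> i k. gram_schmidt_vec Q k $ i /
     of_real (sqrt (Re (hinner (gram_schmidt_vec Q k) (Q *v gram_schmidt_vec Q k)))))"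

lemma continuous_on_chol: "continuous_on {Q. posdef Q} chol"
proof -
  have "0 < Re (hinner (gram_schmidt_vec Q k) (Q *v gram_schmidt_vec Q k))" if "posdef Q" for Q and k :: "'n::{finite,wellorder}"
    using that gram_schmidt_vec_nonzero unfolding posdef_def by blast
  then have *: "Re (hinner (gram_schmidt_vec Q k) (Q *v gram_schmidt_vec Q k)) \<noteq> 0" if "posdef Q" for Q and k :: "'n::{finite,wellorder}"
    using that by (metis less_irrefl)
  show ?thesis
    unfolding chol_def
    by (intro continuous_intros continuous_on_gram_schmidt_vec) (simp add: *)
qed

lemma chol_axis:
  "chol Q *v axis k 1 =
    of_real (1 / sqrt (Re (hinner (gram_schmidt_vec Q k) (Q *v gram_schmidt_vec Q k)))) *s gram_schmidt_vec Q k"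
  unfolding vec_eq_iff by (simp add: cmatrix_vector_mult_axis) (simp add: chol_def)

lemma chol:
  fixes Q :: "complex^('n::{finite,wellorder})^('n::{finite,wellorder})"
  assumes "posdef Q"
  shows "conj_transpose (chol Q) ** Q ** chol Q = mat 1"
proof -
  let ?v = "gram_schmidt_vec Q"
  have "(conj_transpose (chol Q) ** Q ** chol Q) $ i $ j = mat 1 $ i $ j" for i j
  proof -
    let ?r = "\<lambda>k. Re (hinner (?v k) (Q *v ?v k))"
    have pos: "0 < ?r k" for k
      using assms gram_schmidt_vec_nonzero unfolding posdef_def by blast
    have real: "hinner (?v k) (Q *v ?v k) = of_real (?r k)" for k
    proof -
      have "cnj (hinner (?v k) (Q *v ?v k)) = hinner (?v k) (Q *v ?v k)"
        using assms unfolding posdef_def by (metis cnj_hinner hinner_conj_transpose)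
      then show ?thesis by (simp add: complex_eq_iff)
    qed
    have "(conj_transpose (chol Q) ** Q ** chol Q) $ i $ j = hinner (chol Q *v axis i 1) (Q *v (chol Q *v axis j 1))"
      by (simp add: matrix_entry_hinner matrix_vector_mul_assoc[symmetric] hinner_conj_transpose)
    also have "\<dots> = of_real (1 / sqrt (?r i)) * of_real (1 / sqrt (?r j)) * hinner (?v i) (Q *v ?v j)"
      unfolding chol_axis by (simp add: hinner_scale_left vector_scalar_commute hinner_scale_right)
    also have "\<dots> = mat 1 $ i $ j"
    proof (cases "i = j")
      case True
      have "1 / sqrt (?r j) * (1 / sqrt (?r j)) * ?r j = 1"
        using pos[of j] by (simp add: field_simps)
      then have "of_real (1 / sqrt (?r j)) * of_real (1 / sqrt (?r j)) * (of_real (?r j) :: complex) = 1"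
        by (metis of_real_1 of_real_mult)
      then have "of_real (1 / sqrt (?r j)) * of_real (1 / sqrt (?r j)) * hinner (?v j) (Q *v ?v j) = 1"
        by (subst real)
      moreover have "(mat 1 $ j $ j :: complex) = 1"
        by (simp add: Finite_Cartesian_Product.mat_def)
      ultimately show ?thesis unfolding True by (simp only:)
    qed (simp add: gram_schmidt_vec_orthogonal[OF assms] Finite_Cartesian_Product.mat_def)
    finally show ?thesis .
  qed
  then show ?thesis by (simp add: vec_eq_iff)
qed

text \<open>Makes the later deformation trivial wherever the form is the standard one: at time 0,
  and at all times on the unitary part of the orbit.\<close>

lemma chol_mat_1: "chol (mat 1) = mat 1"
proof -
  have v: "gram_schmidt_vec (mat 1) k = axis k 1" for k :: "'n::{finite,wellorder}"
  proof (induction k rule: less_induct)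
    case (less k)
    then show ?case by (subst gram_schmidt_vec.simps) (auto simp: hinner_axis_axis intro!: sum.neutral)
  qed
  show ?thesis
    unfolding vec_eq_iff cmatrix_vector_mult_axis[symmetric]
    by (simp add: chol_axis v hinner_axis_axis)
qed

section \<open>Orthonormal families relative to a subspace\<close>

text \<open>The real inner product is the real part of \<open>hinner\<close>; replacing
  \<open>t\<close> by \<open>\<i> *s t\<close> tests the imaginary part as well.\<close>

lemma hinner_eq_0_of_real_orthogonal:
  assumes T: "vec.subspace T" and "\<And>t. t \<in> T \<Longrightarrow> z \<bullet> t = 0" and "t \<in> T"
  shows "hinner z t = 0"
proof -
  have "\<i> *s t \<in> T" using T assms(3) by (rule vec.subspace_scale)
  then have "Re (hinner z (\<i> *s t)) = 0" "Re (hinner z t) = 0"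
    using assms by (auto simp: Re_hinner)
  then show ?thesis by (simp add: hinner_scale_right complex_eq_iff)
qed

lemma vec_subspace_imp_subspace:
  fixes T :: "(complex^'n) set"
  assumes "vec.subspace T"
  shows "subspace T"
proof (rule subspaceI)
  fix c x assume "x \<in> T"
  have "c *\<^sub>R x = of_real c *s x"
    unfolding vec_eq_iff vector_scaleR_component vector_smult_component by (simp add: scaleR_conv_of_real)
  then show "c *\<^sub>R x \<in> T" using assms \<open>x \<in> T\<close> by (simp add: vec.subspace_scale)
qed (use assms in \<open>auto simp: vec.subspace_0 vec.subspace_add\<close>)

text \<open>Gram-Schmidt modulo \<open>T\<close>; the last hypothesis is independence of
  \<open>u\<close> modulo \<open>T\<close>. Each step normalizes the component of \<open>u a\<close>
  orthogonal to \<open>T\<close> and adjoins \<open>u a\<close> to \<open>T\<close>, so that the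
  vectors still to come are orthogonal to the new one. With \<open>T\<close> the image of
  \<open>cokernel_part\<close> this produces frames, with \<open>T = {0}\<close> orthonormal
  bases.\<close>

lemma orthonormal_family_exists:
  fixes u :: "'i \<Rightarrow> complex^'n"
  assumes "finite J" "vec.subspace T" "vec.subspace R" "T \<subseteq> R" "\<And>a. a \<in> J \<Longrightarrow> u a \<in> R"
    and "\<And>c a. (\<Sum>a\<in>J. c a *s u a) \<in> T \<Longrightarrow> a \<in> J \<Longrightarrow> c a = 0"
  shows "\<exists>w. (\<forall>a\<in>J. w a \<in> R \<and> (\<forall>t\<in>T. hinner (w a) t = 0)) \<and>
    (\<forall>a\<in>J. \<forall>b\<in>J. hinner (w a) (w b) = (if a = b then 1 else 0))"
  using assms
proof (induction J arbitrary: T rule: finite_induct)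
  case (insert a J)
  note T = \<open>vec.subspace T\<close> and R = \<open>vec.subspace R\<close>
  have sT: "subspace T" by (rule vec_subspace_imp_subspace[OF T])
  \<comment> \<open>The decomposition is orthogonal in the real sense; as \<open>T\<close> is a
    complex subspace, it is also orthogonal for \<open>hinner\<close>.\<close>
  obtain y z where yz: "y \<in> span T" "\<And>w. w \<in> span T \<Longrightarrow> orthogonal z w" "u a = y + z"
    using orthogonal_subspace_decomp_exists[of T "u a"] by blast
  have y: "y \<in> T" using yz(1) span_minimal[OF subset_refl sT] by blast
  have "z \<bullet> t = 0" if "t \<in> T" for t
    using yz(2)[OF span_base[OF that]] by (simp add: orthogonal_def)
  then have zT: "hinner z t = 0" if "t \<in> T" for t
    using that by (intro hinner_eq_0_of_real_orthogonal[OF T])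
  have zR: "z \<in> R"
  proof -
    have "u a \<in> R" "y \<in> R" using insert.prems(3,4) y by auto
    then have "u a - y \<in> R" by (rule vec.subspace_diff[OF R])
    then show ?thesis by (simp add: yz(3))
  qed
  \<comment> \<open>If the orthogonal component vanished, \<open>u a\<close> itself would be a
    combination lying in \<open>T\<close> with coefficient 1.\<close>
  have "z \<noteq> 0"
  proof
    assume "z = 0"
    then have ua: "u a \<in> T" using y yz by simp
    let ?c = "\<lambda>b. if b = a then 1 else 0 :: complex"
    have "(\<Sum>b\<in>insert a J. ?c b *s u b) = (\<Sum>b\<in>insert a J. if b = a then u b else 0)"
      by (intro sum.cong) auto
    then have "(\<Sum>b\<in>insert a J. ?c b *s u b) = u a"
      using insert.hyps by (simp del: sum.insert)
    then have "(\<Sum>b\<in>insert a J. ?c b *s u b) \<in> T" using ua by (simp only:)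
    then have "?c a = 0" by (rule insert.prems(5)[of ?c a]) simp
    then show False by simp
  qed
  define wa where "wa = of_real (1 / norm z) *s z"
  have wa: "hinner wa wa = 1"
  proof -
    have "hinner wa wa = of_real (1 / norm z * (1 / norm z) * (norm z)\<^sup>2)"
      unfolding wa_def hinner_scale_left hinner_scale_right unfolding hinner_self by simp
    also have "1 / norm z * (1 / norm z) * (norm z)\<^sup>2 = 1"
      using \<open>z \<noteq> 0\<close> by (simp add: power2_eq_square)
    finally show ?thesis by simp
  qed
  define T' where "T' = {t + c *s u a | t c. t \<in> T}"
  have TT': "T \<subseteq> T'"
  proof
    fix t assume "t \<in> T"
    moreover have "t = t + 0 *s u a" by simp
    ultimately show "t \<in> T'" unfolding T'_def by blast
  qed
  have T': "vec.subspace T'"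
  proof (rule vec.subspaceI)
    show "0 \<in> T'" using TT' vec.subspace_0[OF T] by blast
  next
    fix x y assume "x \<in> T'" "y \<in> T'"
    then obtain t c t' c' where *: "x = t + c *s u a" "y = t' + c' *s u a" "t \<in> T" "t' \<in> T"
      unfolding T'_def by blast
    then have "x + y = (t + t') + (c + c') *s u a" by (simp add: vec.scale_left_distrib)
    then show "x + y \<in> T'" unfolding T'_def using * vec.subspace_add[OF T] by blast
  next
    fix k x assume "x \<in> T'"
    then obtain t c where *: "x = t + c *s u a" "t \<in> T" unfolding T'_def by blast
    then have "k *s x = k *s t + (k * c) *s u a" by (simp add: vec.scale_right_distrib)
    then show "k *s x \<in> T'" unfolding T'_def using * vec.subspace_scale[OF T] by blast
  qed
  have waT': "wa \<in> T'"
  proof -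
    have "z = - y + 1 *s u a" using yz(3) by simp
    then have "z \<in> T'" unfolding T'_def using vec.subspace_neg[OF T y] by blast
    then show ?thesis unfolding wa_def by (rule vec.subspace_scale[OF T'])
  qed
  have "\<exists>w. (\<forall>b\<in>J. w b \<in> R \<and> (\<forall>t\<in>T'. hinner (w b) t = 0)) \<and>
    (\<forall>b\<in>J. \<forall>c\<in>J. hinner (w b) (w c) = (if b = c then 1 else 0))"
  proof (rule insert.IH[OF T' R])
    show "T' \<subseteq> R"
      unfolding T'_def using insert.prems R by (auto intro!: vec.subspace_add vec.subspace_scale)
    show "u b \<in> R" if "b \<in> J" for b using insert.prems that by auto
    fix c b assume c: "(\<Sum>b\<in>J. c b *s u b) \<in> T'" and "b \<in> J"
    then obtain t k where t: "(\<Sum>b\<in>J. c b *s u b) = t + k *s u a" "t \<in> T" unfolding T'_def by blast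
    \<comment> \<open>Moving \<open>k *s u a\<close> to the other side gives a combination over
      \<open>insert a J\<close> that lies in \<open>T\<close>.\<close>
    let ?c = "\<lambda>b. if b = a then - k else c b"
    have "(\<Sum>b\<in>insert a J. ?c b *s u b) = - k *s u a + (\<Sum>b\<in>J. c b *s u b)"
      using insert.hyps by (subst sum.insert) (auto intro!: sum.cong)
    then have "(\<Sum>b\<in>insert a J. ?c b *s u b) = t" using t by simp
    then have "?c b = 0" using insert.prems(5)[of ?c b] t \<open>b \<in> J\<close> by auto
    then show "c b = 0" using insert.hyps \<open>b \<in> J\<close> by (auto split: if_splits)
  qed
  then obtain w where w: "\<And>b. b \<in> J \<Longrightarrow> w b \<in> R" "\<And>b t. b \<in> J \<Longrightarrow> t \<in> T' \<Longrightarrow> hinner (w b) t = 0"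
    "\<And>b c. b \<in> J \<Longrightarrow> c \<in> J \<Longrightarrow> hinner (w b) (w c) = (if b = c then 1 else 0)" by blast
  have wa_w: "hinner wa (w b) = 0" "hinner (w b) wa = 0" if "b \<in> J" for b
    using w(2)[OF that waT'] cnj_hinner[of "w b" wa] by auto
  have "hinner wa t = 0" if "t \<in> T" for t
    using zT[OF that] by (simp add: wa_def hinner_scale_left)
  moreover have "wa \<in> R" unfolding wa_def using zR R by (rule vec.subspace_scale[rotated])
  ultimately show ?case
    using w wa wa_w insert.hyps TT'
    by (intro exI[of _ "w(a := wa)"]) auto
qed simp

lemma invertible_obtain:
  fixes f :: "'a::semiring_1^'n^'n"
  assumes "invertible f"
  obtains f' where "f ** f' = mat 1" "f' ** f = mat 1"
  using assms unfolding invertible_def by blast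

lemma cmatrix_eq_axis:
  fixes A B :: "complex^'n^'m"
  assumes "\<And>j. A *v axis j 1 = B *v axis j 1"
  shows "A = B"
  unfolding vec_eq_iff
proof (intro allI)
  fix i j
  show "A $ i $ j = B $ i $ j"
    using arg_cong[OF assms[of j], of "\<lambda>v. v $ i"] by (simp only: cmatrix_vector_mult_axis)
qed

lemma cvec_expansion: "x = (\<Sum>i\<in>UNIV. x $ i *s axis i (1::complex))"
  unfolding vec_eq_iff
proof
  fix k
  have "(\<Sum>i\<in>UNIV. x $ i *s axis i (1::complex)) $ k = (\<Sum>i\<in>UNIV. if i = k then x $ i else 0)"
    unfolding sum_component by (intro sum.cong) (auto simp: axis_def)
  then show "x $ k = (\<Sum>i\<in>UNIV. x $ i *s axis i (1::complex)) $ k" by simp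
qed

section \<open>Local sections of the similarity orbit\<close>

lemma open_invertible: "open {A :: complex^'n^'n. invertible A}"
proof -
  have "continuous_on UNIV (\<lambda>A :: complex^'n^'n. det A)"
    unfolding det_def by (intro continuous_intros)
  then have "open ((\<lambda>A :: complex^'n^'n. det A) -` (- {0}))"
    by (intro open_vimage) auto
  then show ?thesis by (simp add: vimage_def invertible_det_nz)
qed

lemma cmatrix_mult_bound:
  "\<exists>C>0. \<forall>(A :: complex^'n^'n) (B :: complex^'n^'n). norm (A ** B) \<le> C * norm A * norm B"
proof -
  have "bilinear ((**) :: complex^'n^'n \<Rightarrow> _ \<Rightarrow> complex^'n^'n)"
    unfolding bilinear_def
    by (auto intro!: linearI simp: vec_eq_iff matrix_matrix_mult_def
        scaleR_sum_right sum.distrib algebra_simps)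
  from bilinear_bounded_pos[OF this] show ?thesis by simp
qed

lemma cmatrix_vector_mult_bound:
  "\<exists>C>0. \<forall>(A :: complex^'n^'n) x. norm (A *v x) \<le> C * norm A * norm x"
proof -
  have "bilinear ((*v) :: complex^'n^'n \<Rightarrow> _ \<Rightarrow> complex^'n)"
    unfolding bilinear_def
    by (auto intro!: linearI simp: vec_eq_iff matrix_vector_mult_def
        scaleR_sum_right sum.distrib algebra_simps)
  from bilinear_bounded_pos[OF this] show ?thesis by (auto simp: mult_ac)
qed

text \<open>A continuous local section of the orbit map: the kernels of the operators
  \<open>m \<mapsto> N m - m X\<^sub>0\<close> have constant dimension along the orbit, hence vary continuously.\<close>

lemma similarity_local_section:
  fixes X0 N f :: "complex^'n^'n"
  assumes f: "invertible f" "N ** f = f ** X0" and "e > 0"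
  shows "\<exists>\<delta>>0. \<forall>N'. (\<exists>g. invertible g \<and> N' ** g = g ** X0) \<longrightarrow> dist N' N < \<delta> \<longrightarrow>
    (\<exists>f'. invertible f' \<and> N' ** f' = f' ** X0 \<and> dist f' f < e)"
proof -
  obtain C where C: "C > 0" "\<And>(A :: complex^'n^'n) (B :: complex^'n^'n). norm (A ** B) \<le> C * norm A * norm B"
    using cmatrix_mult_bound by blast
  define L where "L = (\<lambda>(N :: complex^'n^'n) m. N ** m - m ** X0)"
  have linL: "linear (L N)" for N
    unfolding L_def
    by (rule linearI) (simp_all add: vec_eq_iff matrix_matrix_mult_def
        scaleR_sum_right sum.distrib algebra_simps)
  define Kr where "Kr = (\<lambda>N. {m. L N m = 0})"
  have subK: "subspace (Kr N)" for N
    unfolding Kr_def by (rule linear_subspace_kernel[OF linL])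
  \<comment> \<open>Left multiplication by \<open>g\<close> identifies the centralizer of
    \<open>X0\<close> with the kernel at \<open>N'\<close>.\<close>
  have dimK: "dim (Kr N') = dim (Kr X0)" if g: "invertible g" "N' ** g = g ** X0" for N' g
  proof -
    obtain g' where g': "g ** g' = mat 1" "g' ** g = mat 1" using g(1) by (rule invertible_obtain)
    have "Kr N' = (\<lambda>m. g ** m) ` Kr X0"
    proof (intro equalityI subsetI)
      fix m assume "m \<in> Kr N'"
      then have m: "N' ** m = m ** X0" by (simp add: Kr_def L_def)
      have "X0 ** g' = g' ** N'"
        using g(2) g' by (metis matrix_mul_assoc matrix_mul_lid matrix_mul_rid)
      then have "X0 ** (g' ** m) = (g' ** m) ** X0"
        using m by (metis matrix_mul_assoc)
      then have "g' ** m \<in> Kr X0" by (simp add: Kr_def L_def)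
      moreover have "m = g ** (g' ** m)" using g' by (simp add: matrix_mul_assoc)
      ultimately show "m \<in> (\<lambda>m. g ** m) ` Kr X0" by blast
    next
      fix m assume "m \<in> (\<lambda>m. g ** m) ` Kr X0"
      then obtain k where "m = g ** k" "X0 ** k = k ** X0" by (auto simp: Kr_def L_def)
      then have "N' ** m = m ** X0" using g(2) by (metis matrix_mul_assoc)
      then show "m \<in> Kr N'" by (simp add: Kr_def L_def)
    qed
    moreover have "linear (\<lambda>m. g ** m)"
      by (rule linearI) (simp_all add: matrix_add_ldistrib vec_eq_iff matrix_matrix_mult_def
          scaleR_sum_right algebra_simps)
    moreover have "inj (\<lambda>m. g ** m)"
      by (rule injI) (metis g'(2) matrix_mul_assoc matrix_mul_lid)
    ultimately show ?thesis
      by (metis dim_image_eq inj_on_subset subset_UNIV)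
  qed
  define Cp where "Cp = {c. \<forall>k\<in>Kr N. orthogonal k c}"
  have subC: "subspace Cp"
    unfolding Cp_def by (rule subspace_orthogonal_to_vectors)
  have dimC: "dim (Kr N) + dim Cp = DIM(complex^'n^'n)"
    unfolding Cp_def using dim_subspace_orthogonal_to_vectors[OF subK subspace_UNIV, of N] by simp
  have inj: "\<forall>c\<in>Cp. L N c = 0 \<longrightarrow> c = 0"
    by (auto simp: Cp_def Kr_def orthogonal_def)
  \<comment> \<open>\<open>L N\<close> is injective on the orthogonal complement \<open>Cp\<close>
    of its kernel, hence bounded below there.\<close>
  have "\<exists>\<epsilon>>0. \<forall>c\<in>Cp. norm (L N c) \<ge> \<epsilon> * norm c"
    using inj subC linL by (intro injective_imp_isometric closed_subspace) (auto simp: linear_conv_bounded_linear)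
  then obtain \<epsilon> where \<epsilon>: "\<epsilon> > 0" "\<And>c. c \<in> Cp \<Longrightarrow> norm (L N c) \<ge> \<epsilon> * norm c" by blast
  obtain e' where e': "e' > 0" "\<And>m. dist m f < e' \<Longrightarrow> invertible m"
    using open_invertible[where 'n='n] f(1) unfolding open_dist by blast
  define \<eta> where "\<eta> = min e e'"
  have "\<eta> > 0" using e' \<open>e > 0\<close> by (simp add: \<eta>_def)
  \<comment> \<open>The first bound keeps \<open>L N'\<close> bounded below by \<epsilon>/2 on
    \<open>Cp\<close>, the second makes the correction to \<open>f\<close> smaller than
    \<eta>.\<close>
  define \<delta> where "\<delta> = min (\<epsilon> / (2 * C)) (\<epsilon> * \<eta> / (2 * C * (norm f + 1)))"
  have "\<delta> > 0" using \<epsilon> C \<open>\<eta> > 0\<close> by (auto simp: \<delta>_def intro!: divide_pos_pos mult_pos_pos add_nonneg_pos)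
  moreover have "\<exists>f'. invertible f' \<and> N' ** f' = f' ** X0 \<and> dist f' f < e"
    if g: "invertible g" "N' ** g = g ** X0" and d: "dist N' N < \<delta>" for N' g
  proof -
    have lower: "norm (L N' c) \<ge> \<epsilon> / 2 * norm c" if "c \<in> Cp" for c
    proof -
      have "norm (L N c) \<le> norm (L N' c) + norm ((N - N') ** c)"
      proof -
        have "L N c = L N' c + (N - N') ** c"
          by (simp add: L_def vec_eq_iff matrix_matrix_mult_def sum_subtractf algebra_simps)
        then show ?thesis by (metis norm_triangle_ineq)
      qed
      moreover have "norm ((N - N') ** c) \<le> C * norm (N - N') * norm c" by (rule C)
      moreover have "C * norm (N - N') * norm c \<le> \<epsilon> / 2 * norm c"
      proof (rule mult_right_mono)
        have "norm (N - N') < \<epsilon> / (2 * C)" using d by (simp add: \<delta>_def dist_norm norm_minus_commute)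
        then show "C * norm (N - N') \<le> \<epsilon> / 2" using C(1) by (simp add: field_simps)
      qed simp
      ultimately show ?thesis using \<epsilon>(2)[OF that] by (simp add: field_simps)
    qed
    \<comment> \<open>\<open>Kr N'\<close> has the same dimension as \<open>Kr N\<close>, so a
      trivial intersection with \<open>Cp\<close> forces the two to span the whole space.\<close>
    have "Kr N' \<inter> Cp \<subseteq> {0}"
    proof
      fix c assume c: "c \<in> Kr N' \<inter> Cp"
      then have "\<epsilon> / 2 * norm c \<le> 0" using lower[of c] by (simp add: Kr_def)
      then show "c \<in> {0}" using \<epsilon>(1) by (simp add: mult_le_0_iff)
    qed
    then have 0: "dim (Kr N' \<inter> Cp) = 0" by (simp add: dim_eq_0)
    have "dim {x + y |x y. x \<in> Kr N' \<and> y \<in> Cp} + dim (Kr N' \<inter> Cp) = dim (Kr N') + dim Cp"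
      by (rule dim_sums_Int[OF subK subC])
    moreover have "dim (Kr N') = dim (Kr N)" using dimK[OF g] dimK[OF f] by simp
    ultimately have "dim {x + y |x y. x \<in> Kr N' \<and> y \<in> Cp} = DIM(complex^'n^'n)" using 0 dimC by simp
    then have "span {x + y |x y. x \<in> Kr N' \<and> y \<in> Cp} = UNIV" using dim_eq_full by blast
    moreover have "subspace {x + y |x y. x \<in> Kr N' \<and> y \<in> Cp}" by (rule subspace_sums[OF subK subC])
    ultimately have "f \<in> {x + y |x y. x \<in> Kr N' \<and> y \<in> Cp}"
      using span_minimal[OF subset_refl, of "{x + y |x y. x \<in> Kr N' \<and> y \<in> Cp}"] by blast
    \<comment> \<open>The component \<open>k\<close> of \<open>f\<close> in \<open>Kr N'\<close> is
      the new similarity; \<open>c\<close> is small because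
      \<open>L N' c = (N' - N) ** f\<close>.\<close>
    then obtain k c where kc: "f = k + c" "k \<in> Kr N'" "c \<in> Cp" by blast
    have "L N' f = L N' c"
      using kc by (simp add: linear_add[OF linL] Kr_def)
    moreover have "L N' f = (N' - N) ** f"
      using f(2) by (simp add: L_def vec_eq_iff matrix_matrix_mult_def sum_subtractf algebra_simps)
    ultimately have "\<epsilon> / 2 * norm c \<le> norm ((N' - N) ** f)" using lower[OF kc(3)] by simp
    also have "\<dots> \<le> C * norm (N' - N) * norm f" by (rule C)
    also have "\<dots> \<le> C * norm (N' - N) * (norm f + 1)" using C(1) by (intro mult_left_mono) auto
    also have "\<dots> < C * (\<epsilon> * \<eta> / (2 * C * (norm f + 1))) * (norm f + 1)"
    proof -
      have "norm (N' - N) < \<epsilon> * \<eta> / (2 * C * (norm f + 1))" using d by (simp add: \<delta>_def dist_norm)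
      moreover have "norm f + 1 > 0" by (simp add: add_nonneg_pos)
      ultimately show ?thesis using C(1) by (intro mult_strict_right_mono mult_strict_left_mono)
    qed
    also have "\<dots> = \<epsilon> / 2 * \<eta>"
    proof -
      have "norm f + 1 \<noteq> 0" using norm_ge_zero[of f] by linarith
      moreover have "C * (\<epsilon> * \<eta> / (2 * C * F)) * F = \<epsilon> / 2 * \<eta>" if "F \<noteq> 0" for F
        using that C(1) by (simp add: field_simps)
      ultimately show ?thesis by blast
    qed
    finally have "norm c < \<eta>" using \<epsilon>(1) by simp
    moreover have "dist k f = norm c" using kc(1) by (simp add: dist_norm)
    ultimately have "dist k f < e" "dist k f < e'" by (simp_all add: \<eta>_def)
    moreover have "N' ** k = k ** X0" using kc(2) by (simp add: Kr_def L_def)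
    ultimately show ?thesis using e'(2) by blast
  qed
  ultimately show ?thesis by blast
qed

section \<open>Averaging over a compact group\<close>

text \<open>By the parallelogram law no length is left for \<open>a - b\<close> when
  \<open>a + b\<close> is as long as two vectors of norm at most \<mu> allow.\<close>

lemma strict_convexity_norm:
  fixes a b :: "'a::real_inner"
  assumes "norm a \<le> \<mu>" "norm b \<le> \<mu>" "2 * \<mu> \<le> norm (a + b)"
  shows "a = b"
proof -
  have "0 \<le> \<mu>" using assms(1) norm_ge_zero[of a] by linarith
  have "(norm (a - b))\<^sup>2 + (norm (a + b))\<^sup>2 = 2 * (norm a)\<^sup>2 + 2 * (norm b)\<^sup>2"
    by (simp add: power2_norm_eq_inner inner_add_left inner_add_right inner_diff_left inner_diff_right inner_commute)
  moreover have "(norm a)\<^sup>2 \<le> \<mu>\<^sup>2" "(norm b)\<^sup>2 \<le> \<mu>\<^sup>2"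
    using assms by (auto intro: power_mono)
  moreover have "(2 * \<mu>)\<^sup>2 \<le> (norm (a + b))\<^sup>2"
    using assms(3) \<open>0 \<le> \<mu>\<close> by (intro power_mono) auto
  then have "4 * \<mu>\<^sup>2 \<le> (norm (a + b))\<^sup>2" by (simp add: power_mult_distrib)
  ultimately have "(norm (a - b))\<^sup>2 \<le> 0" by linarith
  then show ?thesis by simp
qed

text \<open>A minimizer over \<open>S\<close> of the invariant function \<open>x \<mapsto> sup\<^sub>k norm (act k x)\<close> is unique,
  because the norm is strictly convex; hence it is fixed.\<close>

lemma compact_linear_action_fixed_point:
  fixes act :: "'k::metric_space \<Rightarrow> 'a::euclidean_space \<Rightarrow> 'a"
  assumes K: "compact K" "K \<noteq> {}" and S: "compact S" "convex S" "S \<noteq> {}"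
    and cont: "continuous_on (K \<times> UNIV) (\<lambda>(k, x). act k x)"
    and lin: "\<And>k. k \<in> K \<Longrightarrow> linear (act k)" and inj: "\<And>k. k \<in> K \<Longrightarrow> inj (act k)"
    and comp: "\<And>j k. j \<in> K \<Longrightarrow> k \<in> K \<Longrightarrow> \<exists>l\<in>K. \<forall>x. act j (act k x) = act l x"
    and inv: "\<And>k x. k \<in> K \<Longrightarrow> x \<in> S \<Longrightarrow> act k x \<in> S"
  shows "\<exists>x\<in>S. \<forall>k\<in>K. act k x = x"
proof -
  define F where "F x = (SUP k\<in>K. norm (act k x))" for x
  have contk: "continuous_on K (\<lambda>k. norm (act k x))" for x
    by (intro continuous_on_norm continuous_on_compose2[OF cont, of K "\<lambda>k. (k, x)", simplified] continuous_intros) auto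
  have att: "\<exists>k\<in>K. F x = norm (act k x) \<and> (\<forall>j\<in>K. norm (act j x) \<le> F x)" for x
  proof -
    obtain k where k: "k \<in> K" "\<forall>j\<in>K. norm (act j x) \<le> norm (act k x)"
      using continuous_attains_sup[OF K contk] by blast
    then have "F x = norm (act k x)" unfolding F_def by (intro cSup_eq_maximum) auto
    then show ?thesis using k by auto
  qed
  have "compact ((\<lambda>(k, x). act k x) ` (K \<times> sphere 0 1))"
    by (intro compact_continuous_image continuous_on_subset[OF cont] compact_Times K) auto
  then obtain M where M: "\<And>y. y \<in> (\<lambda>(k, x). act k x) ` (K \<times> sphere 0 1) \<Longrightarrow> norm y \<le> M"
    using compact_imp_bounded bounded_iff by metis
  have op: "norm (act k x) \<le> \<bar>M\<bar> * norm x" if "k \<in> K" for k x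
  proof (cases "x = 0")
    case True
    then show ?thesis using linear_0[OF lin[OF that]] by simp
  next
    case False
    have "norm (act k ((1 / norm x) *\<^sub>R x)) \<le> M"
      using that False by (intro M image_eqI[of _ _ "(k, (1 / norm x) *\<^sub>R x)"]) auto
    then have "norm (act k x) / norm x \<le> M"
      using linear_scale[OF lin[OF that]] by simp
    then have "norm (act k x) \<le> M * norm x" using False by (simp add: field_simps)
    also have "\<dots> \<le> \<bar>M\<bar> * norm x" by (intro mult_right_mono) auto
    finally show ?thesis .
  qed
  \<comment> \<open>A supremum of functions with a common Lipschitz constant has that constant too,
    so \<open>F\<close> is continuous and attains its minimum on \<open>S\<close>.\<close>
  have lip: "F x \<le> F y + \<bar>M\<bar> * dist x y" for x y
  proof -
    obtain k where k: "k \<in> K" "F x = norm (act k x)" using att by blast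
    have "act k x = act k y + act k (x - y)" using linear_diff[OF lin[OF k(1)]] by simp
    then have "norm (act k x) \<le> norm (act k y) + norm (act k (x - y))" by (metis norm_triangle_ineq)
    moreover have "norm (act k y) \<le> F y" using att[of y] k(1) by blast
    ultimately show ?thesis using k(2) op[OF k(1), of "x - y"] by (simp add: dist_norm)
  qed
  have "\<bar>M\<bar>-lipschitz_on S F"
  proof (rule lipschitz_onI)
    fix x y
    show "dist (F x) (F y) \<le> \<bar>M\<bar> * dist x y"
      unfolding dist_real_def abs_le_iff using lip[of x y] lip[of y x] by (simp add: dist_commute[of y x])
  qed simp
  then have "continuous_on S F" by (rule lipschitz_on_continuous_on)
  then obtain p where p: "p \<in> S" "\<And>x. x \<in> S \<Longrightarrow> F p \<le> F x"
    using continuous_attains_inf[OF S(1,3)] by blast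
  have "act k p = p" if k: "k \<in> K" for k
  proof -
    \<comment> \<open>At the midpoint of \<open>p\<close> and \<open>act k p\<close> the value of
      \<open>F\<close> is not smaller than at \<open>p\<close>. For an index \<open>j\<close>
      attaining it, \<open>act j p\<close> and \<open>act j (act k p)\<close> have norm at most
      \<open>F p\<close> while their sum has norm at least \<open>2 * F p\<close>, so they
      coincide.\<close>
    define m where "m = (1 / 2) *\<^sub>R p + (1 / 2) *\<^sub>R act k p"
    have "m \<in> S" unfolding m_def using S(2) p(1) inv[OF k p(1)] by (intro convexD) auto
    then have Fm: "F p \<le> F m" by (rule p(2))
    obtain j where j: "j \<in> K" "F m = norm (act j m)" using att by blast
    obtain l where l: "l \<in> K" "\<And>x. act j (act k x) = act l x" using comp[OF j(1) k] by blast
    have "act j p = act l p"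
    proof (rule strict_convexity_norm)
      show "norm (act j p) \<le> F p" "norm (act l p) \<le> F p" using att[of p] j(1) l(1) by auto
      have "2 *\<^sub>R act j m = act j p + act l p"
        unfolding m_def linear_add[OF lin[OF j(1)]] linear_scale[OF lin[OF j(1)]] l(2)
        by (simp add: scaleR_add_right)
      then have "norm (act j p + act l p) = 2 * norm (act j m)" by (metis norm_scaleR abs_numeral)
      then show "2 * F p \<le> norm (act j p + act l p)" using Fm j(2) by simp
    qed
    then have "act j p = act j (act k p)" by (simp add: l(2))
    then show "act k p = p" using inj[OF j(1)] by (simp add: inj_eq)
  qed
  then show ?thesis using p(1) by blast
qed

lemma linear_cmatrix_mult:
  "linear (\<lambda>P :: complex^'n^'n. A ** P)" "linear (\<lambda>P :: complex^'n^'n. P ** B)"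
  by (auto intro!: linearI simp: vec_eq_iff matrix_matrix_mult_def scaleR_sum_right sum.distrib algebra_simps)

text \<open>The fixed point lemma takes the place of an average over Haar measure. The fixed point
  is positive definite because the positive definite forms are a convex set containing every
  \<open>conj_transpose k ** k\<close>.\<close>

lemma invariant_posdef_form:
  fixes K :: "(complex^'n^'n) set"
  assumes K: "compact K" "mat 1 \<in> K" and mult: "\<And>j k. j \<in> K \<Longrightarrow> k \<in> K \<Longrightarrow> j ** k \<in> K"
    and inv: "\<And>k. k \<in> K \<Longrightarrow> invertible k"
  shows "\<exists>P. posdef P \<and> (\<forall>k\<in>K. conj_transpose k ** P ** k = P)"
proof -
  let ?act = "\<lambda>k P. conj_transpose k ** P ** k"
  let ?S = "convex hull ((\<lambda>k. ?act k (mat 1)) ` K)"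
  have lin: "linear (?act k)" for k :: "complex^'n^'n"
    using linear_compose[OF linear_cmatrix_mult(1)[of "conj_transpose k"] linear_cmatrix_mult(2)[of k]]
    by (simp add: o_def)
  \<comment> \<open>Congruence is a right action, so products come out reversed.\<close>
  have act: "?act j (?act k P) = ?act (k ** j) P" for j k P :: "complex^'n^'n"
    by (simp add: conj_transpose_mult matrix_mul_assoc)
  have "\<exists>P\<in>?S. \<forall>k\<in>K. ?act k P = P"
  proof (rule compact_linear_action_fixed_point[OF K(1)])
    show "compact ?S"
      by (intro compact_convex_hull compact_continuous_image K continuous_intros)
    show "continuous_on (K \<times> UNIV) (\<lambda>(k, P). ?act k P)"
      unfolding case_prod_unfold by (intro continuous_intros)
    show "inj (?act k)" if k: "k \<in> K" for k
    proof (rule injI)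
      fix P Q assume eq: "?act k P = ?act k Q"
      obtain k' where k': "k ** k' = mat 1" using inv[OF k] by (rule invertible_obtain)
      have "?act k' (?act k P) = P" for P
        unfolding act k' by simp
      then show "P = Q" using eq by metis
    qed
    show "\<exists>l\<in>K. \<forall>P. ?act j (?act k P) = ?act l P" if "j \<in> K" "k \<in> K" for j k
      using mult[OF that(2,1)] act by blast
    show "?act k P \<in> ?S" if "k \<in> K" "P \<in> ?S" for k P
    proof -
      have "?act k P \<in> ?act k ` ?S" using that by blast
      also have "\<dots> = convex hull (?act k ` (\<lambda>k. ?act k (mat 1)) ` K)"
        by (rule convex_hull_linear_image[OF lin])
      also have "\<dots> \<subseteq> ?S"
      proof (rule hull_mono, rule subsetI)
        fix Q assume "Q \<in> ?act k ` (\<lambda>k. ?act k (mat 1)) ` K"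
        then obtain j where j: "j \<in> K" "Q = ?act k (?act j (mat 1))" by blast
        then have "j ** k \<in> K" using mult that(1) by blast
        then show "Q \<in> (\<lambda>k. ?act k (mat 1)) ` K" unfolding j(2) act by blast
      qed
      finally show ?thesis .
    qed
  qed (use K lin in auto)
  then obtain P where P: "P \<in> ?S" "\<forall>k\<in>K. ?act k P = P" by blast
  have "?S \<subseteq> {P. posdef P}"
  proof (rule hull_minimal)
    show "convex {P :: complex^'n^'n. posdef P}"
      unfolding convex_alt using posdef_convex by blast
    show "(\<lambda>k. ?act k (mat 1)) ` K \<subseteq> {P. posdef P}"
    proof (intro image_subsetI CollectI)
      fix k assume "k \<in> K"
      then obtain k' where "k ** k' = mat 1" "k' ** k = mat 1" using inv invertible_obtain by metis
      then have "conj_transpose k' ** conj_transpose k = mat 1" "conj_transpose k ** conj_transpose k' = mat 1"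
        by (simp_all add: conj_transpose_mult[symmetric])
      then have "invertible (conj_transpose k)" unfolding invertible_def by blast
      from posdef_mult_conj_transpose[OF this] show "posdef (?act k (mat 1))" by simp
    qed
  qed
  then show ?thesis using P by blast
qed

section \<open>Nilpotent shifts and their frames\<close>

lemma matrix_vector_scaleC: "(A :: complex^'n^'m) *v (c *s x) = c *s (A *v x)"
  by (rule vector_scalar_commute)

lemma isometric_on_support:
  fixes g :: "complex^'n^'m"
  assumes g: "\<And>i j. i \<in> S \<Longrightarrow> j \<in> S \<Longrightarrow> hinner (g *v axis i 1) (g *v axis j 1) = (if i = j then 1 else 0)"
    and x: "\<And>b. x $ b \<noteq> 0 \<Longrightarrow> b \<in> S" and y: "\<And>b. y $ b \<noteq> 0 \<Longrightarrow> b \<in> S"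
  shows "hinner (g *v x) (g *v y) = hinner x y"
proof -
  have exp: "g *v x = (\<Sum>i\<in>UNIV. x $ i *s (g *v axis i 1))" for x :: "complex^'n"
    by (subst cvec_expansion) (simp add: linear_sum[OF matrix_vector_mul_linear] matrix_vector_scaleC)
  have B: "hinner v (g *v y) = (\<Sum>j\<in>UNIV. y $ j * hinner v (g *v axis j 1))" for v
    unfolding exp[of y] by (simp add: hinner_sum_right hinner_scale_right)
  have "hinner (g *v x) (g *v y) = (\<Sum>i\<in>UNIV. cnj (x $ i) * hinner (g *v axis i 1) (g *v y))"
    unfolding exp[of x] by (simp add: hinner_sum_left hinner_scale_left)
  also have "\<dots> = (\<Sum>i\<in>UNIV. \<Sum>j\<in>UNIV. cnj (x $ i) * (y $ j * hinner (g *v axis i 1) (g *v axis j 1)))"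
    unfolding B by (simp only: sum_distrib_left)
  also have "\<dots> = (\<Sum>i\<in>UNIV. \<Sum>j\<in>UNIV. if j = i then cnj (x $ i) * y $ j else 0)"
  proof (intro sum.cong refl)
    fix i j
    show "cnj (x $ i) * (y $ j * hinner (g *v axis i 1) (g *v axis j 1)) =
        (if j = i then cnj (x $ i) * y $ j else 0)"
      using g[of i j] x[of i] y[of j] by (cases "x $ i = 0 \<or> y $ j = 0") auto
  qed
  also have "\<dots> = hinner x y" by (simp add: hinner_def)
  finally show ?thesis .
qed

text \<open>The label \<open>(d, l, i)\<close> of an index stands for the basis vector \<open>X\<^sup>l v\<^sup>d\<^sub>i\<close> of \<open>\<B>\<close>.\<close>

locale shift_matrix =
  fixes lab :: "'n::finite \<Rightarrow> nat \<times> nat \<times> nat"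
  assumes inj_lab: "inj lab"
    and lab_less: "fst (snd (lab a)) < fst (lab a)"
    and lab_exists: "l < fst (lab a) \<Longrightarrow> \<exists>b. lab b = (fst (lab a), l, snd (snd (lab a)))"
begin

definition blk :: "'n \<Rightarrow> nat" where "blk a = fst (lab a)"
definition lev :: "'n \<Rightarrow> nat" where "lev a = fst (snd (lab a))"
definition num :: "'n \<Rightarrow> nat" where "num a = snd (snd (lab a))"

text \<open>The index at level \<open>l\<close> of the Jordan chain through \<open>a\<close>; an
  arbitrary value if \<open>l\<close> is not below \<open>blk a\<close>.\<close>

definition pos :: "'n \<Rightarrow> nat \<Rightarrow> 'n" where
  "pos a l = (SOME b. lab b = (blk a, l, num a))"

lemma lev_less: "lev a < blk a"
  using lab_less by (simp add: lev_def blk_def)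

lemma blk_pos: "0 < blk a"
  using lev_less[of a] by simp

lemma lab_eqI: "blk a = blk b \<Longrightarrow> lev a = lev b \<Longrightarrow> num a = num b \<Longrightarrow> a = b"
  using inj_lab by (auto simp: inj_def blk_def lev_def num_def prod_eq_iff)

lemma pos:
  assumes "l < blk a"
  shows "blk (pos a l) = blk a" "lev (pos a l) = l" "num (pos a l) = num a"
proof -
  have "\<exists>b. lab b = (blk a, l, num a)"
    using lab_exists[of l a] assms by (simp add: blk_def num_def)
  then have "lab (pos a l) = (blk a, l, num a)"
    unfolding pos_def by (rule someI_ex)
  then show "blk (pos a l) = blk a" "lev (pos a l) = l" "num (pos a l) = num a"
    by (simp_all add: blk_def lev_def num_def)
qed

lemma pos_pos: "l < blk a \<Longrightarrow> l' < blk a \<Longrightarrow> pos (pos a l) l' = pos a l'"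
  by (intro lab_eqI) (simp_all add: pos)

lemma pos_lev [simp]: "pos a (lev a) = a"
  by (intro lab_eqI) (simp_all add: pos lev_less)

text \<open>A nilpotent matrix in Jordan form, with one chain for each occurring pair of
  \<open>blk\<close> and \<open>num\<close>.\<close>

definition shift :: "complex^'n^'n" where
  "shift = (\<chi> c b. if blk c = blk b \<and> num c = num b \<and> lev c = Suc (lev b) then 1 else 0)"

abbreviation "sh \<equiv> (*v) shift"

lemma shift_nth: "(shift *v x) $ c = (if 0 < lev c then x $ pos c (lev c - Suc 0) else 0)"
proof -
  have l: "lev c - Suc 0 < blk c" using lev_less[of c] by linarith
  have "(blk c = blk b \<and> num c = num b \<and> lev c = Suc (lev b)) \<longleftrightarrow> 0 < lev c \<and> b = pos c (lev c - Suc 0)" for b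
    using pos[OF l] lab_eqI[of b "pos c (lev c - Suc 0)"] by auto
  note eq = this
  have "(shift *v x) $ c = (\<Sum>b\<in>UNIV. (if blk c = blk b \<and> num c = num b \<and> lev c = Suc (lev b) then 1 else 0) * x $ b)"
    by (simp add: shift_def matrix_vector_mult_def)
  also have "\<dots> = (\<Sum>b\<in>UNIV. if b = pos c (lev c - Suc 0) then (if 0 < lev c then x $ b else 0) else 0)"
    unfolding eq by (intro sum.cong) auto
  finally show ?thesis by simp
qed

lemma shift_pow_nth: "((sh ^^ k) x) $ c = (if k \<le> lev c then x $ pos c (lev c - k) else 0)"
proof (induction k arbitrary: c)
  case (Suc k)
  have l: "lev c - Suc 0 < blk c" "lev c - Suc k < blk c" using lev_less[of c] by linarith+
  show ?case
    using Suc[of "pos c (lev c - Suc 0)"] by (auto simp: shift_nth pos[OF l(1)] pos_pos[OF l])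
qed simp

lemma shift_pow_axis:
  assumes "l < blk b"
  shows "(sh ^^ l) (axis (pos b 0) 1) = axis (pos b l) 1"
proof -
  have "(if l \<le> lev c then axis (pos b 0) 1 $ pos c (lev c - l) else 0) = (axis (pos b l) 1 $ c :: complex)" for c
  proof -
    have c: "lev c - l < blk c" using lev_less[of c] by linarith
    have "l \<le> lev c \<and> pos c (lev c - l) = pos b 0 \<longleftrightarrow> c = pos b l"
    proof
      assume *: "l \<le> lev c \<and> pos c (lev c - l) = pos b 0"
      then have "lev c - l = 0" "blk c = blk b" "num c = num b"
        using pos[OF c] pos[of 0 b] blk_pos[of b] by metis+
      then show "c = pos b l" using * assms by (intro lab_eqI) (simp_all add: pos)
    next
      assume "c = pos b l"
      then show "l \<le> lev c \<and> pos c (lev c - l) = pos b 0"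
        using assms blk_pos[of b] by (simp add: pos pos_pos)
    qed
    then show ?thesis by (auto simp: axis_def)
  qed
  then show ?thesis
    unfolding vec_eq_iff shift_pow_nth by blast
qed

lemma axis_eq_shift_pow: "axis b 1 = (sh ^^ lev b) (axis (pos b 0) 1)"
  using shift_pow_axis[OF lev_less, of b] by simp

lemma shift_axis:
  "shift *v axis b 1 = (if Suc (lev b) < blk b then axis (pos b (Suc (lev b))) 1 else 0)"
proof -
  have "shift *v axis b 1 = (sh ^^ Suc (lev b)) (axis (pos b 0) 1)"
    by (subst axis_eq_shift_pow) simp
  also have "\<dots> = (if Suc (lev b) < blk b then axis (pos b (Suc (lev b))) 1 else 0)"
  proof (cases "Suc (lev b) < blk b")
    case False
    have "((sh ^^ Suc (lev b)) (axis (pos b 0) 1)) $ c = 0" for c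
    proof (cases "Suc (lev b) \<le> lev c \<and> pos c (lev c - Suc (lev b)) = pos b 0")
      case True
      have c: "lev c - Suc (lev b) < blk c" using lev_less[of c] by linarith
      have "blk c = blk b" using True pos(1)[OF c] pos(1)[OF blk_pos] by metis
      then show ?thesis using True False lev_less[of c] by linarith
    qed (auto simp: shift_pow_nth axis_def simp del: funpow.simps)
    then show ?thesis using False by (simp add: vec_eq_iff del: funpow.simps)
  qed (simp only: shift_pow_axis if_True)
  finally show ?thesis .
qed

definition Ker :: "nat \<Rightarrow> (complex^'n) set" where
  "Ker k = {x. (sh ^^ k) x = 0}"

text \<open>A basis vector at level \<open>l\<close> of a chain of length \<open>d\<close> dies
  after \<open>d - l\<close> steps, and different basis vectors that survive never collide under
  \<open>shift\<close>.\<close>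

lemma mem_Ker_iff: "x \<in> Ker k \<longleftrightarrow> (\<forall>b. x $ b \<noteq> 0 \<longrightarrow> blk b \<le> lev b + k)"
proof
  assume x: "x \<in> Ker k"
  show "\<forall>b. x $ b \<noteq> 0 \<longrightarrow> blk b \<le> lev b + k"
  proof (intro allI impI; rule ccontr)
    fix b assume "x $ b \<noteq> 0" "\<not> blk b \<le> lev b + k"
    then have b: "lev b + k < blk b" by simp
    have "((sh ^^ k) x) $ pos b (lev b + k) = x $ b"
      using b by (simp add: shift_pow_nth pos pos_pos lev_less)
    then show False using x \<open>x $ b \<noteq> 0\<close> by (simp add: Ker_def)
  qed
next
  assume *: "\<forall>b. x $ b \<noteq> 0 \<longrightarrow> blk b \<le> lev b + k"
  have "((sh ^^ k) x) $ c = 0" for c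
  proof (cases "k \<le> lev c")
    case True
    have "lev c - k < blk c" using lev_less[of c] by linarith
    then have "\<not> blk (pos c (lev c - k)) \<le> lev (pos c (lev c - k)) + k"
      using True lev_less[of c] by (simp add: pos)
    then show ?thesis using * by (auto simp: shift_pow_nth)
  qed (simp add: shift_pow_nth)
  then show "x \<in> Ker k" by (simp add: Ker_def vec_eq_iff)
qed

text \<open>A complement of the span of the \<open>axis a 1\<close> with \<open>blk a = d\<close>, \<open>lev a = 0\<close> in \<open>Ker d\<close>;
  it is invariant under the centralizer of \<open>shift\<close> by \<open>mem_cokernel_part_iff\<close>.\<close>

definition cokernel_part :: "nat \<Rightarrow> (complex^'n) set" where
  "cokernel_part d = {x. \<forall>b. x $ b \<noteq> 0 \<longrightarrow> blk b \<le> lev b + d \<and> \<not> (blk b = d \<and> lev b = 0)}"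

text \<open>The left side is a coordinate condition, the right side depends on \<open>shift\<close>
  alone. A basis vector of \<open>Ker d\<close> that does not start a chain of length
  \<open>d\<close> either starts a shorter chain, and lies in \<open>Ker (d - 1)\<close>, or has a
  predecessor, which lies in \<open>Ker (d + 1)\<close>.\<close>

lemma mem_cokernel_part_iff:
  assumes "0 < d"
  shows "x \<in> cokernel_part d \<longleftrightarrow> (\<exists>u\<in>Ker (d - 1). \<exists>y\<in>Ker (d + 1). x = u + shift *v y)"
proof
  assume x: "x \<in> cokernel_part d"
  define u where "u = (\<chi> b. if lev b = 0 then x $ b else 0)"
  define y where "y = (\<chi> c. if Suc (lev c) < blk c then x $ pos c (Suc (lev c)) else 0)"
  have "u \<in> Ker (d - 1)"
    unfolding mem_Ker_iff
  proof (intro allI impI)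
    fix b assume "u $ b \<noteq> 0"
    then have b: "lev b = 0" "x $ b \<noteq> 0" by (auto simp: u_def split: if_splits)
    then have "blk b \<le> lev b + d \<and> \<not> (blk b = d \<and> lev b = 0)" using x unfolding cokernel_part_def by blast
    then show "blk b \<le> lev b + (d - 1)" using b(1) by linarith
  qed
  moreover have "y \<in> Ker (d + 1)"
    unfolding mem_Ker_iff
  proof (intro allI impI)
    fix b assume "y $ b \<noteq> 0"
    then have b: "Suc (lev b) < blk b" "x $ pos b (Suc (lev b)) \<noteq> 0" by (auto simp: y_def split: if_splits)
    then have "blk (pos b (Suc (lev b))) \<le> lev (pos b (Suc (lev b))) + d" using x by (simp add: cokernel_part_def)
    then show "blk b \<le> lev b + (d + 1)" using b by (simp add: pos)
  qed
  moreover have "x = u + shift *v y"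
  proof -
    have "x $ c = u $ c + (shift *v y) $ c" for c
    proof (cases "lev c = 0")
      case False
      have l: "lev c - Suc 0 < blk c" "lev c < blk c" using lev_less[of c] by linarith+
      then show ?thesis using False by (simp add: u_def y_def shift_nth pos pos_pos)
    qed (simp add: u_def shift_nth)
    then show ?thesis by (simp add: vec_eq_iff)
  qed
  ultimately show "\<exists>u\<in>Ker (d - 1). \<exists>y\<in>Ker (d + 1). x = u + shift *v y" by blast
next
  assume "\<exists>u\<in>Ker (d - 1). \<exists>y\<in>Ker (d + 1). x = u + shift *v y"
  then obtain u y where uy: "u \<in> Ker (d - 1)" "y \<in> Ker (d + 1)" "x = u + shift *v y" by blast
  show "x \<in> cokernel_part d"
    unfolding cokernel_part_def
  proof (intro CollectI allI impI)
    fix b assume "x $ b \<noteq> 0"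
    then consider "u $ b \<noteq> 0" | "(shift *v y) $ b \<noteq> 0" using uy(3) by fastforce
    then show "blk b \<le> lev b + d \<and> \<not> (blk b = d \<and> lev b = 0)"
    proof cases
      case 1
      then have "blk b \<le> lev b + (d - 1)" using uy(1) by (simp add: mem_Ker_iff)
      then show ?thesis using assms by auto
    next
      case 2
      then have b: "0 < lev b" "y $ pos b (lev b - Suc 0) \<noteq> 0" by (auto simp: shift_nth split: if_splits)
      have l: "lev b - Suc 0 < blk b" using lev_less[of b] by linarith
      have "blk (pos b (lev b - Suc 0)) \<le> lev (pos b (lev b - Suc 0)) + (d + 1)"
        using b uy(2) by (simp add: mem_Ker_iff)
      then show ?thesis using b by (simp add: pos[OF l])
    qed
  qed
qed

lemma Ker_pred_subset_cokernel_part: "0 < d \<Longrightarrow> Ker (d - 1) \<subseteq> cokernel_part d"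
  by (fastforce simp: cokernel_part_def mem_Ker_iff)

lemma vec_subspace_support: "vec.subspace {x :: complex^'n. \<forall>b. x $ b \<noteq> 0 \<longrightarrow> P b}"
proof -
  have "{x :: complex^'n. \<forall>b. x $ b \<noteq> 0 \<longrightarrow> P b} = {x. \<forall>b. \<not> P b \<longrightarrow> x $ b = 0}" by blast
  then show ?thesis by (auto intro!: vec.subspaceI)
qed

lemma vec_subspace_Ker: "vec.subspace (Ker k)"
  using vec_subspace_support[of "\<lambda>b. blk b \<le> lev b + k"] by (simp add: mem_Ker_iff[symmetric])

lemma vec_subspace_cokernel_part: "vec.subspace (cokernel_part k)"
  unfolding cokernel_part_def by (rule vec_subspace_support)

lemma cokernel_part_subset_Ker: "cokernel_part d \<subseteq> Ker d"
  by (auto simp: cokernel_part_def mem_Ker_iff)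

lemma commutes_pow:
  assumes "z ** shift = shift ** z"
  shows "(sh ^^ k) (z *v x) = z *v (sh ^^ k) x"
  by (induction k) (simp_all add: matrix_vector_mul_assoc assms)

lemma commutes_Ker:
  assumes "z ** shift = shift ** z" "x \<in> Ker k"
  shows "z *v x \<in> Ker k"
  using assms by (simp add: Ker_def commutes_pow)

lemma commutes_cokernel_part:
  assumes z: "z ** shift = shift ** z" and x: "x \<in> cokernel_part d"
  shows "z *v x \<in> cokernel_part d"
proof (cases "d = 0")
  case True
  then have "x $ b = 0" for b
    using x lev_less[of b] by (fastforce simp: cokernel_part_def)
  then have "x = 0" by (simp add: vec_eq_iff)
  then show ?thesis using x by simp
next
  case False
  then have d: "0 < d" by simp
  obtain u y where uy: "u \<in> Ker (d - 1)" "y \<in> Ker (d + 1)" "x = u + shift *v y"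
    using x mem_cokernel_part_iff[OF d] by blast
  have "z *v x = z *v u + shift *v (z *v y)"
    by (simp add: uy(3) matrix_vector_right_distrib matrix_vector_mul_assoc z)
  then show ?thesis
    using mem_cokernel_part_iff[OF d] commutes_Ker[OF z uy(1)] commutes_Ker[OF z uy(2)] by blast
qed

section \<open>Frames and their uniqueness\<close>

text \<open>Orthonormality is asked among generators of chains of equal length. The matrix
  \<open>f\<close> serves to carry \<open>cokernel_part\<close> over to \<open>N\<close>; by
  \<open>frame_change\<close> another similarity gives the same condition.\<close>

definition frame :: "complex^'n^'n \<Rightarrow> complex^'n^'n \<Rightarrow> complex^'n^'n \<Rightarrow> bool" where
  "frame N f g \<longleftrightarrow> N ** g = g ** shift \<and>
    (\<forall>a b. lev a = 0 \<longrightarrow> lev b = 0 \<longrightarrow> blk a = blk b \<longrightarrow>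
      hinner (g *v axis a 1) (g *v axis b 1) = (if a = b then 1 else 0)) \<and>
    (\<forall>a x. lev a = 0 \<longrightarrow> x \<in> cokernel_part (blk a) \<longrightarrow> hinner (g *v axis a 1) (f *v x) = 0)"

lemma conj_commutes:
  assumes "f' ** f = mat 1" "f ** f' = mat 1" "N ** f = f ** shift" "N ** g = g ** shift"
  shows "(f' ** g) ** shift = shift ** (f' ** g)"
proof -
  have "f' ** N = shift ** f'"
    using assms by (metis matrix_mul_assoc matrix_mul_lid matrix_mul_rid)
  then show ?thesis using assms(4) by (metis matrix_mul_assoc)
qed

lemma frame_isometric:
  assumes g: "frame N f g" and x: "\<And>b. x $ b \<noteq> 0 \<Longrightarrow> blk b = d \<and> lev b = 0"
    and y: "\<And>b. y $ b \<noteq> 0 \<Longrightarrow> blk b = d \<and> lev b = 0"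
  shows "hinner (g *v x) (g *v y) = hinner x y"
proof (rule isometric_on_support[where S = "{b. blk b = d \<and> lev b = 0}"])
  show "hinner (g *v axis i 1) (g *v axis j 1) = (if i = j then 1 else 0)"
    if "i \<in> {b. blk b = d \<and> lev b = 0}" "j \<in> {b. blk b = d \<and> lev b = 0}" for i j
    using g that by (simp add: frame_def)
qed (use x y in blast)+

lemma frame_orthogonal:
  assumes g: "frame N f g" and x: "\<And>b. x $ b \<noteq> 0 \<Longrightarrow> blk b = d \<and> lev b = 0"
    and y: "y \<in> cokernel_part d"
  shows "hinner (g *v x) (f *v y) = 0"
proof -
  have "g *v x = (\<Sum>i\<in>UNIV. x $ i *s (g *v axis i 1))"
    by (subst cvec_expansion) (simp add: linear_sum[OF matrix_vector_mul_linear] matrix_vector_scaleC)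
  then have "hinner (g *v x) (f *v y) = (\<Sum>i\<in>UNIV. cnj (x $ i) * hinner (g *v axis i 1) (f *v y))"
    by (simp add: hinner_sum_left hinner_scale_left)
  also have "\<dots> = 0"
  proof (intro sum.neutral ballI)
    fix i
    show "cnj (x $ i) * hinner (g *v axis i 1) (f *v y) = 0"
      using g x[of i] y by (cases "x $ i = 0") (auto simp: frame_def)
  qed
  finally show ?thesis .
qed

lemma shift_nilpotent: "\<exists>k. (sh ^^ k) x = 0"
proof -
  have "x \<in> Ker (\<Sum>b\<in>UNIV. blk b)"
    unfolding mem_Ker_iff by (auto intro!: trans_le_add2 member_le_sum)
  then show ?thesis by (auto simp: Ker_def)
qed

text \<open>The kernel of \<open>z = f' ** g\<close> is invariant under \<open>shift\<close>, so if
  nonzero it contains some \<open>x \<noteq> 0\<close> with \<open>shift *v x = 0\<close>. The part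
  of \<open>x\<close> in its shortest chains comes from generators. Their combination is mapped by
  \<open>g\<close> into the image of \<open>cokernel_part\<close> and also orthogonally to it, hence
  to 0, although \<open>g\<close> is isometric on such combinations.\<close>

lemma frame_invertible:
  assumes f: "invertible f" "N ** f = f ** shift" and g: "frame N f g"
  shows "invertible g"
proof -
  obtain f' where f': "f ** f' = mat 1" "f' ** f = mat 1" using f(1) by (rule invertible_obtain)
  define z where "z = f' ** g"
  have gz: "g = f ** z" by (simp add: z_def matrix_mul_assoc f')
  have z: "z ** shift = shift ** z"
    unfolding z_def using g by (intro conj_commutes[OF f'(2,1) f(2)]) (simp add: frame_def)
  have z0: "z *v x = 0 \<longleftrightarrow> g *v x = 0" for x
    by (metis f'(2) gz matrix_vector_mul_assoc matrix_vector_mul_lid matrix_vector_mult_0_right)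
  have ker: "x = 0" if x: "z *v x = 0" "shift *v x = 0" for x
  proof (rule ccontr)
    assume "x \<noteq> 0"
    then have "\<exists>b. x $ b \<noteq> 0" by (simp add: vec_eq_iff)
    \<comment> \<open>\<open>b\<close> lies in a shortest chain of the support, of length
      \<open>d\<close>; this allows \<open>x\<close>, which is supported on chain ends, to be pulled
      back \<open>d - 1\<close> times along \<open>shift\<close>.\<close>
    then obtain b where b: "x $ b \<noteq> 0" "\<And>c. x $ c \<noteq> 0 \<Longrightarrow> blk b \<le> blk c"
      using ex_has_least_nat[of "\<lambda>b. x $ b \<noteq> 0" _ blk] by blast
    define d where "d = blk b"
    have d: "0 < d" using blk_pos by (simp add: d_def)
    have x1: "lev c = blk c - 1" "d \<le> blk c" if "x $ c \<noteq> 0" for c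
    proof -
      have "x \<in> Ker 1" using x(2) by (simp add: Ker_def)
      then have "blk c \<le> lev c + 1" using that by (simp add: mem_Ker_iff)
      then show "lev c = blk c - 1" using lev_less[of c] by linarith
    qed (use b that d_def in auto)
    define q where "q = (\<chi> c. if lev c + (d - 1) < blk c then x $ pos c (lev c + (d - 1)) else 0)"
    have xq: "(sh ^^ (d - 1)) q = x"
    proof -
      have "((sh ^^ (d - 1)) q) $ c = x $ c" for c
      proof (cases "d - 1 \<le> lev c")
        case True
        have l: "lev c - (d - 1) < blk c" using lev_less[of c] by linarith
        then show ?thesis using True lev_less[of c] by (simp add: shift_pow_nth q_def pos pos_pos)
      next
        case False
        have "x $ c = 0"
        proof (rule ccontr)
          assume "x $ c \<noteq> 0"
          from x1[OF this] show False using False by linarith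
        qed
        then show ?thesis using False by (simp add: shift_pow_nth)
      qed
      then show ?thesis by (simp add: vec_eq_iff)
    qed
    have q: "lev c + d = blk c" if "q $ c \<noteq> 0" for c
    proof -
      have c: "lev c + (d - 1) < blk c" "x $ pos c (lev c + (d - 1)) \<noteq> 0"
        using that by (auto simp: q_def split: if_splits)
      then have "lev c + (d - 1) = blk c - 1" using x1(1)[OF c(2)] by (simp add: pos)
      then show ?thesis using d blk_pos[of c] by linarith
    qed
    \<comment> \<open>As \<open>lev c + d = blk c\<close> on the support of \<open>q\<close>, its
      coordinates in chains of length \<open>d\<close> sit at level 0, and all others belong to
      \<open>cokernel_part d\<close>.\<close>
    define u where "u = (\<chi> c. if blk c = d then q $ c else 0)"
    define q' where "q' = q - u"
    have u: "blk c = d \<and> lev c = 0" if "u $ c \<noteq> 0" for c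
      using that q[of c] by (auto simp: u_def split: if_splits)
    have "q' \<in> cokernel_part d"
      unfolding cokernel_part_def
    proof (intro CollectI allI impI)
      fix c assume "q' $ c \<noteq> 0"
      then have c: "blk c \<noteq> d" "q $ c \<noteq> 0" by (auto simp: q'_def u_def split: if_splits)
      then show "blk c \<le> lev c + d \<and> \<not> (blk c = d \<and> lev c = 0)" using q[OF c(2)] by simp
    qed
    then have 1: "z *v q' \<in> cokernel_part d" by (rule commutes_cokernel_part[OF z])
    have "(sh ^^ (d - 1)) (z *v q) = 0"
      unfolding commutes_pow[OF z] xq by (rule x(1))
    then have 2: "z *v q \<in> cokernel_part d"
      using Ker_pred_subset_cokernel_part[OF d] by (auto simp: Ker_def)
    have "z *v u = z *v q - z *v q'"
      by (simp add: q'_def matrix_vector_mult_diff_distrib)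
    then have "z *v u \<in> cokernel_part d"
      using vec.subspace_diff[OF vec_subspace_cokernel_part 2 1] by simp
    from frame_orthogonal[OF g u this] have "hinner (g *v u) (g *v u) = 0"
      by (simp add: gz matrix_vector_mul_assoc)
    then have "hinner u u = 0" by (simp add: frame_isometric[OF g u u])
    then have "u = 0" by simp
    have "lev b = d - 1" using x1(1)[OF b(1)] d_def by simp
    have "u $ pos b 0 = x $ b"
      using pos(1,2)[OF blk_pos, of b] pos_pos[of 0 b "d - 1"] \<open>lev b = d - 1\<close> lev_less[of b] d
      by (simp add: u_def q_def d_def) (metis pos_lev)
    then show False using \<open>u = 0\<close> b(1) by simp
  qed
  \<comment> \<open>The last nonzero power of \<open>shift\<close> applied to \<open>x\<close>
    reduces this to the case just treated.\<close>
  have "x = 0" if "z *v x = 0" for x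
  proof (rule ccontr)
    assume "x \<noteq> 0"
    define k where "k = (LEAST k. (sh ^^ k) x = 0)"
    have k: "(sh ^^ k) x = 0" unfolding k_def by (rule LeastI_ex) (rule shift_nilpotent)
    then have "k \<noteq> 0" using \<open>x \<noteq> 0\<close> by (intro notI) simp
    then obtain l where l: "k = Suc l" by (cases k) auto
    have "(sh ^^ l) x \<noteq> 0"
      using not_less_Least[of l "\<lambda>k. (sh ^^ k) x = 0"] unfolding k_def[symmetric] l by blast
    moreover have "z *v (sh ^^ l) x = (sh ^^ l) 0"
      using commutes_pow[OF z, of l x] by (simp only: that)
    moreover have "(sh ^^ l) 0 = 0" by (induction l) simp_all
    ultimately have "z *v (sh ^^ l) x = 0" "(sh ^^ l) x \<noteq> 0" by simp_all
    moreover have "shift *v (sh ^^ l) x = 0" using k l by simp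
    ultimately show False using ker by blast
  qed
  then have "\<forall>x. g *v x = 0 \<longrightarrow> x = 0" using z0 by blast
  then obtain h where "h ** g = mat 1" using matrix_left_invertible_ker[of g] by blast
  then show ?thesis using invertible_left_inverse by blast
qed

text \<open>For each \<open>d\<close> the images of the generators are orthonormalized in the image
  of \<open>Ker d\<close> relative to the image of \<open>cokernel_part d\<close>; powers of
  \<open>N\<close> extend them to chains. Staying in the image of \<open>Ker d\<close> makes each
  chain end after \<open>d\<close> steps.\<close>

lemma frame_exists:
  assumes f: "invertible f" "N ** f = f ** shift"
  shows "\<exists>g. frame N f g"
proof -
  obtain f' where f': "f ** f' = mat 1" "f' ** f = mat 1" using f(1) by (rule invertible_obtain)
  have sub: "vec.subspace ((*v) f ` S)" if "vec.subspace S" for S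
    using that by (intro vec.subspace_image)
  have inj: "f *v x = f *v y \<longleftrightarrow> x = y" for x y
    by (metis f'(2) matrix_vector_mul_assoc matrix_vector_mul_lid)
  define P where "P d w \<longleftrightarrow> (\<forall>a\<in>{a. blk a = d \<and> lev a = 0}. w a \<in> (*v) f ` Ker d \<and>
        (\<forall>t\<in>(*v) f ` cokernel_part d. hinner (w a) t = 0)) \<and>
      (\<forall>a\<in>{a. blk a = d \<and> lev a = 0}. \<forall>b\<in>{a. blk a = d \<and> lev a = 0}. hinner (w a) (w b) = (if a = b then 1 else 0))" for d w
  have ex: "\<exists>w. P d w" for d
    unfolding P_def
  proof (rule orthonormal_family_exists[where u = "\<lambda>a. f *v axis a 1"])
    show "vec.subspace ((*v) f ` cokernel_part d)" "vec.subspace ((*v) f ` Ker d)"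
      using sub vec_subspace_cokernel_part vec_subspace_Ker by auto
    show "(*v) f ` cokernel_part d \<subseteq> (*v) f ` Ker d"
      using cokernel_part_subset_Ker by blast
    show "f *v axis a 1 \<in> (*v) f ` Ker d" if "a \<in> {a. blk a = d \<and> lev a = 0}" for a
      using that by (intro imageI) (auto simp: mem_Ker_iff axis_def)
  next
    fix c :: "'n \<Rightarrow> complex" and a
    let ?J = "{a. blk a = d \<and> lev a = 0}"
    assume c: "(\<Sum>a\<in>?J. c a *s (f *v axis a 1)) \<in> (*v) f ` cokernel_part d" and a: "a \<in> ?J"
    have "(\<Sum>a\<in>?J. c a *s (f *v axis a 1)) = f *v (\<Sum>a\<in>?J. c a *s axis a 1)"
      by (simp add: linear_sum[OF matrix_vector_mul_linear] matrix_vector_scaleC)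
    then have "(\<Sum>a\<in>?J. c a *s axis a 1) \<in> cokernel_part d"
      using c by (auto simp: inj)
    then have "(\<Sum>a\<in>?J. c a *s axis a 1) $ a = 0"
      using a unfolding cokernel_part_def by blast
    moreover have "(\<Sum>a\<in>?J. c a *s axis a 1) $ a = (\<Sum>b\<in>?J. if b = a then c b else 0)"
      unfolding sum_component by (intro sum.cong) (auto simp: axis_def)
    ultimately show "c a = 0" using a by simp
  qed simp
  define w where "w d = (SOME w. P d w)" for d
  have "P d (w d)" for d
    unfolding w_def by (rule someI_ex[OF ex])
  then have w: "\<And>d a. blk a = d \<Longrightarrow> lev a = 0 \<Longrightarrow> w d a \<in> (*v) f ` Ker d"
    "\<And>d a x. blk a = d \<Longrightarrow> lev a = 0 \<Longrightarrow> x \<in> cokernel_part d \<Longrightarrow> hinner (w d a) (f *v x) = 0"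
    "\<And>d a b. blk a = d \<Longrightarrow> lev a = 0 \<Longrightarrow> blk b = d \<Longrightarrow> lev b = 0 \<Longrightarrow> hinner (w d a) (w d b) = (if a = b then 1 else 0)"
    unfolding P_def by blast+
  define g where "g = (\<chi> r b. (((*v) N ^^ lev b) (w (blk b) (pos b 0))) $ r)"
  have g: "g *v axis b 1 = ((*v) N ^^ lev b) (w (blk b) (pos b 0))" for b
    unfolding vec_eq_iff cmatrix_vector_mult_axis by (simp add: g_def)
  have Nf: "((*v) N ^^ k) (f *v x) = f *v (sh ^^ k) x" for k x
    by (induction k) (simp_all add: matrix_vector_mul_assoc f(2))
  have "N ** g = g ** shift"
  proof (rule cmatrix_eq_axis)
    fix b
    have 1: "(N ** g) *v axis b 1 = ((*v) N ^^ Suc (lev b)) (w (blk b) (pos b 0))"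
      by (simp add: matrix_vector_mul_assoc[symmetric] g)
    show "(N ** g) *v axis b 1 = (g ** shift) *v axis b 1"
    proof (cases "Suc (lev b) < blk b")
      case True
      then have "(g ** shift) *v axis b 1 = g *v axis (pos b (Suc (lev b))) 1"
        by (simp add: matrix_vector_mul_assoc[symmetric] shift_axis)
      also have "\<dots> = ((*v) N ^^ Suc (lev b)) (w (blk b) (pos b 0))"
        using True blk_pos[of b] by (simp add: g pos pos_pos del: funpow.simps)
      finally show ?thesis using 1 by simp
    next
      case False
      then have e: "Suc (lev b) = blk b" using lev_less[of b] by simp
      obtain x where x: "w (blk b) (pos b 0) = f *v x" "x \<in> Ker (blk b)"
        using w(1)[of "pos b 0" "blk b"] pos[OF blk_pos, of b] by auto
      then have "((*v) N ^^ Suc (lev b)) (w (blk b) (pos b 0)) = 0"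
        unfolding e x(1) Nf by (simp add: Ker_def)
      then show ?thesis using 1 False
        by (simp add: matrix_vector_mul_assoc[symmetric] shift_axis)
    qed
  qed
  moreover have "g *v axis a 1 = w (blk a) a" if "lev a = 0" for a
    using g[of a] that pos_lev[of a] by simp
  ultimately have "frame N f g"
    using w by (simp add: frame_def)
  then show ?thesis by blast
qed

section \<open>Block matrices and the shift\<close>

text \<open>One square matrix per chain length, repeated at every level: the block diagonal matrices
  of the theorem, described without reference to the order of the indices.\<close>

definition block_form :: "complex^'n^'n \<Rightarrow> bool" where
  "block_form z \<longleftrightarrow> (\<forall>c b. z $ c $ b = (if blk c = blk b \<and> lev c = lev b then z $ pos c 0 $ pos b 0 else 0))"

text \<open>A matrix commuting with \<open>shift\<close> is determined by its columns at level 0;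
  the column at level \<open>l\<close> is that of the generator moved up \<open>l\<close>
  levels.\<close>

lemma block_formI:
  assumes z: "z ** shift = shift ** z" and gen: "\<And>a c. lev a = 0 \<Longrightarrow> z $ c $ a \<noteq> 0 \<Longrightarrow> blk c = blk a \<and> lev c = 0"
  shows "block_form z"
  unfolding block_form_def
proof (intro allI)
  fix c b
  have a0: "lev (pos b 0) = 0" "blk (pos b 0) = blk b" using pos[OF blk_pos] by auto
  have "z $ c $ b = (z *v (sh ^^ lev b) (axis (pos b 0) 1)) $ c"
    by (simp add: axis_eq_shift_pow[symmetric] cmatrix_vector_mult_axis)
  also have "\<dots> = ((sh ^^ lev b) (z *v axis (pos b 0) 1)) $ c"
    by (simp add: commutes_pow[OF z])
  also have "\<dots> = (if lev b \<le> lev c then z $ pos c (lev c - lev b) $ pos b 0 else 0)"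
    by (simp add: shift_pow_nth cmatrix_vector_mult_axis)
  also have "\<dots> = (if blk c = blk b \<and> lev c = lev b then z $ pos c 0 $ pos b 0 else 0)"
  proof (cases "lev b \<le> lev c")
    case True
    have l: "lev c - lev b < blk c" using lev_less[of c] by linarith
    show ?thesis
    proof (cases "z $ pos c (lev c - lev b) $ pos b 0 = 0")
      case True
      then show ?thesis by auto
    next
      case False
      then have "lev c - lev b = 0" "blk c = blk b"
        using gen[OF a0(1) False] pos[OF l] a0 by auto
      then show ?thesis using True by simp
    qed
  qed simp
  finally show "z $ c $ b = (if blk c = blk b \<and> lev c = lev b then z $ pos c 0 $ pos b 0 else 0)" .
qed

lemma block_form_commutes:
  assumes "block_form z"
  shows "z ** shift = shift ** z"
proof (rule cmatrix_eq_axis)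
  fix b
  have bf: "z $ c $ b = (if blk c = blk b \<and> lev c = lev b then z $ pos c 0 $ pos b 0 else 0)" for c b
    using assms by (simp add: block_form_def)
  have "((z ** shift) *v axis b 1) $ c = ((shift ** z) *v axis b 1) $ c" for c
  proof -
    have l: "lev c - Suc 0 < blk c" using lev_less[of c] by linarith
    have L: "((z ** shift) *v axis b 1) $ c = (if Suc (lev b) < blk b then z $ c $ pos b (Suc (lev b)) else 0)"
      by (simp add: matrix_vector_mul_assoc[symmetric] shift_axis cmatrix_vector_mult_axis)
    have R: "((shift ** z) *v axis b 1) $ c = (if 0 < lev c then z $ pos c (lev c - Suc 0) $ b else 0)"
      by (simp add: matrix_vector_mul_assoc[symmetric] shift_nth cmatrix_vector_mult_axis)
    have "z $ c $ pos b (Suc (lev b)) = (if blk c = blk b \<and> lev c = Suc (lev b) then z $ pos c 0 $ pos b 0 else 0)"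
      if "Suc (lev b) < blk b"
      using that blk_pos[of b] bf[of c "pos b (Suc (lev b))"] by (simp add: pos pos_pos)
    moreover have "z $ pos c (lev c - Suc 0) $ b = (if blk c = blk b \<and> lev c - Suc 0 = lev b then z $ pos c 0 $ pos b 0 else 0)"
      using bf[of "pos c (lev c - Suc 0)" b] by (simp only: pos[OF l] pos_pos[OF l blk_pos])
    ultimately show ?thesis unfolding L R using lev_less[of c] by auto
  qed
  then show "(z ** shift) *v axis b 1 = (shift ** z) *v axis b 1" by (simp add: vec_eq_iff)
qed

text \<open>For \<open>l < d\<close>, going down to level 0 is a bijection on the chains of length
  \<open>d\<close>; for larger \<open>l\<close> the level is empty.\<close>

lemma sum_level:
  "(\<Sum>r\<in>UNIV. if blk r = d \<and> lev r = l then F (pos r 0) else 0) =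
   (if l < d then \<Sum>r\<in>UNIV. if blk r = d \<and> lev r = 0 then F r else (0::complex) else 0)"
proof (cases "l < d")
  case True
  have p0: "pos r (lev r) = r" for r by simp
  have p0: "pos r 0 = r" if "lev r = 0" for r using p0[of r] that by simp
  have bij: "bij_betw (\<lambda>r. pos r 0) {r. blk r = d \<and> lev r = l} {r. blk r = d \<and> lev r = 0}"
    using True by (intro bij_betw_byWitness[where f' = "\<lambda>r. pos r l"]) (auto simp: pos pos_pos p0)
  have "(\<Sum>r\<in>UNIV. if blk r = d \<and> lev r = l then F (pos r 0) else 0) = (\<Sum>r\<in>{r. blk r = d \<and> lev r = l}. F (pos r 0))"
    by (simp add: sum.If_cases)
  also have "\<dots> = (\<Sum>r\<in>{r. blk r = d \<and> lev r = 0}. F r)"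
    by (rule sum.reindex_bij_betw[OF bij])
  finally show ?thesis using True by (simp add: sum.If_cases)
next
  case False
  have "(\<Sum>r\<in>UNIV. if blk r = d \<and> lev r = l then F (pos r 0) else 0) = 0"
    using False lev_less by (intro sum.neutral) auto
  then show ?thesis using False by simp
qed

text \<open>Columns of different levels or chain lengths have disjoint supports, and inner products
  within one level agree with those at level 0.\<close>

lemma block_form_unitary:
  assumes bf: "block_form z"
    and gen: "\<And>a b. lev a = 0 \<Longrightarrow> lev b = 0 \<Longrightarrow> blk a = blk b \<Longrightarrow> hinner (z *v axis a 1) (z *v axis b 1) = (if a = b then 1 else 0)"
  shows "conj_transpose z ** z = mat 1"
proof -
  have bf': "z $ c $ b = (if blk c = blk b \<and> lev c = lev b then z $ pos c 0 $ pos b 0 else 0)" for c b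
    using bf by (simp add: block_form_def)
  have *: "hinner (z *v axis a 1) (z *v axis b 1) =
      (if blk a = blk b \<and> lev a = lev b then \<Sum>r\<in>UNIV. if blk r = blk b \<and> lev r = 0 then cnj (z $ r $ pos a 0) * z $ r $ pos b 0 else 0 else 0)" for a b
  proof -
    have "hinner (z *v axis a 1) (z *v axis b 1) = (\<Sum>r\<in>UNIV. cnj (z $ r $ a) * z $ r $ b)"
      by (simp add: hinner_def cmatrix_vector_mult_axis)
    also have "\<dots> = (\<Sum>r\<in>UNIV. if blk r = blk b \<and> lev r = lev b then (if blk a = blk b \<and> lev a = lev b then cnj (z $ pos r 0 $ pos a 0) * z $ pos r 0 $ pos b 0 else 0) else 0)"
      by (intro sum.cong refl) (subst bf', subst (2) bf', auto)
    also have "\<dots> = (\<Sum>r\<in>UNIV. if blk r = blk b \<and> lev r = 0 then (if blk a = blk b \<and> lev a = lev b then cnj (z $ r $ pos a 0) * z $ r $ pos b 0 else 0) else 0)"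
      using lev_less[of b] by (subst sum_level) simp
    finally show ?thesis by (auto intro!: sum.cong sum.neutral)
  qed
  have e: "blk (pos a 0) = blk a" "lev (pos a 0) = 0" "pos (pos a 0) 0 = pos a 0" for a
    using blk_pos[of a] by (simp_all add: pos pos_pos)
  have "(conj_transpose z ** z) $ a $ b = mat 1 $ a $ b" for a b
  proof -
    have "(conj_transpose z ** z) $ a $ b = hinner (z *v axis a 1) (z *v axis b 1)"
      by (simp add: matrix_entry_hinner matrix_vector_mul_assoc[symmetric] hinner_conj_transpose)
    also have "\<dots> = mat 1 $ a $ b"
    proof (cases "blk a = blk b \<and> lev a = lev b")
      case True
      have "hinner (z *v axis a 1) (z *v axis b 1) = hinner (z *v axis (pos a 0) 1) (z *v axis (pos b 0) 1)"
        unfolding * by (simp only: True e simp_thms if_True)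
      also have "\<dots> = (if pos a 0 = pos b 0 then 1 else 0)"
        using True blk_pos[of a] blk_pos[of b] by (intro gen) (simp_all add: pos)
      also have "pos a 0 = pos b 0 \<longleftrightarrow> a = b"
        using True pos[OF blk_pos, of a] pos[OF blk_pos, of b] lab_eqI[of a b] by metis
      finally show ?thesis by (simp add: Finite_Cartesian_Product.mat_def)
    next
      case False
      then have "hinner (z *v axis a 1) (z *v axis b 1) = 0" unfolding * by (simp only: if_False)
      moreover have "a \<noteq> b" using False by auto
      ultimately show ?thesis by (simp add: Finite_Cartesian_Product.mat_def)
    qed
    finally show ?thesis .
  qed
  then show ?thesis by (simp add: vec_eq_iff)
qed

text \<open>\<open>z\<close> maps a generator to \<open>v = u + q\<close>, with \<open>u\<close>
  supported on generators of the same chain length and \<open>q\<close> in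
  \<open>cokernel_part\<close>. Both \<open>g *v v\<close> and \<open>g *v u\<close> are orthogonal
  to the image of \<open>cokernel_part\<close>, which contains \<open>g *v q\<close>; so
  \<open>q = 0\<close>. Thus \<open>z\<close> mixes only generators of equal chain length, and it
  does so isometrically.\<close>

lemma frames_differ_unitary:
  assumes f: "invertible f" "N ** f = f ** shift" and g: "frame N f g" and g': "frame N f (g ** z)"
  shows "block_form z" "conj_transpose z ** z = mat 1"
proof -
  obtain f' where f': "f ** f' = mat 1" "f' ** f = mat 1" using f(1) by (rule invertible_obtain)
  obtain h where h: "g ** h = mat 1" "h ** g = mat 1"
    using frame_invertible[OF f g] by (rule invertible_obtain)
  have "(h ** (g ** z)) ** shift = shift ** (h ** (g ** z))"
    using g g' by (intro conj_commutes[where N = N, OF h(2,1)]) (simp_all add: frame_def)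
  then have z: "z ** shift = shift ** z" by (simp add: matrix_mul_assoc h)
  define k where "k = f' ** g"
  have gk: "g = f ** k" by (simp add: k_def matrix_mul_assoc f')
  have k: "k ** shift = shift ** k"
    unfolding k_def using g by (intro conj_commutes[OF f'(2,1) f(2)]) (simp add: frame_def)
  have gen: "blk c = blk a \<and> lev c = 0" if a: "lev a = 0" and nz: "z $ c $ a \<noteq> 0" for a c
  proof -
    define d where "d = blk a"
    define v where "v = z *v axis a 1"
    define u where "u = (\<chi> c. if blk c = d \<and> lev c = 0 then v $ c else 0)"
    define q where "q = v - u"
    have "axis a 1 \<in> Ker d" using a by (auto simp: mem_Ker_iff axis_def d_def)
    then have vK: "v \<in> Ker d" unfolding v_def by (rule commutes_Ker[OF z])
    have q: "q \<in> cokernel_part d"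
      unfolding cokernel_part_def
    proof (intro CollectI allI impI)
      fix b assume "q $ b \<noteq> 0"
      then have "\<not> (blk b = d \<and> lev b = 0)" "v $ b \<noteq> 0" by (auto simp: q_def u_def split: if_splits)
      then show "blk b \<le> lev b + d \<and> \<not> (blk b = d \<and> lev b = 0)" using vK by (simp add: mem_Ker_iff)
    qed
    have gq: "g *v q = f *v (k *v q)" by (simp add: gk matrix_vector_mul_assoc)
    have kq: "k *v q \<in> cokernel_part d" by (rule commutes_cokernel_part[OF k q])
    have "hinner (g *v v) (g *v q) = 0"
    proof -
      have "g *v v = (g ** z) *v axis a 1" by (simp add: v_def matrix_vector_mul_assoc)
      then show ?thesis using g' a kq unfolding gq frame_def d_def by simp
    qed
    moreover have "hinner (g *v u) (g *v q) = 0"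
      unfolding gq using kq by (rule frame_orthogonal[OF g, rotated]) (auto simp: u_def split: if_splits)
    moreover have "g *v q = g *v v - g *v u" by (simp add: q_def matrix_vector_mult_diff_distrib)
    ultimately have "hinner (g *v q) (g *v q) = 0"
      by (metis diff_zero hinner_diff_left)
    then have "g *v q = 0" by simp
    then have "q = 0"
      by (metis h(2) matrix_vector_mul_assoc matrix_vector_mul_lid matrix_vector_mult_0_right)
    then have "v = u" by (simp add: q_def)
    then have "u $ c \<noteq> 0" using nz by (metis v_def cmatrix_vector_mult_axis)
    then show ?thesis by (auto simp: u_def d_def split: if_splits)
  qed
  show bf: "block_form z" by (rule block_formI[OF z gen])
  show "conj_transpose z ** z = mat 1"
  proof (rule block_form_unitary[OF bf])
    fix a b assume ab: "lev a = 0" "lev b = 0" "blk a = blk b"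
    have supp: "blk c = blk b \<and> lev c = 0" if "(z *v axis a 1) $ c \<noteq> 0 \<or> (z *v axis b 1) $ c \<noteq> 0" for c
      using that gen ab by (auto simp: cmatrix_vector_mult_axis)
    have "hinner (z *v axis a 1) (z *v axis b 1) = hinner (g *v (z *v axis a 1)) (g *v (z *v axis b 1))"
      using supp by (intro frame_isometric[OF g, symmetric]) blast+
    also have "\<dots> = (if a = b then 1 else 0)"
      using g' ab by (simp add: frame_def matrix_vector_mul_assoc)
    finally show "hinner (z *v axis a 1) (z *v axis b 1) = (if a = b then 1 else 0)" .
  qed
qed

text \<open>\<open>f\<close> and \<open>f2\<close> differ by a matrix commuting with
  \<open>shift\<close>, which maps \<open>cokernel_part\<close> into itself.\<close>

lemma frame_change:
  assumes f: "invertible f" "N ** f = f ** shift" and f2: "invertible f2" "N ** f2 = f2 ** shift"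
    and g: "frame N f g"
  shows "frame N f2 g"
proof -
  obtain f' where f': "f ** f' = mat 1" "f' ** f = mat 1" using f(1) by (rule invertible_obtain)
  define k where "k = f' ** f2"
  have k: "k ** shift = shift ** k"
    unfolding k_def by (rule conj_commutes[OF f'(2,1) f(2) f2(2)])
  have fk: "f2 *v x = f *v (k *v x)" for x by (simp add: k_def matrix_vector_mul_assoc matrix_mul_assoc f')
  show ?thesis
    using g commutes_cokernel_part[OF k] unfolding frame_def fk by blast
qed

text \<open>The orthogonality clause holds because a generator is a standard basis vector whose
  coordinate vanishes on \<open>cokernel_part\<close>.\<close>

lemma unitary_frame:
  assumes u: "conj_transpose u ** u = mat 1" "N ** u = u ** shift"
  shows "frame N u u"
proof -
  have iso: "hinner (u *v x) (u *v y) = hinner x y" for x y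
    by (simp add: hinner_conj_transpose matrix_vector_mul_assoc u(1))
  have "hinner (axis a 1) x = 0" if "lev a = 0" "x \<in> cokernel_part (blk a)" for a x
    using that unfolding hinner_axis_left cokernel_part_def by blast
  then show ?thesis using u by (simp add: frame_def iso hinner_axis_axis)
qed

text \<open>Both \<open>mat 1\<close> and \<open>u\<close> are frames of \<open>shift\<close>, and
  two frames differ by a block form.\<close>

lemma unitary_commutes_block_form:
  assumes u: "conj_transpose u ** u = mat 1" "u ** shift = shift ** u"
  shows "block_form u"
proof -
  have 1: "frame shift (mat 1) (mat 1)" by (rule unitary_frame) simp_all
  have i1: "invertible (mat 1 :: complex^'n^'n)" by (metis invertible_def matrix_mul_lid)
  have i: "invertible u" using u(1) invertible_left_inverse by blast
  have "frame shift u u" by (rule unitary_frame) (use u in simp_all)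
  then have "frame shift (mat 1) (mat 1 ** u)"
    using frame_change[OF i u(2)[symmetric] i1] by simp
  from frames_differ_unitary(1)[OF i1 _ 1 this] show ?thesis by simp
qed

end

section \<open>Retraction of the orbit onto its unitary part\<close>

lemma tendsto_cmatrix_mult [tendsto_intros]:
  fixes f g :: "'a \<Rightarrow> complex^'n^'n"
  assumes "(f \<longlongrightarrow> A) F" "(g \<longlongrightarrow> B) F"
  shows "((\<lambda>x. f x ** g x) \<longlongrightarrow> A ** B) F"
  unfolding matrix_matrix_mult_def using assms by (intro tendsto_intros)

lemma tendsto_cmatrix_vector_mult [tendsto_intros]:
  fixes f :: "'a \<Rightarrow> complex^'n^'n"
  assumes "(f \<longlongrightarrow> A) F"
  shows "((\<lambda>x. f x *v v) \<longlongrightarrow> A *v v) F"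
  unfolding matrix_vector_mult_def using assms by (intro tendsto_intros)

lemma tendsto_hinner [tendsto_intros]:
  assumes "(f \<longlongrightarrow> x) F" "(g \<longlongrightarrow> y) F"
  shows "((\<lambda>t. hinner (f t) (g t)) \<longlongrightarrow> hinner x y) F"
  unfolding hinner_def using assms by (intro tendsto_intros)

lemma tendsto_conj_transpose [tendsto_intros]:
  assumes "(f \<longlongrightarrow> A) F"
  shows "((\<lambda>x. conj_transpose (f x)) \<longlongrightarrow> conj_transpose A) F"
  unfolding conj_transpose_def using assms by (intro tendsto_intros)

lemma tendsto_of_dist_less:
  assumes "\<And>k. dist (X k) L < 1 / real (Suc k)"
  shows "X \<longlonglongrightarrow> L"
proof -
  have "(\<lambda>k. dist (X k) L) \<longlonglongrightarrow> 0"
  proof (rule tendsto_sandwich[of "\<lambda>_. 0" _ _ "\<lambda>k. inverse (real (Suc k))"])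
    show "\<forall>\<^sub>F k in sequentially. dist (X k) L \<le> inverse (real (Suc k))"
      using assms by (intro always_eventually allI less_imp_le) (simp add: inverse_eq_divide)
    show "(\<lambda>k. inverse (real (Suc k))) \<longlonglongrightarrow> 0" by (rule LIMSEQ_inverse_real_of_nat)
  qed simp_all
  then show ?thesis by (rule tendsto_dist_iff[THEN iffD2])
qed

lemma norm_cmatrix_le: "norm (A :: complex^'n^'m) \<le> (\<Sum>i\<in>(UNIV :: 'm set). \<Sum>j\<in>UNIV. norm (A *v axis j 1))"
proof -
  have "norm A \<le> (\<Sum>i\<in>(UNIV :: 'm set). norm (A $ i))"
    unfolding norm_vec_def[of A] by (rule L2_set_le_sum) simp
  also have "\<dots> \<le> (\<Sum>i\<in>(UNIV :: 'm set). \<Sum>j\<in>UNIV. norm (A $ i $ j))"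
  proof (rule sum_mono)
    fix i
    show "norm (A $ i) \<le> (\<Sum>j\<in>UNIV. norm (A $ i $ j))"
      unfolding norm_vec_def[of "A $ i"] by (rule L2_set_le_sum) simp
  qed
  also have "\<dots> \<le> (\<Sum>i\<in>(UNIV :: 'm set). \<Sum>j\<in>UNIV. norm (A *v axis j 1))"
  proof (intro sum_mono)
    fix i j
    show "norm (A $ i $ j) \<le> norm (A *v axis j 1)"
      unfolding cmatrix_vector_mult_axis[symmetric] by (rule Finite_Cartesian_Product.norm_nth_le)
  qed
  finally show ?thesis .
qed

lemma unitary_left_right: "conj_transpose u ** u = mat 1 \<longleftrightarrow> u ** conj_transpose u = mat 1"
  by (rule matrix_left_right_inverse)

lemma mat_mult_nth: "(mat c ** (A :: complex^'n^'n)) $ i $ j = c * A $ i $ j"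
  "((A :: complex^'n^'n) ** mat c) $ i $ j = c * A $ i $ j"
proof -
  have "(mat c ** A) $ i $ j = (\<Sum>k\<in>UNIV. (if i = k then c else 0) * A $ k $ j)"
    by (simp add: matrix_matrix_mult_def Finite_Cartesian_Product.mat_def)
  also have "\<dots> = (\<Sum>k\<in>UNIV. if k = i then c * A $ k $ j else 0)"
    by (intro sum.cong) auto
  finally show "(mat c ** A) $ i $ j = c * A $ i $ j" by simp
  have "(A ** mat c) $ i $ j = (\<Sum>k\<in>UNIV. A $ i $ k * (if k = j then c else 0))"
    by (simp add: matrix_matrix_mult_def Finite_Cartesian_Product.mat_def)
  also have "\<dots> = (\<Sum>k\<in>UNIV. if k = j then c * A $ i $ k else 0)"
    by (intro sum.cong) auto
  finally show "(A ** mat c) $ i $ j = c * A $ i $ j" by simp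
qed

lemma mat_mult_commute: "mat c ** (A :: complex^'n^'n) = A ** mat c"
  by (simp add: vec_eq_iff mat_mult_nth)

lemma det_mat: "Determinants.det (mat c :: complex^'n^'n) = c ^ CARD('n)"
  by (subst det_diagonal) (auto simp: Finite_Cartesian_Product.mat_def)

lemma det_mat_mult: "Determinants.det (mat c ** (A :: complex^'n^'n)) = c ^ CARD('n) * Determinants.det A"
  by (simp add: det_mul det_mat)

lemma complex_root_exists:
  assumes "w \<noteq> (0::complex)" "0 < n"
  shows "\<exists>c. c ^ n = w"
proof
  have "exp (Ln w / of_nat n) ^ n = exp (of_nat n * (Ln w / of_nat n))"
    by (rule exp_of_nat_mult[symmetric])
  then show "exp (Ln w / of_nat n) ^ n = w" using assms by simp
qed

text \<open>Scalar matrices act trivially by conjugation, so any conjugation by an invertible matrix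
  can be achieved with determinant 1.\<close>

lemma scale_to_det_1:
  fixes A :: "complex^'n^'n"
  assumes "Determinants.det A \<noteq> 0"
  shows "\<exists>c. c \<noteq> 0 \<and> Determinants.det (mat c ** A) = 1"
proof -
  obtain c where c: "c ^ CARD('n) = 1 / Determinants.det A"
    using complex_root_exists[of "1 / Determinants.det A" "CARD('n)"] assms by auto
  then have "c ^ CARD('n) \<noteq> 0" using assms by simp
  then have "c \<noteq> 0" by auto
  then show ?thesis using c assms by (auto simp: det_mat_mult)
qed

lemma SU_iff: "u \<in> SU \<longleftrightarrow> conj_transpose u ** u = mat 1 \<and> Determinants.det u = 1"
  by (simp add: SU_def unitary_left_right)

lemma SU_mult: "u \<in> SU \<Longrightarrow> v \<in> SU \<Longrightarrow> u ** v \<in> SU"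
  by (simp add: SU_iff conj_transpose_mult det_mul)
     (metis matrix_mul_assoc matrix_mul_lid)

lemma SU_conj_transpose: "u \<in> SU \<Longrightarrow> conj_transpose u \<in> SU"
  by (auto simp: SU_def unitary_left_right[symmetric] det_conj_transpose)

lemma compact_SU: "compact (SU :: (complex^'n^'n) set)"
proof -
  have cdet: "continuous_on UNIV (\<lambda>A :: complex^'n^'n. Determinants.det A)"
    unfolding Determinants.det_def by (intro continuous_intros)
  have "closed (SU :: (complex^'n^'n) set)"
    unfolding SU_def by (intro closed_Collect_conj closed_Collect_eq continuous_intros cdet)
  moreover have "norm u \<le> real CARD('n)" if "u \<in> SU" for u :: "complex^'n^'n"
  proof -
    have "norm (u $ i) = 1" for i
    proof -
      have "of_real ((norm (u $ i))\<^sup>2) = hinner (u $ i) (u $ i)" by (simp add: hinner_self)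
      also have "\<dots> = (u ** conj_transpose u) $ i $ i"
        by (simp add: hinner_def matrix_matrix_mult_def conj_transpose_def mult.commute)
      also have "\<dots> = 1" using that by (simp add: SU_def Finite_Cartesian_Product.mat_def)
      finally have "(norm (u $ i))\<^sup>2 = 1" by (simp only: of_real_eq_1_iff)
      then show ?thesis by (simp add: power2_eq_1_iff) (use norm_ge_zero[of "u $ i"] in linarith)
    qed
    then have "(\<Sum>i\<in>UNIV. norm (u $ i)) = real CARD('n)" by simp
    moreover have "norm u \<le> (\<Sum>i\<in>UNIV. norm (u $ i))"
      unfolding norm_vec_def[of u] by (rule L2_set_le_sum) simp
    ultimately show ?thesis by simp
  qed
  then have "bounded (SU :: (complex^'n^'n) set)" by (intro boundedI)
  ultimately show ?thesis by (simp add: compact_eq_bounded_closed)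
qed

text \<open>Continuous bijections from quotients of a compact group are homeomorphisms.\<close>

lemma SU_orbit_homeomorphic_coset_space:
  fixes X0 :: "complex^'n^'n"
  shows "top_of_set ((\<lambda>u. u ** X0 ** conj_transpose u) ` SU) homeomorphic_space
    coset_space (matrix_group SU) {u \<in> SU. u ** X0 = X0 ** u}"
proof -
  let ?G = "matrix_group SU :: (complex^'n^'n) monoid"
  let ?H = "{u \<in> SU. u ** X0 = X0 ** u}"
  let ?\<phi> = "\<lambda>u. u ** X0 ** conj_transpose u"
  let ?p = "\<lambda>u. u <#\<^bsub>?G\<^esub> ?H"
  let ?O = "?\<phi> ` SU"
  have carr: "carrier ?G = SU" by (simp add: matrix_group_def)
  have p: "?p u = (\<lambda>h. u ** h) ` ?H" for u
    by (auto simp: l_coset_def matrix_group_def)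
  have q1: "quotient_map (top_of_set SU) (coset_space ?G ?H) ?p"
    using quotient_map_coset_space[of ?G ?H] by (simp add: carr)
  have cont: "continuous_on SU ?\<phi>" by (intro continuous_intros)
  \<comment> \<open>A continuous surjection from a compact space onto a Hausdorff space is a
    quotient map.\<close>
  have q2: "quotient_map (top_of_set SU) (top_of_set ?O) ?\<phi>"
  proof (rule continuous_imp_quotient_map)
    show "compact_space (top_of_set (SU :: (complex^'n^'n) set))"
      by (rule compact_space_subtopology) (simp add: compact_SU)
  qed (use cont in \<open>auto simp: Hausdorff_space_subtopology\<close>)
  have uni: "conj_transpose u ** u = mat 1" "u ** conj_transpose u = mat 1" if "u \<in> SU" for u :: "complex^'n^'n"
    using that by (auto simp: SU_def unitary_left_right)
  \<comment> \<open>The two quotient maps of \<open>SU\<close> have the same fibres, so each factors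
    through the other.\<close>
  have fib: "?p u = ?p v \<longleftrightarrow> ?\<phi> u = ?\<phi> v" if "u \<in> SU" "v \<in> SU" for u v
  proof
    assume "?p u = ?p v"
    moreover have "v \<in> ?p v"
    proof -
      have "mat 1 \<in> ?H" by (simp add: SU_iff)
      then show ?thesis unfolding p by (intro image_eqI[of _ _ "mat 1"]) simp_all
    qed
    ultimately obtain h where h: "h \<in> ?H" "v = u ** h" unfolding p by blast
    have "?\<phi> v = u ** (h ** X0) ** conj_transpose h ** conj_transpose u"
      by (simp add: h(2) conj_transpose_mult matrix_mul_assoc)
    also have "\<dots> = u ** X0 ** (h ** conj_transpose h) ** conj_transpose u"
      using h(1) by (simp add: matrix_mul_assoc)
    also have "\<dots> = ?\<phi> u" using h(1) uni by simp
    finally show "?\<phi> u = ?\<phi> v" ..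
  next
    have sub: "?p v \<subseteq> ?p u" if "?\<phi> u = ?\<phi> v" "u \<in> SU" "v \<in> SU" for u v
    proof
      fix w assume "w \<in> ?p v"
      then obtain h where h: "h \<in> ?H" "w = v ** h" unfolding p by blast
      define k where "k = conj_transpose u ** v"
      have "k ** X0 = k ** X0 ** (conj_transpose v ** v)"
        by (simp add: uni[OF that(3)])
      also have "\<dots> = conj_transpose u ** (v ** X0 ** conj_transpose v) ** v"
        by (simp only: k_def matrix_mul_assoc)
      also have "\<dots> = conj_transpose u ** (u ** X0 ** conj_transpose u) ** v"
        by (simp only: that(1))
      also have "\<dots> = (conj_transpose u ** u) ** X0 ** k"
        by (simp only: k_def matrix_mul_assoc)
      also have "\<dots> = X0 ** k"
        by (simp add: uni[OF that(2)])
      finally have "k ** X0 = X0 ** k" .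
      moreover have "k \<in> SU" unfolding k_def using that by (intro SU_mult SU_conj_transpose)
      moreover have "(k ** h) ** X0 = X0 ** (k ** h)"
        using h(1) \<open>k ** X0 = X0 ** k\<close>
        by (simp add: matrix_mul_assoc[symmetric]) (simp add: matrix_mul_assoc)
      ultimately have "k ** h \<in> ?H" using h(1) by (simp add: SU_mult)
      moreover have "w = u ** (k ** h)"
        unfolding h(2) k_def by (simp add: matrix_mul_assoc uni[OF that(2)])
      ultimately show "w \<in> ?p u" unfolding p by blast
    qed
    assume "?\<phi> u = ?\<phi> v"
    then show "?p u = ?p v" using sub[of u v] sub[of v u] that by auto
  qed
  have w1: "?\<phi> u = ?\<phi> v" if "u \<in> topspace (top_of_set SU)" "v \<in> topspace (top_of_set SU)" "?p u = ?p v" for u v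
    using fib[of u v] that by simp
  obtain F where F: "continuous_map (coset_space ?G ?H) (top_of_set ?O) F"
      "\<And>u. u \<in> topspace (top_of_set SU) \<Longrightarrow> F (?p u) = ?\<phi> u"
    by (rule quotient_map_lift_exists[OF q1 quotient_imp_continuous_map[OF q2]], rule w1, assumption+) (rule that)
  have w2: "?p u = ?p v" if "u \<in> topspace (top_of_set SU)" "v \<in> topspace (top_of_set SU)" "?\<phi> u = ?\<phi> v" for u v
    using fib[of u v] that by simp
  obtain F' where F': "continuous_map (top_of_set ?O) (coset_space ?G ?H) F'"
      "\<And>u. u \<in> topspace (top_of_set SU) \<Longrightarrow> F' (?\<phi> u) = ?p u"
    by (rule quotient_map_lift_exists[OF q2 quotient_imp_continuous_map[OF q1]], rule w2, assumption+) (rule that)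
  have "topspace (coset_space ?G ?H) = ?p ` SU"
    using quotient_imp_surjective_map[OF q1] by simp
  then have "homeomorphic_maps (top_of_set ?O) (coset_space ?G ?H) F' F"
    unfolding homeomorphic_maps_def using F F' by auto
  then show ?thesis using homeomorphic_space_def by blast
qed

section \<open>The canonical form and its continuity\<close>

context shift_matrix
begin

text \<open>Similarity by arbitrary invertible matrices postpones the determinant condition to
  \<open>adjoint_orbit_eq\<close>.\<close>

definition orb :: "(complex^'n^'n) set" where
  "orb = {N. \<exists>f. invertible f \<and> N ** f = f ** shift}"

definition unitary_orb :: "(complex^'n^'n) set" where
  "unitary_orb = {N. \<exists>u. conj_transpose u ** u = mat 1 \<and> N ** u = u ** shift}"

text \<open>The inverse of the canonical Hermitian form for which \<open>N\<close> acts by partial isometries.\<close>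

definition metric :: "complex^'n^'n \<Rightarrow> complex^'n^'n" where
  "metric N = (SOME Q. \<exists>f g. invertible f \<and> N ** f = f ** shift \<and> frame N f g \<and> Q = g ** conj_transpose g)"

text \<open>Any two frames of \<open>N\<close> differ by a unitary factor on the right, which
  cancels in \<open>g ** conj_transpose g\<close>.\<close>

lemma metric_eq:
  assumes f: "invertible f" "N ** f = f ** shift" and g: "frame N f g"
  shows "metric N = g ** conj_transpose g"
proof -
  have "\<exists>Q f g. invertible f \<and> N ** f = f ** shift \<and> frame N f g \<and> Q = g ** conj_transpose g"
    using assms by blast
  then obtain f2 g2 where f2: "invertible f2" "N ** f2 = f2 ** shift" and g2: "frame N f2 g2"
    and eq: "metric N = g2 ** conj_transpose g2"
    using someI_ex[of "\<lambda>Q. \<exists>f g. invertible f \<and> N ** f = f ** shift \<and> frame N f g \<and> Q = g ** conj_transpose g"]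
    unfolding metric_def by blast
  obtain h where h: "g ** h = mat 1" "h ** g = mat 1"
    using frame_invertible[OF f g] by (rule invertible_obtain)
  define z where "z = h ** g2"
  have g2z: "g2 = g ** z" by (simp add: z_def matrix_mul_assoc h)
  have "frame N f (g ** z)" using frame_change[OF f2 f g2] by (simp add: g2z)
  then have "conj_transpose z ** z = mat 1" by (rule frames_differ_unitary(2)[OF f g])
  then have "z ** conj_transpose z = mat 1" by (simp add: unitary_left_right)
  then have "g ** (z ** conj_transpose z) ** conj_transpose g = g ** conj_transpose g" by simp
  then show ?thesis unfolding eq g2z conj_transpose_mult by (simp add: matrix_mul_assoc)
qed

lemma orb_obtain_frame:
  assumes "N \<in> orb"
  obtains f g where "invertible f" "N ** f = f ** shift" "frame N f g" "invertible g"
    "metric N = g ** conj_transpose g"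
proof -
  obtain f where f: "invertible f" "N ** f = f ** shift" using assms by (auto simp: orb_def)
  then obtain g where "frame N f g" using frame_exists by blast
  with f show ?thesis using that metric_eq frame_invertible by blast
qed

lemma posdef_metric: "N \<in> orb \<Longrightarrow> posdef (metric N)"
  using posdef_mult_conj_transpose by (metis orb_obtain_frame)

text \<open>A unitary similarity is a frame for itself.\<close>

lemma metric_unitary_orb:
  assumes "N \<in> unitary_orb"
  shows "metric N = mat 1"
proof -
  obtain u where u: "conj_transpose u ** u = mat 1" "N ** u = u ** shift"
    using assms by (auto simp: unitary_orb_def)
  have "invertible u" using u(1) invertible_left_inverse by blast
  then have "metric N = u ** conj_transpose u" using metric_eq unitary_frame u by blast
  then show ?thesis using u(1) by (simp add: unitary_left_right)
qed

lemma unitary_orb_subset_orb: "unitary_orb \<subseteq> orb"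
  unfolding unitary_orb_def orb_def using invertible_left_inverse by blast

text \<open>Each column is a power of \<open>N\<close> applied to a unit vector. This bounds the
  frames of all matrices near a given one at once.\<close>

lemma frame_norm_bound:
  assumes g: "frame N f g" and C: "\<And>(A :: complex^'n^'n) x. norm (A *v x) \<le> C * norm A * norm x" "0 \<le> C"
    and B: "norm N \<le> B"
  shows "norm (g *v axis b 1) \<le> (C * B) ^ lev b"
proof -
  have Ng: "((*v) N ^^ k) (g *v x) = g *v (sh ^^ k) x" for k x
    using g by (induction k) (simp_all add: matrix_vector_mul_assoc frame_def)
  have "norm (((*v) N ^^ k) x) \<le> (C * B) ^ k * norm x" for k x
  proof (induction k)
    case (Suc k)
    have "norm (((*v) N ^^ Suc k) x) \<le> C * norm N * norm (((*v) N ^^ k) x)"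
      using C(1) by simp
    also have "\<dots> \<le> (C * B) * ((C * B) ^ k * norm x)"
      using Suc C(2) B order_trans[OF norm_ge_zero B] by (intro mult_mono mult_left_mono) auto
    finally show ?case by simp
  qed simp
  then have "norm (g *v axis b 1) \<le> (C * B) ^ lev b * norm (g *v axis (pos b 0) 1)"
    unfolding axis_eq_shift_pow[of b] Ng[symmetric] .
  moreover have "norm (g *v axis (pos b 0) 1) = 1"
  proof -
    have "hinner (g *v axis (pos b 0) 1) (g *v axis (pos b 0) 1) = 1"
      using g pos(2)[OF blk_pos, of b] by (simp add: frame_def)
    then have "(norm (g *v axis (pos b 0) 1))\<^sup>2 = 1"
      unfolding hinner_self by (simp only: of_real_eq_1_iff)
    then show ?thesis by (simp add: power2_eq_1_iff) (use norm_ge_zero[of "g *v axis (pos b 0) 1"] in linarith)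
  qed
  ultimately show ?thesis by simp
qed

text \<open>By contradiction along a sequence. The local section supplies similarities converging to
  \<open>f\<close>; the frames stay bounded, so a subsequence converges, and its limit is a frame of
  \<open>N\<close> because the conditions in \<open>frame\<close> are closed. Independence of the
  form from the frame identifies the limit of the forms with \<open>metric N\<close>.\<close>

lemma continuous_on_metric: "continuous_on orb metric"
  unfolding continuous_on_iff
proof (intro ballI allI impI; rule ccontr)
  fix N and e :: real assume "N \<in> orb" "e > 0"
    and neg: "\<not> (\<exists>d>0. \<forall>N'\<in>orb. dist N' N < d \<longrightarrow> dist (metric N') (metric N) < e)"
  obtain f where f: "invertible f" "N ** f = f ** shift" using \<open>N \<in> orb\<close> by (auto simp: orb_def)
  have "\<exists>N' f' g'. invertible f' \<and> N' ** f' = f' ** shift \<and> frame N' f' g' \<and>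
      dist N' N < 1 / real (Suc k) \<and> dist f' f < 1 / real (Suc k) \<and> e \<le> dist (metric N') (metric N)" for k
  proof -
    obtain \<delta> where \<delta>: "\<delta> > 0" "\<And>N'. N' \<in> orb \<Longrightarrow> dist N' N < \<delta> \<Longrightarrow>
        \<exists>f'. invertible f' \<and> N' ** f' = f' ** shift \<and> dist f' f < 1 / real (Suc k)"
      using similarity_local_section[OF f, of "1 / real (Suc k)"] by (auto simp: orb_def)
    have "min \<delta> (1 / real (Suc k)) > 0" using \<delta>(1) by simp
    then obtain N' where N': "N' \<in> orb" "dist N' N < min \<delta> (1 / real (Suc k))" "\<not> dist (metric N') (metric N) < e"
      using neg by blast
    then obtain f' where f': "invertible f'" "N' ** f' = f' ** shift" "dist f' f < 1 / real (Suc k)"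
      using \<delta>(2)[of N'] by auto
    then obtain g' where "frame N' f' g'" using frame_exists by blast
    then show ?thesis using N' f' by (intro exI[of _ N'] exI[of _ f'] exI[of _ g']) auto
  qed
  then obtain Ns fs gs where seq: "\<And>k. invertible (fs k)" "\<And>k. Ns k ** fs k = fs k ** shift"
      "\<And>k. frame (Ns k) (fs k) (gs k)" "\<And>k. dist (Ns k) N < 1 / real (Suc k)"
      "\<And>k. dist (fs k) f < 1 / real (Suc k)" "\<And>k. e \<le> dist (metric (Ns k)) (metric N)"
    by metis
  have Ns: "Ns \<longlonglongrightarrow> N" and fs: "fs \<longlonglongrightarrow> f"
    using seq(4,5) by (auto intro: tendsto_of_dist_less)
  obtain C where C: "C > 0" "\<And>(A :: complex^'n^'n) x. norm (A *v x) \<le> C * norm A * norm x"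
    using cmatrix_vector_mult_bound by blast
  have "norm (gs k) \<le> (\<Sum>i\<in>(UNIV :: 'n set). \<Sum>b\<in>UNIV. (C * (norm N + 1)) ^ lev b)" for k
  proof -
    have "dist (Ns k) N < 1"
      using seq(4)[of k] by (rule less_le_trans) simp
    then have "norm (Ns k) \<le> norm N + 1"
      using norm_triangle_ineq2[of "Ns k" N] by (simp add: dist_norm)
    then have "norm (gs k *v axis b 1) \<le> (C * (norm N + 1)) ^ lev b" for b
      using frame_norm_bound[OF seq(3) C(2)] C(1) by simp
    then show ?thesis
      using norm_cmatrix_le[of "gs k"] by (meson order_trans sum_mono)
  qed
  then have "bounded (range gs)" by (intro boundedI) auto
  then obtain l r where r: "strict_mono r" "(gs \<circ> r) \<longlonglongrightarrow> l"
    using bounded_imp_convergent_subsequence by blast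
  have g: "(\<lambda>k. gs (r k)) \<longlonglongrightarrow> l" using r(2) by (simp add: o_def)
  have N: "(\<lambda>k. Ns (r k)) \<longlonglongrightarrow> N" and ff: "(\<lambda>k. fs (r k)) \<longlonglongrightarrow> f"
    using LIMSEQ_subseq_LIMSEQ[OF Ns r(1)] LIMSEQ_subseq_LIMSEQ[OF fs r(1)] by (simp_all add: o_def)
  have "frame N f l"
    unfolding frame_def
  proof (intro conjI allI impI)
    have "(\<lambda>k. gs (r k) ** shift) \<longlonglongrightarrow> N ** l"
      using tendsto_cmatrix_mult[OF N g] seq(3) by (simp add: frame_def)
    moreover have "(\<lambda>k. gs (r k) ** shift) \<longlonglongrightarrow> l ** shift" by (intro tendsto_intros g)
    ultimately show "N ** l = l ** shift" by (rule LIMSEQ_unique)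
  next
    fix a b assume ab: "lev a = 0" "lev b = 0" "blk a = blk b"
    have "(\<lambda>k. hinner (gs (r k) *v axis a 1) (gs (r k) *v axis b 1)) \<longlonglongrightarrow> hinner (l *v axis a 1) (l *v axis b 1)"
      by (intro tendsto_intros g)
    moreover have "(\<lambda>k. hinner (gs (r k) *v axis a 1) (gs (r k) *v axis b 1)) = (\<lambda>k. if a = b then 1 else 0)"
      using seq(3) ab by (auto simp: frame_def)
    ultimately show "hinner (l *v axis a 1) (l *v axis b 1) = (if a = b then 1 else 0)"
      by (simp only: LIMSEQ_const_iff)
  next
    fix a x assume ax: "lev a = 0" "x \<in> cokernel_part (blk a)"
    have "(\<lambda>k. hinner (gs (r k) *v axis a 1) (fs (r k) *v x)) \<longlonglongrightarrow> hinner (l *v axis a 1) (f *v x)"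
      by (intro tendsto_intros g ff)
    moreover have "(\<lambda>k. hinner (gs (r k) *v axis a 1) (fs (r k) *v x)) = (\<lambda>k. 0)"
      using seq(3) ax by (auto simp: frame_def)
    ultimately show "hinner (l *v axis a 1) (f *v x) = 0"
      by (simp only: LIMSEQ_const_iff)
  qed
  then have "metric N = l ** conj_transpose l" by (rule metric_eq[OF f])
  moreover have "metric (Ns (r k)) = gs (r k) ** conj_transpose (gs (r k))" for k
    by (rule metric_eq[OF seq(1-3)])
  moreover have "(\<lambda>k. gs (r k) ** conj_transpose (gs (r k))) \<longlonglongrightarrow> l ** conj_transpose l"
    by (intro tendsto_intros g)
  ultimately have "(\<lambda>k. metric (Ns (r k))) \<longlonglongrightarrow> metric N" by simp
  then have "\<forall>\<^sub>F k in sequentially. dist (metric (Ns (r k))) (metric N) < e"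
    using \<open>e > 0\<close> by (rule tendstoD)
  then obtain k where "dist (metric (Ns (r k))) (metric N) < e"
    using eventually_happens by fastforce
  then show False using seq(6)[of "r k"] by simp
qed

lemma unitary_orb_eq: "unitary_orb = (\<lambda>u. u ** shift ** conj_transpose u) ` SU"
proof (intro equalityI subsetI)
  fix N assume "N \<in> unitary_orb"
  then obtain u where u: "conj_transpose u ** u = mat 1" "N ** u = u ** shift" by (auto simp: unitary_orb_def)
  then have u': "u ** conj_transpose u = mat 1" by (simp add: unitary_left_right)
  have "cnj (Determinants.det u) * Determinants.det u = 1"
    using arg_cong[OF u(1), of Determinants.det] by (simp add: det_mul det_conj_transpose)
  then have du: "norm (Determinants.det u) = 1" "Determinants.det u \<noteq> 0"
    by (auto simp: complex_mod_sqrt_Re_mult_cnj mult.commute)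
  \<comment> \<open>The determinant of a unitary matrix has modulus 1, so the scalar that normalizes
    it has modulus 1 too and preserves unitarity.\<close>
  obtain c where c: "c \<noteq> 0" "Determinants.det (mat c ** u) = 1" using scale_to_det_1 du by blast
  then have "norm (c ^ CARD('n) * Determinants.det u) = 1" by (simp add: det_mat_mult)
  then have "norm c ^ CARD('n) = 1" by (simp add: norm_mult norm_power du)
  then have "norm c = 1" by (intro power_eq_imp_eq_base[of "norm c" "CARD('n)" 1]) simp_all
  then have cc: "cnj c * c = 1" using complex_norm_square[of c] by (simp add: mult.commute)
  let ?w = "mat c ** u"
  have ct: "conj_transpose (mat c ** A) = mat (cnj c) ** conj_transpose A" for A :: "complex^'n^'n"
    by (simp add: vec_eq_iff conj_transpose_def mat_mult_nth)
  have "conj_transpose ?w ** ?w = mat (cnj c) ** (conj_transpose u ** mat c) ** u"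
    unfolding ct by (simp only: matrix_mul_assoc)
  also have "\<dots> = mat (cnj c) ** (mat c ** (conj_transpose u ** u))"
    unfolding mat_mult_commute[of c "conj_transpose u", symmetric] by (simp only: matrix_mul_assoc)
  also have "\<dots> = mat 1"
    unfolding u(1) vec_eq_iff mat_mult_nth using cc by (simp add: Finite_Cartesian_Product.mat_def)
  finally have "?w \<in> SU" using c by (simp add: SU_iff)
  moreover have "N = ?w ** shift ** conj_transpose ?w"
  proof -
    have "N ** ?w = (N ** mat c) ** u" by (simp only: matrix_mul_assoc)
    also have "\<dots> = mat c ** (N ** u)"
      unfolding mat_mult_commute[of c N, symmetric] by (simp only: matrix_mul_assoc)
    also have "\<dots> = ?w ** shift" unfolding u(2) by (simp only: matrix_mul_assoc)
    finally have "N ** ?w = ?w ** shift" .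
    then have "N ** (?w ** conj_transpose ?w) = ?w ** shift ** conj_transpose ?w"
      by (simp add: matrix_mul_assoc)
    then show ?thesis using \<open>?w \<in> SU\<close> by (simp add: SU_def)
  qed
  ultimately show "N \<in> (\<lambda>u. u ** shift ** conj_transpose u) ` SU" by blast
next
  fix N assume "N \<in> (\<lambda>u. u ** shift ** conj_transpose u) ` SU"
  then obtain u where u: "u \<in> SU" "N = u ** shift ** conj_transpose u" by blast
  then have "N ** u = u ** shift ** (conj_transpose u ** u)" by (simp add: matrix_mul_assoc)
  then show "N \<in> unitary_orb" using u unfolding unitary_orb_def SU_iff by auto
qed

end

section \<open>Deformation retraction onto the unitary part\<close>

type_synonym 'n cmatrix = "((complex, 'n) Finite_Cartesian_Product.vec, 'n) Finite_Cartesian_Product.vec"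

locale ordered_shift_matrix = shift_matrix lab
  for lab :: "'n::{finite,wellorder} \<Rightarrow> nat \<times> nat \<times> nat"
begin

definition metric_path :: "real \<Rightarrow> 'n cmatrix \<Rightarrow> 'n cmatrix" where
  "metric_path s N = (1 - s) *\<^sub>R mat 1 + s *\<^sub>R metric N"

text \<open>For \<open>Q = metric_path s N\<close> and \<open>w = chol Q\<close>, the identity
  \<open>conj_transpose w ** Q ** w = mat 1\<close> makes \<open>Q ** w\<close> the inverse of
  \<open>conj_transpose w\<close>. The formula is thus conjugation of \<open>N\<close> by
  \<open>conj_transpose w\<close>, written without an inverse.\<close>

definition deformation :: "real \<Rightarrow> 'n cmatrix \<Rightarrow> 'n cmatrix" where
  "deformation s N = conj_transpose (chol (metric_path s N)) ** N ** (metric_path s N ** chol (metric_path s N))"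

lemma posdef_metric_path: "N \<in> orb \<Longrightarrow> s \<in> {0..1} \<Longrightarrow> posdef (metric_path s N)"
  unfolding metric_path_def by (intro posdef_convex posdef_mat_1 posdef_metric) auto

lemma continuous_on_deformation:
  "continuous_on ({0..1} \<times> orb) (\<lambda>(s, N). deformation s N)"
proof -
  let ?S = "{0..1 :: real} \<times> orb"
  have m: "continuous_on ?S (\<lambda>x. metric (snd x))"
    by (rule continuous_on_compose2[OF continuous_on_metric]) (auto intro!: continuous_intros)
  have p: "continuous_on ?S (\<lambda>x. metric_path (fst x) (snd x))"
    unfolding metric_path_def by (intro continuous_intros m)
  have c: "continuous_on ?S (\<lambda>x. chol (metric_path (fst x) (snd x)))"
    by (rule continuous_on_compose2[OF continuous_on_chol p]) (auto simp: posdef_metric_path)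
  show ?thesis
    unfolding deformation_def case_prod_unfold by (intro continuous_intros p c)
qed

lemma deformation_similar:
  assumes N: "N \<in> orb" and s: "s \<in> {0..1}" and f: "N ** f = f ** shift"
  shows "deformation s N ** (conj_transpose (chol (metric_path s N)) ** f) =
    (conj_transpose (chol (metric_path s N)) ** f) ** shift"
proof -
  let ?w = "chol (metric_path s N)" and ?Q = "metric_path s N"
  have "conj_transpose ?w ** (?Q ** ?w) = mat 1"
    using chol[OF posdef_metric_path[OF N s]] by (simp add: matrix_mul_assoc)
  then have 1: "(?Q ** ?w) ** conj_transpose ?w = mat 1"
    using matrix_left_right_inverse by blast
  have "deformation s N ** (conj_transpose ?w ** f) = conj_transpose ?w ** N ** ((?Q ** ?w) ** conj_transpose ?w) ** f"
    by (simp add: deformation_def matrix_mul_assoc)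
  also have "\<dots> = conj_transpose ?w ** (N ** f)" by (simp add: 1 matrix_mul_assoc)
  finally show ?thesis by (simp add: f matrix_mul_assoc)
qed

lemma deformation_in_orb:
  assumes N: "N \<in> orb" and s: "s \<in> {0..1}"
  shows "deformation s N \<in> orb"
proof -
  let ?w = "chol (metric_path s N)" and ?Q = "metric_path s N"
  obtain f where f: "invertible f" "N ** f = f ** shift" using N by (auto simp: orb_def)
  have "conj_transpose ?w ** (?Q ** ?w) = mat 1"
    using chol[OF posdef_metric_path[OF N s]] by (simp add: matrix_mul_assoc)
  then have "invertible (conj_transpose ?w)" using invertible_right_inverse by blast
  then have "invertible (conj_transpose ?w ** f)" using f(1) by (rule invertible_mult)
  then show ?thesis unfolding orb_def using deformation_similar[OF N s f(2)] by blast
qed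

lemma deformation_0: "deformation 0 N = N"
  by (simp add: deformation_def metric_path_def chol_mat_1)

text \<open>With \<open>metric N = g ** conj_transpose g\<close> for a frame \<open>g\<close>, the
  Cholesky identity says that \<open>conj_transpose w ** g\<close> is unitary, and this matrix
  intertwines the deformed matrix with \<open>shift\<close>.\<close>

lemma deformation_1:
  assumes N: "N \<in> orb"
  shows "deformation 1 N \<in> unitary_orb"
proof -
  let ?w = "chol (metric_path 1 N)"
  obtain f g where g: "frame N f g" "metric N = g ** conj_transpose g"
    using N by (metis orb_obtain_frame)
  let ?u = "conj_transpose ?w ** g"
  have "?u ** conj_transpose ?u = conj_transpose ?w ** metric_path 1 N ** ?w"
    by (simp add: conj_transpose_mult metric_path_def g(2) matrix_mul_assoc)
  also have "\<dots> = mat 1" by (rule chol[OF posdef_metric_path[OF N]]) simp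
  finally have "conj_transpose ?u ** ?u = mat 1" by (simp add: unitary_left_right)
  moreover have "deformation 1 N ** ?u = ?u ** shift"
    using g(1) by (intro deformation_similar[OF N]) (auto simp: frame_def)
  ultimately show ?thesis unfolding unitary_orb_def by blast
qed

lemma deformation_unitary_orb: "N \<in> unitary_orb \<Longrightarrow> deformation s N = N"
  by (simp add: deformation_def metric_path_def metric_unitary_orb chol_mat_1 scaleR_left_distrib[symmetric])

lemma orb_homotopy_eqv_unitary_orb: "orb homotopy_eqv unitary_orb"
proof (rule deformation_retract_imp_homotopy_eqv)
  show "homotopic_with_canon (\<lambda>x. True) orb orb id (deformation 1)"
    unfolding homotopic_with_def
    using continuous_on_deformation deformation_in_orb
    by (intro exI[of _ "\<lambda>(s, N). deformation s N"]) (auto simp: deformation_0)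
  have "continuous_on orb (\<lambda>N. (\<lambda>(s, N). deformation s N) (1, N))"
    by (rule continuous_on_compose2[OF continuous_on_deformation]) (auto intro!: continuous_intros)
  then show "retraction orb unitary_orb (deformation 1)"
    unfolding retraction_def
    using deformation_1 deformation_unitary_orb unitary_orb_subset_orb by auto
qed

theorem orb_homotopy_equivalent_coset_space:
  "top_of_set orb homotopy_equivalent_space
    coset_space (matrix_group SU) {u \<in> SU. u ** shift = shift ** u}"
  using orb_homotopy_eqv_unitary_orb SU_orbit_homeomorphic_coset_space[of shift]
  unfolding unitary_orb_eq
  by (meson homeomorphic_imp_homotopy_equivalent_space homotopy_eqv_trans)

end

section \<open>Modules over \<open>sl\<^sub>2\<close>\<close>

text \<open>\<open>h - c a\<close> kills the summand at \<open>a\<close> and multiplies each other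
  summand by a nonzero scalar.\<close>

lemma eigenvectors_independent:
  fixes h :: "'a::real_vector \<Rightarrow> 'a" and w :: "'i \<Rightarrow> 'a"
  assumes "linear h" "finite I" "\<And>i. i \<in> I \<Longrightarrow> h (w i) = c i *\<^sub>R w i" "inj_on c I" "sum w I = 0" "i \<in> I"
  shows "w i = 0"
  using assms(2-6)
proof (induction I arbitrary: w i rule: finite_induct)
  case (insert a I)
  let ?w = "\<lambda>i. (c i - c a) *\<^sub>R w i"
  have "h (sum w (insert a I)) = 0"
    using insert.prems(3) by (simp add: linear_0[OF \<open>linear h\<close>])
  then have "(\<Sum>i\<in>insert a I. h (w i)) = 0"
    by (simp add: linear_sum[OF \<open>linear h\<close>] o_def)
  then have 1: "(\<Sum>i\<in>insert a I. c i *\<^sub>R w i) = 0"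
    using insert.prems(1) by simp
  have "(\<Sum>i\<in>insert a I. c a *\<^sub>R w i) = 0"
    using insert.prems(3) by (metis scaleR_sum_right scaleR_zero_right)
  then have "(\<Sum>i\<in>insert a I. ?w i) = 0"
    using 1 by (simp add: scaleR_left_diff_distrib sum_subtractf del: sum.insert)
  then have 0: "sum ?w I = 0"
    using insert.hyps by simp
  have "?w i = 0" if "i \<in> I" for i
    by (rule insert.IH) (use insert.prems 0 that in \<open>auto simp: linear_scale[OF \<open>linear h\<close>] inj_on_def\<close>)
  moreover have "c i \<noteq> c a" if "i \<in> I" for i
    using insert.prems(2) insert.hyps(2) that by (auto simp: inj_on_def)
  ultimately have "w i = 0" if "i \<in> I" for i
    using that by force
  then show ?case
    using insert.prems(3,4) insert.hyps by auto
qed simp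

text \<open>The product \<open>g (g + 1) ... (g + k - 1)\<close>. It arises from moving powers of
  \<open>y\<close> past powers of \<open>x\<close>.\<close>

primrec shifted_power :: "('a::real_vector \<Rightarrow> 'a) \<Rightarrow> nat \<Rightarrow> 'a \<Rightarrow> 'a" where
  "shifted_power g 0 w = w"
| "shifted_power g (Suc k) w = shifted_power g k (g w + real k *\<^sub>R w)"

lemma linear_shifted_power:
  assumes "linear g"
  shows "linear (shifted_power g k)"
proof (induction k)
  case (Suc k)
  have "linear (\<lambda>w. g w + real k *\<^sub>R w)"
    using assms by (intro linear_compose_add linear_compose_scale_right linear_ident)
  from linear_compose[OF this Suc] show ?case
    by (simp add: o_def)
qed (simp add: linear_ident)

lemma shifted_power_invariant:
  assumes "subspace T" "\<And>w. w \<in> T \<Longrightarrow> g w \<in> T" "w \<in> T"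
  shows "shifted_power g k w \<in> T"
  using assms(3) by (induction k arbitrary: w) (simp_all add: assms subspace_add subspace_scale)

text \<open>Modulo \<open>T\<close> each factor \<open>g + i\<close> acts on \<open>w\<close> as the
  scalar \<open>c + i\<close>.\<close>

lemma shifted_power_eigenvector:
  assumes g: "linear g" and T: "subspace T" "\<And>w. w \<in> T \<Longrightarrow> g w \<in> T" and w: "g w - c *\<^sub>R w \<in> T"
  shows "shifted_power g k w - (\<Prod>i<k. c + real i) *\<^sub>R w \<in> T"
proof (induction k)
  case 0
  then show ?case using T by (simp add: subspace_0)
next
  case (Suc k)
  interpret g: linear "shifted_power g k" by (rule linear_shifted_power[OF g])
  have "shifted_power g k (g w - c *\<^sub>R w) \<in> T"
    using T w by (rule shifted_power_invariant)
  moreover have "(c + real k) *\<^sub>R (shifted_power g k w - (\<Prod>i<k. c + real i) *\<^sub>R w) \<in> T"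
    using Suc T by (simp add: subspace_scale)
  ultimately have "shifted_power g k (g w - c *\<^sub>R w) +
      (c + real k) *\<^sub>R (shifted_power g k w - (\<Prod>i<k. c + real i) *\<^sub>R w) \<in> T"
    using T by (simp add: subspace_add)
  moreover have "shifted_power g k (g w - c *\<^sub>R w) +
      (c + real k) *\<^sub>R (shifted_power g k w - (\<Prod>i<k. c + real i) *\<^sub>R w) =
      shifted_power g (Suc k) w - (\<Prod>i<Suc k. c + real i) *\<^sub>R w"
    by (simp add: g.diff g.add g.scale algebra_simps)
  ultimately show ?case by simp
qed

text \<open>The factors are applied one at a time; the last vector before \<open>T\<close> is
  reached is an eigenvector modulo \<open>T\<close>.\<close>

lemma shifted_power_root:
  assumes "linear g" and T: "subspace T" and R: "subspace R" "\<And>w. w \<in> R \<Longrightarrow> g w \<in> R"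
    and "w \<in> R" "w \<notin> T" "shifted_power g k w \<in> T"
  shows "\<exists>u\<in>R. \<exists>i<k. u \<notin> T \<and> g u + real i *\<^sub>R u \<in> T"
  using assms(5-7)
proof (induction k arbitrary: w)
  case (Suc k)
  show ?case
  proof (cases "g w + real k *\<^sub>R w \<in> T")
    case False
    have "g w + real k *\<^sub>R w \<in> R"
      using R Suc.prems(1) by (simp add: subspace_add subspace_scale)
    from Suc.IH[OF this False] Suc.prems(3) show ?thesis
      using less_Suc_eq by auto
  qed (use Suc.prems in blast)
qed simp

text \<open>The roots of the product are distinct, so its kernel is spanned by eigenvectors. The
  induction step uses that \<open>g + k\<close> maps the span of the eigenvectors for
  \<open>- i\<close>, \<open>i < k\<close>, onto itself.\<close>

lemma shifted_power_kernel:
  assumes g: "linear g" and R: "subspace R" "\<And>w. w \<in> R \<Longrightarrow> g w \<in> R"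
    and "w \<in> R" "shifted_power g k w = 0"
  shows "w \<in> span {e \<in> R. \<exists>i<k. g e = - real i *\<^sub>R e}"
  using assms(4,5)
proof (induction k arbitrary: w)
  case 0
  then show ?case by (simp add: span_zero)
next
  case (Suc k)
  interpret g: linear g by (rule g)
  let ?E = "{e \<in> R. \<exists>i<k. g e = - real i *\<^sub>R e}"
  let ?F = "{e \<in> R. \<exists>i<Suc k. g e = - real i *\<^sub>R e}"
  have ER: "span ?E \<subseteq> R"
    using R by (intro span_minimal) auto
  have "g w + real k *\<^sub>R w \<in> span ?E"
    using Suc R by (auto intro!: Suc.IH simp: subspace_add subspace_scale)
  moreover have "span ?E \<subseteq> {z. \<exists>u\<in>span ?E. g u + real k *\<^sub>R u = z}"
  proof (rule span_minimal)
    show "?E \<subseteq> {z. \<exists>u\<in>span ?E. g u + real k *\<^sub>R u = z}"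
    proof (rule subsetI)
      fix e assume "e \<in> ?E"
      then obtain i where e: "e \<in> R" "i < k" "g e = - real i *\<^sub>R e" by blast
      \<comment> \<open>\<open>g + k\<close> multiplies \<open>e\<close> by the nonzero number
        \<open>k - i\<close>.\<close>
      have "(1 / (real k - real i)) *\<^sub>R e \<in> span ?E"
        using e by (intro span_scale span_base) auto
      moreover have "real k - real i \<noteq> 0" using e by simp
      then have "1 / (real k - real i) * - real i + real k * (1 / (real k - real i)) = 1"
        by (simp add: diff_divide_distrib[symmetric])
      then have "g ((1 / (real k - real i)) *\<^sub>R e) + real k *\<^sub>R (1 / (real k - real i)) *\<^sub>R e = e"
        unfolding g.scale e(3) scaleR_scaleR scaleR_add_left[symmetric] by simp
      ultimately show "e \<in> {z. \<exists>u\<in>span ?E. g u + real k *\<^sub>R u = z}" by blast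
    qed
    have "{z. \<exists>u\<in>span ?E. g u + real k *\<^sub>R u = z} = (\<lambda>u. g u + real k *\<^sub>R u) ` span ?E"
      by auto
    moreover have "linear (\<lambda>u. g u + real k *\<^sub>R u)"
      by (intro linear_compose_add linear_compose_scale_right linear_ident g)
    ultimately show "subspace {z. \<exists>u\<in>span ?E. g u + real k *\<^sub>R u = z}"
      by (simp add: linear_subspace_image)
  qed
  ultimately obtain u where u: "u \<in> span ?E" "g u + real k *\<^sub>R u = g w + real k *\<^sub>R w"
    by auto
  have "g (w - u) = - real k *\<^sub>R (w - u)"
    using u(2) by (simp add: g.diff algebra_simps)
  moreover have "w - u \<in> R"
    using u ER R Suc.prems by (auto intro: subspace_diff)
  ultimately have "w - u \<in> span ?F"
    by (intro span_base) auto
  moreover have "u \<in> span ?F"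
    using u(1) by (rule subsetD[OF span_mono, rotated]) (blast intro: less_SucI)
  ultimately show ?case
    using span_add by fastforce
qed

section \<open>Lowest weight vectors and complete reducibility\<close>

text \<open>Weights are counted from below because \<open>L_space\<close> lies in the kernel of
  \<open>Y\<close>: \<open>x\<close> raises weights by 2, \<open>y\<close> lowers them. One exponent
  \<open>N\<close> serves both nilpotent operators.\<close>

locale sl2_action =
  fixes x y h :: "'a::real_vector \<Rightarrow> 'a" and N :: nat
  assumes lin_x: "linear x" and lin_y: "linear y" and lin_h: "linear h"
    and h_x: "h (x v) = x (h v) + 2 *\<^sub>R x v"
    and h_y: "h (y v) = y (h v) - 2 *\<^sub>R y v"
    and x_y: "x (y v) = y (x v) + h v"
    and x_nilpotent: "(x ^^ N) v = 0" and y_nilpotent: "(y ^^ N) v = 0"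
begin

sublocale x: linear x by (rule lin_x)
sublocale y: linear y by (rule lin_y)
sublocale h: linear h by (rule lin_h)

definition submodule :: "'a set \<Rightarrow> bool" where
  "submodule T \<longleftrightarrow> subspace T \<and> (\<forall>w\<in>T. x w \<in> T \<and> y w \<in> T \<and> h w \<in> T)"

definition lowest :: "nat \<Rightarrow> 'a set" where
  "lowest m = {v. y v = 0 \<and> h v = - real m *\<^sub>R v}"

lemma linear_funpow:
  fixes f :: "'b::real_vector \<Rightarrow> 'b"
  assumes "linear f"
  shows "linear (f ^^ k)"
proof (induction k)
  case (Suc k)
  then show ?case using assms by (simp add: linear_iff)
qed (simp add: linear_ident id_def)

lemma h_x_power: "h ((x ^^ k) v) = (x ^^ k) (h v) + (2 * real k) *\<^sub>R (x ^^ k) v"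
  by (induction k) (simp_all add: h_x x.add x.scale algebra_simps)

lemma y_x_power:
  "y ((x ^^ Suc k) v) = (x ^^ Suc k) (y v) - (real k + 1) *\<^sub>R (x ^^ k) (h v) - (real k * (real k + 1)) *\<^sub>R (x ^^ k) v"
proof (induction k)
  case 0
  then show ?case using x_y[of v] by (simp add: algebra_simps)
next
  case (Suc k)
  let ?D = "(x ^^ Suc (Suc k)) (y v)" and ?B = "(x ^^ Suc k) (h v)" and ?C = "(x ^^ Suc k) v"
  let ?a = "real k + 1" and ?b = "real k * (real k + 1)"
  have "y ((x ^^ Suc (Suc k)) v) = x (y ((x ^^ Suc k) v)) - h ((x ^^ Suc k) v)"
    using x_y[of "(x ^^ Suc k) v"] by simp
  also have "\<dots> = x ((x ^^ Suc k) (y v) - (real k + 1) *\<^sub>R (x ^^ k) (h v) - (real k * (real k + 1)) *\<^sub>R (x ^^ k) v)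
     - (x ^^ Suc k) (h v) - (2 * real (Suc k)) *\<^sub>R (x ^^ Suc k) v"
    unfolding Suc h_x_power by (simp add: algebra_simps)
  also have "\<dots> = ?D - (?a *\<^sub>R ?B + 1 *\<^sub>R ?B) - (?b *\<^sub>R ?C + (2 * real (Suc k)) *\<^sub>R ?C)"
    unfolding x.diff x.scale by simp
  also have "\<dots> = ?D - (?a + 1) *\<^sub>R ?B - (?b + 2 * real (Suc k)) *\<^sub>R ?C"
    unfolding scaleR_left_distrib[symmetric] ..
  also have "?a + 1 = real (Suc k) + 1" by simp
  also have "?b + 2 * real (Suc k) = real (Suc k) * (real (Suc k) + 1)" by (simp add: algebra_simps)
  finally show ?case .
qed

lemma y_x_power_lowest:
  assumes "v \<in> lowest m"
  shows "y ((x ^^ Suc k) v) = ((real k + 1) * (real m - real k)) *\<^sub>R (x ^^ k) v"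
proof -
  interpret xk: linear "x ^^ k" by (rule linear_funpow[OF lin_x])
  have "y v = 0" "h v = - real m *\<^sub>R v"
    using assms by (auto simp: lowest_def)
  moreover have "(x ^^ Suc k) 0 = 0"
    using linear_0[OF linear_funpow[OF lin_x]] .
  ultimately show ?thesis
    by (simp add: y_x_power xk.scale xk.neg algebra_simps del: funpow.simps)
qed

lemma h_x_power_lowest:
  assumes "v \<in> lowest m"
  shows "h ((x ^^ k) v) = (2 * real k - real m) *\<^sub>R (x ^^ k) v"
proof -
  interpret xk: linear "x ^^ k" by (rule linear_funpow[OF lin_x])
  show ?thesis
    using assms by (simp add: h_x_power lowest_def xk.scale xk.neg algebra_simps)
qed

text \<open>Modulo \<open>T\<close>, where \<open>y w\<close> vanishes, moving one \<open>y\<close>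
  past \<open>x ^^ Suc k\<close> leaves \<open>x ^^ k\<close> applied to
  \<open>- (k + 1) (h + k) w\<close>. Repetition collects the factorial and the shifted
  product.\<close>

lemma y_power_x_power:
  assumes T: "submodule T" and "y w \<in> T"
  shows "(y ^^ k) ((x ^^ k) w) - ((- 1) ^ k * fact k) *\<^sub>R shifted_power h k w \<in> T"
  using assms(2)
proof (induction k arbitrary: w)
  case 0
  then show ?case using T by (simp add: submodule_def subspace_0)
next
  case (Suc k)
  interpret yk: linear "y ^^ k" by (rule linear_funpow[OF lin_y])
  interpret xk: linear "x ^^ k" by (rule linear_funpow[OF lin_x])
  have pow: "v \<in> T \<Longrightarrow> (x ^^ j) v \<in> T" "v \<in> T \<Longrightarrow> (y ^^ j) v \<in> T" for j v
    using T by (induction j) (auto simp: submodule_def)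
  let ?w = "h w + real k *\<^sub>R w"
  have "y ?w = h (y w) + (2 + real k) *\<^sub>R y w"
    using h_y[of w] by (simp add: y.add y.scale algebra_simps)
  then have "y ?w \<in> T"
    using Suc.prems T by (simp add: submodule_def subspace_add subspace_scale)
  note IH = Suc.IH[OF this]
  have 1: "(y ^^ Suc k) ((x ^^ Suc k) w) = (y ^^ k) ((x ^^ Suc k) (y w)) - (real k + 1) *\<^sub>R (y ^^ k) ((x ^^ k) ?w)"
    unfolding funpow_Suc_right o_apply y_x_power[unfolded funpow_Suc_right o_apply]
    by (simp add: yk.diff yk.scale yk.add xk.add xk.scale algebra_simps)
  have "(y ^^ k) ((x ^^ Suc k) (y w)) \<in> T"
    using Suc.prems pow by blast
  moreover have "(real k + 1) *\<^sub>R ((y ^^ k) ((x ^^ k) ?w) - ((- 1) ^ k * fact k) *\<^sub>R shifted_power h k ?w) \<in> T"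
    using IH T by (simp add: submodule_def subspace_scale)
  ultimately have "(y ^^ k) ((x ^^ Suc k) (y w)) -
    (real k + 1) *\<^sub>R ((y ^^ k) ((x ^^ k) ?w) - ((- 1) ^ k * fact k) *\<^sub>R shifted_power h k ?w) \<in> T"
    using T by (simp add: submodule_def subspace_diff)
  moreover have "(y ^^ k) ((x ^^ Suc k) (y w)) -
    (real k + 1) *\<^sub>R ((y ^^ k) ((x ^^ k) ?w) - ((- 1) ^ k * fact k) *\<^sub>R shifted_power h k ?w) =
    (y ^^ Suc k) ((x ^^ Suc k) w) - ((- 1) ^ Suc k * fact (Suc k)) *\<^sub>R shifted_power h (Suc k) w"
    unfolding 1 by (simp add: algebra_simps)
  ultimately show ?case by simp
qed

text \<open>At exponent \<open>N\<close> the left side of the preceding congruence vanishes. On the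
  kernel of \<open>y\<close> modulo \<open>T\<close>, \<open>h\<close> therefore satisfies a
  polynomial with simple roots \<open>- i\<close>, \<open>i < N\<close>; this is the source of
  diagonalizability and of integral weights.\<close>

lemma shifted_power_h_mem:
  assumes T: "submodule T" and "y w \<in> T"
  shows "shifted_power h N w \<in> T"
proof -
  have "((- 1) ^ N * fact N) *\<^sub>R shifted_power h N w \<in> T"
    using y_power_x_power[OF assms, of N] T subspace_neg[of T]
    by (fastforce simp: x_nilpotent y_nilpotent submodule_def)
  then have "(1 / ((- 1) ^ N * fact N)) *\<^sub>R ((- 1) ^ N * fact N) *\<^sub>R shifted_power h N w \<in> T"
    using T subspace_scale unfolding submodule_def by blast
  then show ?thesis by simp
qed

lemma submodule_0: "submodule {0}"
  by (simp add: submodule_def)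

lemma shifted_power_h_kernel: "y w = 0 \<Longrightarrow> shifted_power h N w = 0"
  using shifted_power_h_mem[OF submodule_0] by simp

lemma kernel_eigenvalue:
  assumes "y w = 0" "h w = c *\<^sub>R w" "w \<noteq> 0"
  shows "\<exists>i<N. c = - real i"
proof -
  have "(\<Prod>i<N. c + real i) *\<^sub>R w = 0"
    using shifted_power_eigenvector[OF lin_h subspace_single_0, of w c N] assms shifted_power_h_kernel
    by simp
  then have "(\<Prod>i<N. c + real i) = 0" using assms by simp
  then show ?thesis by (simp add: eq_neg_iff_add_eq_0) blast
qed

lemma lowest_bound: "v \<in> lowest m \<Longrightarrow> v \<noteq> 0 \<Longrightarrow> m < N"
  using kernel_eigenvalue[of v "- real m"] by (auto simp: lowest_def)

text \<open>Otherwise \<open>x ^^ Suc m\<close> would send \<open>v\<close> to a nonzero vector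
  killed by \<open>y\<close> and of positive weight \<open>m + 2\<close>, but the weights on the
  kernel of \<open>y\<close> are nonpositive.\<close>

lemma x_power_lowest_eq_0:
  assumes v: "v \<in> lowest m" and "m < j"
  shows "(x ^^ j) v = 0"
proof -
  have "(x ^^ Suc m) v = 0"
  proof (rule ccontr)
    assume "(x ^^ Suc m) v \<noteq> 0"
    then obtain i where "2 * real (Suc m) - real m = - real i"
      using kernel_eigenvalue[OF _ h_x_power_lowest[OF v, of "Suc m"]] y_x_power_lowest[OF v, of m]
      by auto
    then have "real (2 * Suc m + i) = real m" by simp
    then show False by (simp only: of_nat_eq_iff) simp
  qed
  moreover have "(x ^^ j) v = (x ^^ (j - Suc m)) ((x ^^ Suc m) v)"
    using assms(2) by (simp add: funpow_add[symmetric, THEN fun_cong, unfolded o_apply] del: funpow.simps)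
  ultimately show ?thesis
    using linear_0[OF linear_funpow[OF lin_x]] by simp
qed

text \<open>Each \<open>y\<close> undoes one \<open>x\<close> up to a factor
  \<open>(i + 1) (m - i)\<close>, which is positive for \<open>i < m\<close>.\<close>

lemma y_power_x_power_lowest:
  assumes v: "v \<in> lowest m" and "j \<le> m"
  shows "\<exists>c>0. (y ^^ j) ((x ^^ j) v) = c *\<^sub>R v"
  using assms(2)
proof (induction j)
  case 0
  then show ?case by (intro exI[of _ 1]) simp
next
  case (Suc j)
  then obtain c where c: "c > 0" "(y ^^ j) ((x ^^ j) v) = c *\<^sub>R v" by auto
  interpret yj: linear "y ^^ j" by (rule linear_funpow[OF lin_y])
  have "(y ^^ Suc j) ((x ^^ Suc j) v) = (y ^^ j) (y ((x ^^ Suc j) v))"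
    unfolding funpow_Suc_right o_apply ..
  also have "\<dots> = (((real j + 1) * (real m - real j)) * c) *\<^sub>R v"
    unfolding y_x_power_lowest[OF v] by (simp add: yj.scale c)
  finally have "(y ^^ Suc j) ((x ^^ Suc j) v) = ((real j + 1) * (real m - real j) * c) *\<^sub>R v" .
  moreover have "(real j + 1) * (real m - real j) * c > 0" using c Suc.prems by simp
  ultimately show ?case by blast
qed

lemma y_power_x_power_lowest_eq_0:
  assumes v: "v \<in> lowest m"
  shows "(y ^^ Suc j) ((x ^^ j) v) = 0"
proof (induction j)
  case 0
  then show ?case using v by (simp add: lowest_def)
next
  case (Suc j)
  interpret yj: linear "y ^^ Suc j" by (rule linear_funpow[OF lin_y])
  have "(y ^^ Suc (Suc j)) ((x ^^ Suc j) v) = (y ^^ Suc j) (y ((x ^^ Suc j) v))"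
    unfolding funpow_Suc_right[of "Suc j"] o_apply ..
  also have "\<dots> = 0"
    unfolding y_x_power_lowest[OF v] yj.scale Suc by simp
  finally show ?case .
qed

lemma y_power_x_power_lowest_gt:
  assumes "v \<in> lowest m" "j < k"
  shows "(y ^^ k) ((x ^^ j) v) = 0"
proof -
  have "(y ^^ k) ((x ^^ j) v) = (y ^^ (k - Suc j)) ((y ^^ Suc j) ((x ^^ j) v))"
    using assms(2) by (simp add: funpow_add[symmetric, THEN fun_cong, unfolded o_apply] del: funpow.simps)
  then show ?thesis
    using linear_0[OF linear_funpow[OF lin_y]] y_power_x_power_lowest_eq_0[OF assms(1)] by simp
qed

lemma subspace_lowest: "subspace (lowest m)"
  by (rule subspaceI) (auto simp: lowest_def y.add h.add y.scale h.scale algebra_simps)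

text \<open>Downward induction on the exponent. When all terms beyond \<open>J\<close> vanish,
  \<open>y ^^ J\<close> kills the terms below \<open>J\<close> and turns those at \<open>J\<close>
  into positive multiples of \<open>u m J\<close>, which lie in different weight spaces.\<close>

lemma lowest_decomposition_independent:
  assumes u: "\<And>m j. j \<le> m \<Longrightarrow> m < M \<Longrightarrow> u m j \<in> lowest m"
    and sum0: "(\<Sum>m<M. \<Sum>j\<le>m. (x ^^ j) (u m j)) = 0"
    and "j \<le> m" "m < M"
  shows "u m j = 0"
proof -
  have "\<forall>m j. M - k \<le> j \<longrightarrow> j \<le> m \<longrightarrow> m < M \<longrightarrow> u m j = 0" for k
  proof (induction k)
    case (Suc k)
    show ?case
    proof (cases "k < M")
      case True
      \<comment> \<open>The largest exponent not yet treated; exponents from \<open>M\<close> on do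
        not occur, since \<open>j \<le> m\<close> and \<open>m < M\<close>.\<close>
      define J where "J = M - Suc k"
      have J: "M - k = Suc J" "J < M" using True by (auto simp: J_def)
      interpret yJ: linear "y ^^ J" by (rule linear_funpow[OF lin_y])
      let ?w = "\<lambda>m. if J \<le> m then (y ^^ J) ((x ^^ J) (u m J)) else 0"
      have "(y ^^ J) (\<Sum>j\<le>m. (x ^^ j) (u m j)) = ?w m" if "m < M" for m
      proof -
        have "(y ^^ J) (\<Sum>j\<le>m. (x ^^ j) (u m j)) = (\<Sum>j\<le>m. (y ^^ J) ((x ^^ j) (u m j)))"
          by (simp add: yJ.sum)
        also have "\<dots> = (\<Sum>j\<le>m. if j = J then (y ^^ J) ((x ^^ J) (u m J)) else 0)"
        proof (intro sum.cong refl)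
          fix j assume j: "j \<in> {..m}"
          consider "j < J" | "j = J" | "J < j" by linarith
          then show "(y ^^ J) ((x ^^ j) (u m j)) = (if j = J then (y ^^ J) ((x ^^ J) (u m J)) else 0)"
          proof cases
            case 1
            then show ?thesis
              using y_power_x_power_lowest_gt[OF u] j that by auto
          next
            case 3
            then have "u m j = 0" using Suc J j that by auto
            then show ?thesis
              using 3 by (simp add: linear_0[OF linear_funpow[OF lin_x]])
          qed simp
        qed
        also have "\<dots> = ?w m" by simp
        finally show ?thesis .
      qed
      then have "(\<Sum>m<M. ?w m) = (\<Sum>m<M. (y ^^ J) (\<Sum>j\<le>m. (x ^^ j) (u m j)))"
        by (intro sum.cong) auto
      also have "\<dots> = (y ^^ J) (\<Sum>m<M. \<Sum>j\<le>m. (x ^^ j) (u m j))"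
        by (rule yJ.sum[symmetric])
      finally have "(\<Sum>m<M. ?w m) = (y ^^ J) (\<Sum>m<M. \<Sum>j\<le>m. (x ^^ j) (u m j))" .
      then have sum_w: "(\<Sum>m<M. ?w m) = 0" using sum0 by simp
      have w: "\<exists>c>0. ?w m = c *\<^sub>R u m J" if "J \<le> m" "m < M" for m
        using y_power_x_power_lowest[OF u that(1)] that by auto
      have "?w m = 0" if "m < M" for m
      proof (rule eigenvectors_independent[OF lin_h _ _ _ sum_w])
        fix m assume m: "m \<in> {..<M}"
        show "h (?w m) = (- real m) *\<^sub>R ?w m"
        proof (cases "J \<le> m")
          case True
          then have "?w m \<in> lowest m"
            using w[OF True] m u[OF True] subspace_scale[OF subspace_lowest] by fastforce
          then show ?thesis by (simp add: lowest_def)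
        qed simp
      qed (use that in \<open>auto simp: inj_on_def\<close>)
      then have uJ: "u m J = 0" if "J \<le> m" "m < M" for m
        using w[OF that] that by (metis less_irrefl scaleR_eq_0_iff)
      show ?thesis
      proof (intro allI impI)
        fix m j assume mj: "M - Suc k \<le> j" "j \<le> m" "m < M"
        show "u m j = 0"
        proof (cases "j = J")
          case False
          then have "M - k \<le> j" using mj(1) J J_def by linarith
          then show ?thesis using Suc mj by blast
        qed (use uJ mj in auto)
      qed
    qed (use Suc in auto)
  qed simp
  from this[of M] show ?thesis using assms by simp
qed

definition lowest_span :: "'a set" where
  "lowest_span = span {(x ^^ j) v | j v. \<exists>m. j \<le> m \<and> v \<in> lowest m}"

lemma x_power_lowest_span:
  assumes "v \<in> lowest m"
  shows "(x ^^ j) v \<in> lowest_span"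
proof (cases "j \<le> m")
  case True
  then show ?thesis unfolding lowest_span_def using assms by (intro span_base) blast
next
  case False
  then show ?thesis using x_power_lowest_eq_0[OF assms] by (simp add: lowest_span_def span_zero)
qed

lemma lowest_span_induct [consumes 1, case_names subspace generator]:
  assumes "w \<in> lowest_span" "subspace P" "\<And>m j v. v \<in> lowest m \<Longrightarrow> j \<le> m \<Longrightarrow> (x ^^ j) v \<in> P"
  shows "w \<in> P"
proof -
  have "lowest_span \<subseteq> P"
    unfolding lowest_span_def using assms by (intro span_minimal) auto
  then show ?thesis using assms by blast
qed

lemma submodule_lowest_span: "submodule lowest_span"
  unfolding submodule_def
proof (intro conjI ballI)
  show *: "subspace lowest_span" by (simp add: lowest_span_def)
  fix w assume "w \<in> lowest_span"
  then have "w \<in> {w. x w \<in> lowest_span}"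
  proof (induction rule: lowest_span_induct)
    case subspace
    then show ?case
      using linear_subspace_vimage[OF lin_x *] by (simp add: vimage_def)
  next
    case (generator m j v)
    then show ?case using x_power_lowest_span[of v m "Suc j"] by simp
  qed
  then show "x w \<in> lowest_span" by simp
  from \<open>w \<in> lowest_span\<close> have "w \<in> {w. h w \<in> lowest_span}"
  proof (induction rule: lowest_span_induct)
    case subspace
    then show ?case
      using linear_subspace_vimage[OF lin_h *] by (simp add: vimage_def)
  next
    case (generator m j v)
    then show ?case
      using x_power_lowest_span[of v m j] * by (simp add: h_x_power_lowest subspace_scale)
  qed
  then show "h w \<in> lowest_span" by simp
  from \<open>w \<in> lowest_span\<close> have "w \<in> {w. y w \<in> lowest_span}"
  proof (induction rule: lowest_span_induct)
    case subspace
    then show ?case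
      using linear_subspace_vimage[OF lin_y *] by (simp add: vimage_def)
  next
    case (generator m j v)
    then show ?case
    proof (cases j)
      case 0
      then show ?thesis using generator subspace_0[OF *] by (simp add: lowest_def)
    next
      case (Suc k)
      then show ?thesis using generator y_x_power_lowest[of v m k] x_power_lowest_span[of v m k] *
        by (simp add: subspace_scale del: funpow.simps)
    qed
  qed
  then show "y w \<in> lowest_span" by simp
qed

text \<open>\<open>h\<close> preserves the kernel of \<open>y\<close> and is diagonalizable there
  with eigenvalues \<open>- i\<close>, so the kernel is spanned by lowest weight vectors.\<close>

lemma kernel_in_lowest_span:
  assumes "y w = 0"
  shows "w \<in> lowest_span"
proof -
  have "subspace {w. y w = 0}"
    by (rule subspaceI) (auto simp: y.add y.scale)
  moreover have "y (h w) = 0" if "y w = 0" for w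
    using h_y[of w] that by simp
  ultimately have "w \<in> span {e \<in> {w. y w = 0}. \<exists>i<N. h e = - real i *\<^sub>R e}"
    using assms shifted_power_h_kernel by (intro shifted_power_kernel lin_h) auto
  moreover have "\<dots> \<subseteq> lowest_span"
  proof (rule span_minimal)
    show "{e \<in> {w. y w = 0}. \<exists>i<N. h e = - real i *\<^sub>R e} \<subseteq> lowest_span"
      using x_power_lowest_span[where j = 0] by (auto simp: lowest_def)
  qed (use submodule_lowest_span in \<open>simp add: submodule_def\<close>)
  ultimately show ?thesis by blast
qed

text \<open>On \<open>lowest_span / y ` lowest_span\<close>, spanned by the classes of the highest weight vectors, the
  eigenvalues of \<open>h\<close> are nonnegative.\<close>

lemma in_y_image_lowest_span:
  assumes z: "z \<in> lowest_span" and "h z + c *\<^sub>R z \<in> y ` lowest_span" and "c > 0"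
  shows "z \<in> y ` lowest_span"
proof -
  let ?T = "y ` lowest_span"
  have S: "subspace lowest_span" "\<And>w. w \<in> lowest_span \<Longrightarrow> h w \<in> lowest_span"
    using submodule_lowest_span by (auto simp: submodule_def)
  have T: "subspace ?T"
    using S lin_y by (intro linear_subspace_image)
  have hT: "- h w \<in> ?T" if w: "w \<in> ?T" for w
  proof -
    obtain s where s: "s \<in> lowest_span" "w = y s" using w by auto
    have "- h w = y (- (h s) + 2 *\<^sub>R s)"
      by (simp add: s h_y y.add y.diff y.neg y.scale)
    moreover have "- (h s) + 2 *\<^sub>R s \<in> lowest_span"
      using s S by (intro subspace_add subspace_scale subspace_neg) auto
    ultimately show ?thesis by blast
  qed
  have lin: "linear (\<lambda>w. - h w)"
    by (intro linear_compose_neg lin_h)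
  \<comment> \<open>Modulo the image of \<open>y\<close>, \<open>- h\<close> acts on
    \<open>z\<close> as \<open>c\<close>, so the product acts as a nonzero scalar.\<close>
  have "shifted_power (\<lambda>w. - h w) N z - (\<Prod>i<N. c + real i) *\<^sub>R z \<in> ?T"
  proof (rule shifted_power_eigenvector[OF lin T hT])
    have "- (h z + c *\<^sub>R z) \<in> ?T" by (rule subspace_neg[OF T assms(2)])
    moreover have "- h z - c *\<^sub>R z = - (h z + c *\<^sub>R z)" by simp
    ultimately show "- h z - c *\<^sub>R z \<in> ?T" by (simp only:)
  qed
  \<comment> \<open>The same product maps all of \<open>lowest_span\<close> into the image of
    \<open>y\<close>: a nonzero highest vector \<open>(x ^^ m) v\<close> has weight
    \<open>m < N\<close> and meets the vanishing factor \<open>i = m\<close>, while every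
    \<open>(x ^^ j) v\<close> with \<open>j < m\<close> is already an image under
    \<open>y\<close>.\<close>
  moreover have "z \<in> {z. shifted_power (\<lambda>w. - h w) N z \<in> ?T}"
    using z
  proof (induction rule: lowest_span_induct)
    case subspace
    then show ?case
      using linear_subspace_vimage[OF linear_shifted_power[OF lin] T] by (simp add: vimage_def)
  next
    case (generator m j v)
    show ?case
    proof (cases "j = m")
      case True
      have "shifted_power (\<lambda>w. - h w) N ((x ^^ m) v) = (\<Prod>i<N. - real m + real i) *\<^sub>R (x ^^ m) v"
        using shifted_power_eigenvector[OF lin subspace_single_0, of "(x ^^ m) v" "- real m" N]
          h_x_power_lowest[OF generator(1), of m]
        by (simp add: linear_0[OF lin_h])
      also have "\<dots> = 0"
      proof (cases "v = 0")
        case True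
        then show ?thesis by (simp add: linear_0[OF linear_funpow[OF lin_x]])
      next
        case False
        then have "m < N" using generator lowest_bound by blast
        then have "(\<Prod>i<N. - real m + real i) = 0" by (intro prod_zero) auto
        then show ?thesis by simp
      qed
      finally show ?thesis using True T by (simp add: subspace_0)
    next
      case False
      let ?c = "(real j + 1) * (real m - real j)"
      have "?c \<noteq> 0" using False by auto
      then have "(x ^^ j) v = y ((1 / ?c) *\<^sub>R (x ^^ Suc j) v)"
        unfolding y.scale y_x_power_lowest[OF generator(1)] by (simp del: funpow.simps)
      moreover have "(1 / ?c) *\<^sub>R (x ^^ Suc j) v \<in> lowest_span"
        using S x_power_lowest_span[OF generator(1)] by (intro subspace_scale)
      ultimately have "(x ^^ j) v \<in> ?T" by blast
      then show ?thesis using shifted_power_invariant[of ?T "\<lambda>w. - h w", OF T hT] by blast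
    qed
  qed
  then have "shifted_power (\<lambda>w. - h w) N z \<in> ?T" by simp
  ultimately have "shifted_power (\<lambda>w. - h w) N z -
      (shifted_power (\<lambda>w. - h w) N z - (\<Prod>i<N. c + real i) *\<^sub>R z) \<in> ?T"
    by (rule subspace_diff[OF T, rotated])
  then have "(\<Prod>i<N. c + real i) *\<^sub>R z \<in> ?T" by (simp only: diff_diff_eq2 add_diff_cancel_left')
  from subspace_scale[OF T this]
  have "(1 / (\<Prod>i<N. c + real i)) *\<^sub>R (\<Prod>i<N. c + real i) *\<^sub>R z \<in> ?T" .
  moreover have "(\<Prod>i<N. c + real i) \<noteq> 0"
    using \<open>c > 0\<close> by (auto simp: add_eq_0_iff)
  ultimately show ?thesis by simp
qed

text \<open>Complete reducibility. Otherwise some \<open>u\<close> outside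
  \<open>lowest_span\<close>, with \<open>y u\<close> inside, has weight \<open>- i\<close> modulo
  \<open>lowest_span\<close>. Then \<open>y u\<close> has weight \<open>- (i + 2)\<close> modulo the
  image of \<open>lowest_span\<close> under \<open>y\<close>, hence lies in that image. Subtracting
  a preimage from \<open>u\<close> leaves a vector killed by \<open>y\<close>, which belongs to
  \<open>lowest_span\<close>.\<close>

lemma lowest_span_UNIV: "lowest_span = UNIV"
proof (rule ccontr)
  assume "lowest_span \<noteq> UNIV"
  then obtain w where w: "w \<notin> lowest_span" by blast
  have S: "subspace lowest_span" "\<And>w. w \<in> lowest_span \<Longrightarrow> h w \<in> lowest_span"
    using submodule_lowest_span by (auto simp: submodule_def)
  \<comment> \<open>The last of the vectors \<open>w, y w, ...\<close> outside
    \<open>lowest_span\<close> represents a nonzero kernel vector of \<open>y\<close> in the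
    quotient.\<close>
  define k where "k = (LEAST k. (y ^^ k) w \<in> lowest_span)"
  have "(y ^^ N) w \<in> lowest_span"
    using S by (simp add: y_nilpotent subspace_0)
  then have k: "(y ^^ k) w \<in> lowest_span" unfolding k_def by (rule LeastI)
  then have "k \<noteq> 0" using w by (intro notI) simp
  then obtain l where l: "k = Suc l" by (cases k) auto
  have "(y ^^ l) w \<notin> lowest_span"
    using not_less_Least[of l "\<lambda>k. (y ^^ k) w \<in> lowest_span"] unfolding k_def[symmetric] l by blast
  moreover have yw: "y ((y ^^ l) w) \<in> lowest_span" using k l by simp
  moreover have "subspace {w. y w \<in> lowest_span}"
    using linear_subspace_vimage[OF lin_y S(1)] by (simp add: vimage_def)
  moreover have "y (h w) \<in> lowest_span" if "y w \<in> lowest_span" for w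
  proof -
    have "y (h w) = h (y w) + 2 *\<^sub>R y w" using h_y[of w] by simp
    then show ?thesis using that S by (simp add: subspace_add subspace_scale)
  qed
  ultimately have "\<exists>u\<in>{w. y w \<in> lowest_span}. \<exists>i<N. u \<notin> lowest_span \<and> h u + real i *\<^sub>R u \<in> lowest_span"
    using shifted_power_h_mem[OF submodule_lowest_span yw]
    by (intro shifted_power_root lin_h S(1)) auto
  then obtain u i where u: "y u \<in> lowest_span" "u \<notin> lowest_span" "h u + real i *\<^sub>R u \<in> lowest_span"
    by auto
  have "h (y u) + (real i + 2) *\<^sub>R y u = y (h u + real i *\<^sub>R u)"
    by (simp add: h_y y.add y.scale algebra_simps)
  then have "h (y u) + (real i + 2) *\<^sub>R y u \<in> y ` lowest_span"
    using u(3) by (simp only: imageI)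
  from in_y_image_lowest_span[OF u(1) this] have "y u \<in> y ` lowest_span"
    by simp
  then obtain s where s: "s \<in> lowest_span" "y u = y s" by auto
  then have "u - s \<in> lowest_span"
    by (intro kernel_in_lowest_span) (simp add: y.diff)
  then have "u \<in> lowest_span"
    using s S(1) subspace_add[of lowest_span "u - s" s] by simp
  with u show False by blast
qed

section \<open>Irreducible submodules and the Casimir operator\<close>

definition chain :: "'a \<Rightarrow> nat \<Rightarrow> 'a set" where
  "chain v m = span ((\<lambda>j. (x ^^ j) v) ` {..m})"

lemma x_power_lowest_ne_0:
  assumes "v \<in> lowest m" "v \<noteq> 0" "j \<le> m"
  shows "(x ^^ j) v \<noteq> 0"
proof
  assume "(x ^^ j) v = 0"
  moreover obtain c where "c > 0" "(y ^^ j) ((x ^^ j) v) = c *\<^sub>R v"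
    using y_power_x_power_lowest assms by blast
  ultimately show False
    using assms linear_0[OF linear_funpow[OF lin_y]] by simp
qed

lemma chain_coefficients_0:
  assumes v: "v \<in> lowest m" "v \<noteq> 0" and "(\<Sum>j\<le>m. a j *\<^sub>R (x ^^ j) v) = 0" "j \<le> m"
  shows "a j = 0"
proof -
  have "a j *\<^sub>R (x ^^ j) v = 0"
    by (rule eigenvectors_independent[OF lin_h _ _ _ assms(3), of "\<lambda>j. 2 * real j - real m"])
       (use assms in \<open>auto simp: h.scale h_x_power_lowest inj_on_def\<close>)
  then show ?thesis using x_power_lowest_ne_0[OF v assms(4)] by simp
qed

lemma inj_on_chain:
  assumes v: "v \<in> lowest m" "v \<noteq> 0"
  shows "inj_on (\<lambda>j. (x ^^ j) v) {..m}"
proof (rule inj_onI; rule ccontr)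
  fix i j assume ij: "i \<in> {..m}" "j \<in> {..m}" "(x ^^ i) v = (x ^^ j) v" "i \<noteq> j"
  have "(2 * real i - real m) *\<^sub>R (x ^^ i) v = (2 * real j - real m) *\<^sub>R (x ^^ i) v"
    using h_x_power_lowest[OF v(1)] ij(3) by metis
  then show False using x_power_lowest_ne_0[OF v, of i] ij by simp
qed

lemma mem_chain_iff:
  assumes v: "v \<in> lowest m" "v \<noteq> 0"
  shows "w \<in> chain v m \<longleftrightarrow> (\<exists>a. w = (\<Sum>j\<le>m. a j *\<^sub>R (x ^^ j) v))"
proof
  assume "w \<in> chain v m"
  then obtain b where "w = (\<Sum>u\<in>(\<lambda>j. (x ^^ j) v) ` {..m}. b u *\<^sub>R u)"
    unfolding chain_def by (subst (asm) span_finite) auto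
  then have "w = (\<Sum>j\<le>m. b ((x ^^ j) v) *\<^sub>R (x ^^ j) v)"
    by (simp add: sum.reindex[OF inj_on_chain[OF v]])
  then show "\<exists>a. w = (\<Sum>j\<le>m. a j *\<^sub>R (x ^^ j) v)"
    by (rule exI[of _ "\<lambda>j. b ((x ^^ j) v)"])
next
  assume "\<exists>a. w = (\<Sum>j\<le>m. a j *\<^sub>R (x ^^ j) v)"
  then show "w \<in> chain v m"
    unfolding chain_def by clarify (rule span_sum, rule span_scale, rule span_base, rule imageI)
qed

lemma dim_chain:
  assumes v: "v \<in> lowest m" "v \<noteq> 0"
  shows "dim (chain v m) = Suc m"
proof -
  let ?B = "(\<lambda>j. (x ^^ j) v) ` {..m}"
  have "independent ?B"
  proof (rule independent_if_scalars_zero)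
    fix b u assume 0: "(\<Sum>u\<in>?B. b u *\<^sub>R u) = 0" and "u \<in> ?B"
    then obtain j where j: "j \<le> m" "u = (x ^^ j) v" by auto
    have "(\<Sum>j\<le>m. b ((x ^^ j) v) *\<^sub>R (x ^^ j) v) = 0"
      using 0 by (simp add: sum.reindex[OF inj_on_chain[OF v]])
    from chain_coefficients_0[OF v this j(1)] j show "b u = 0" by simp
  qed simp
  then show ?thesis
    unfolding chain_def dim_span_eq_card_independent[OF \<open>independent ?B\<close>]
    by (simp add: card_image inj_on_chain[OF v])
qed

lemma submodule_chain:
  assumes v: "v \<in> lowest m"
  shows "submodule (chain v m)"
proof -
  have sub: "subspace (chain v m)" by (simp add: chain_def)
  have mem: "(x ^^ j) v \<in> chain v m" for j
  proof (cases "j \<le> m")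
    case True
    then show ?thesis by (auto simp: chain_def intro!: span_base)
  next
    case False
    then show ?thesis using sub by (simp add: x_power_lowest_eq_0[OF v] subspace_0)
  qed
  have vim: "chain v m \<subseteq> f -` chain v m" if "linear f" "\<And>j. f ((x ^^ j) v) \<in> chain v m" for f
    unfolding chain_def
    by (rule span_minimal) (use that linear_subspace_vimage[OF that(1) sub] in \<open>auto simp: chain_def[symmetric]\<close>)
  have "y ((x ^^ j) v) \<in> chain v m" for j
  proof (cases j)
    case 0
    then show ?thesis using v sub by (simp add: lowest_def subspace_0)
  next
    case (Suc k)
    then show ?thesis using y_x_power_lowest[OF v, of k] mem sub by (simp add: subspace_scale del: funpow.simps)
  qed
  moreover have "x ((x ^^ j) v) \<in> chain v m" for j
    using mem[of "Suc j"] by simp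
  moreover have "h ((x ^^ j) v) \<in> chain v m" for j
    using h_x_power_lowest[OF v] mem sub by (simp add: subspace_scale)
  ultimately show ?thesis
    using vim[OF lin_x] vim[OF lin_y] vim[OF lin_h] sub unfolding submodule_def by blast
qed

text \<open>Nilpotency of \<open>y\<close> gives a nonzero kernel vector in \<open>W\<close>; the
  vanishing shifted product of \<open>h\<close> on the kernel then yields an eigenvector
  there.\<close>

lemma submodule_contains_lowest:
  assumes W: "submodule W" "W \<noteq> {0}"
  shows "\<exists>v m. v \<in> W \<and> v \<in> lowest m \<and> v \<noteq> 0"
proof -
  have sub: "subspace W" using W by (simp add: submodule_def)
  then obtain w where w: "w \<in> W" "w \<noteq> 0" using W(2) subspace_0 by blast
  define k where "k = (LEAST k. (y ^^ k) w = 0)"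
  have k: "(y ^^ k) w = 0" unfolding k_def by (rule LeastI) (rule y_nilpotent)
  then have "k \<noteq> 0" using w by (intro notI) simp
  then obtain l where l: "k = Suc l" by (cases k) auto
  define w' where "w' = (y ^^ l) w"
  have "w' \<noteq> 0"
    using not_less_Least[of l "\<lambda>k. (y ^^ k) w = 0"] unfolding k_def[symmetric] l w'_def by blast
  have "(y ^^ j) w \<in> W" for j
    using w W by (induction j) (auto simp: submodule_def)
  then have "w' \<in> W" by (simp add: w'_def)
  have "y w' = 0" using k l by (simp add: w'_def)
  have "subspace {w \<in> W. y w = 0}"
    using sub by (intro subspaceI) (auto simp: y.add y.scale subspace_0 subspace_add subspace_scale)
  moreover have "h w \<in> {w \<in> W. y w = 0}" if "w \<in> {w \<in> W. y w = 0}" for w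
    using that W h_y[of w] by (auto simp: submodule_def)
  ultimately have "\<exists>u\<in>{w \<in> W. y w = 0}. \<exists>i<N. u \<notin> {0} \<and> h u + real i *\<^sub>R u \<in> {0}"
    using \<open>w' \<in> W\<close> \<open>w' \<noteq> 0\<close> \<open>y w' = 0\<close> shifted_power_h_kernel
    by (intro shifted_power_root[of h _ _ w'] lin_h) auto
  then obtain u i where "u \<in> W" "y u = 0" "u \<noteq> 0" "h u + real i *\<^sub>R u = 0"
    by blast
  then have "u \<in> W \<and> u \<in> lowest i \<and> u \<noteq> 0"
    by (simp add: lowest_def eq_neg_iff_add_eq_0)
  then show ?thesis by blast
qed

text \<open>\<open>y\<close> lowers the chain with nonzero factors, so a combination killed by
  \<open>y\<close> is a multiple of \<open>v\<close>. A nonzero submodule of the chain thus contains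
  \<open>v\<close>.\<close>

lemma chain_irreducible:
  assumes v: "v \<in> lowest m" "v \<noteq> 0" and W: "submodule W" "W \<noteq> {0}" "W \<subseteq> chain v m"
  shows "W = chain v m"
proof -
  obtain u k where u: "u \<in> W" "u \<in> lowest k" "u \<noteq> 0"
    using submodule_contains_lowest[OF W(1,2)] by blast
  then obtain a where a: "u = (\<Sum>j\<le>m. a j *\<^sub>R (x ^^ j) v)"
    using W(3) mem_chain_iff[OF v] by blast
  \<comment> \<open>The coefficients of \<open>y u\<close>. The factor \<open>m - j\<close> vanishes
    at \<open>j = m\<close>, where \<open>a (Suc m)\<close> is not a coefficient of
    \<open>u\<close>.\<close>
  let ?b = "\<lambda>j. a (Suc j) * ((real j + 1) * (real m - real j))"
  have "(\<Sum>j\<le>m. ?b j *\<^sub>R (x ^^ j) v) = (\<Sum>j<m. ?b j *\<^sub>R (x ^^ j) v)"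
    by (simp add: lessThan_Suc_atMost[symmetric])
  also have "\<dots> = (\<Sum>j<m. a (Suc j) *\<^sub>R y ((x ^^ Suc j) v))"
    by (simp add: y_x_power_lowest[OF v(1)] del: funpow.simps)
  also have "\<dots> = (\<Sum>j<Suc m. a j *\<^sub>R y ((x ^^ j) v))"
    using v(1) by (simp add: sum.lessThan_Suc_shift lowest_def del: sum.lessThan_Suc)
  also have "\<dots> = y u"
    by (simp add: a y.sum y.scale lessThan_Suc_atMost)
  also have "\<dots> = 0" using u by (simp add: lowest_def)
  finally have 0: "(\<Sum>j\<le>m. ?b j *\<^sub>R (x ^^ j) v) = 0" .
  have a0: "a (Suc j) = 0" if "j < m" for j
    using chain_coefficients_0[OF v 0, of j] that by auto
  have "u = (\<Sum>j<Suc m. a j *\<^sub>R (x ^^ j) v)"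
    by (simp add: a lessThan_Suc_atMost)
  also have "\<dots> = a 0 *\<^sub>R v"
    using a0 by (simp add: sum.lessThan_Suc_shift del: sum.lessThan_Suc funpow.simps(2))
  finally have u': "u = a 0 *\<^sub>R v" .
  then have "v = (1 / a 0) *\<^sub>R u" using u by auto
  then have "v \<in> W" using u W(1) by (metis submodule_def subspace_scale)
  then have "(x ^^ j) v \<in> W" for j
    using W by (induction j) (auto simp: submodule_def)
  then have "chain v m \<subseteq> W"
    unfolding chain_def using W(1) by (intro span_minimal) (auto simp: submodule_def)
  then show ?thesis using W(3) by blast
qed

lemma irreducible_eq_chain:
  assumes W: "submodule W" "W \<noteq> {0}" and irr: "\<And>W'. submodule W' \<Longrightarrow> W' \<subseteq> W \<Longrightarrow> W' = {0} \<or> W' = W"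
  shows "\<exists>v m. v \<in> lowest m \<and> v \<noteq> 0 \<and> W = chain v m"
proof -
  obtain v m where v: "v \<in> W" "v \<in> lowest m" "v \<noteq> 0"
    using submodule_contains_lowest[OF W] by blast
  have "(x ^^ j) v \<in> W" for j
    using v W by (induction j) (auto simp: submodule_def)
  then have "chain v m \<subseteq> W"
    unfolding chain_def using W(1) by (intro span_minimal) (auto simp: submodule_def)
  moreover have "(x ^^ 0) v \<in> chain v m"
    unfolding chain_def by (intro span_base imageI) simp
  then have "chain v m \<noteq> {0}" using v(3) by auto
  ultimately have "W = chain v m"
    using irr[OF submodule_chain[OF v(2)]] by blast
  then show ?thesis using v by blast
qed

text \<open>On a chain of lowest weight \<open>- m\<close> this acts as the scalar
  \<open>m (m + 2)\<close>. It detects the chain length of a sum of vectors from several irreducible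
  submodules of one dimension.\<close>

definition casimir :: "'a \<Rightarrow> 'a" where
  "casimir w = h (h w) + 2 *\<^sub>R x (y w) + 2 *\<^sub>R y (x w)"

lemma linear_casimir: "linear casimir"
  unfolding casimir_def
  by (rule linearI) (simp_all add: x.add y.add h.add x.scale y.scale h.scale algebra_simps)

lemma casimir_x_power_lowest:
  assumes v: "v \<in> lowest m"
  shows "casimir ((x ^^ j) v) = (real m * (real m + 2)) *\<^sub>R (x ^^ j) v"
proof -
  have "x (y ((x ^^ j) v)) = (real j * (real m - real j + 1)) *\<^sub>R (x ^^ j) v"
  proof (cases j)
    case 0
    then show ?thesis using v by (simp add: lowest_def)
  next
    case (Suc k)
    have "x (y ((x ^^ Suc k) v)) = ((real k + 1) * (real m - real k)) *\<^sub>R (x ^^ Suc k) v"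
      unfolding y_x_power_lowest[OF v] by (simp add: x.scale)
    also have "(real k + 1) * (real m - real k) = real j * (real m - real j + 1)"
      by (simp add: Suc)
    finally show ?thesis unfolding Suc .
  qed
  moreover have "y (x ((x ^^ j) v)) = ((real j + 1) * (real m - real j)) *\<^sub>R (x ^^ j) v"
    using y_x_power_lowest[OF v, of j] by simp
  moreover have "h (h ((x ^^ j) v)) = ((2 * real j - real m) * (2 * real j - real m)) *\<^sub>R (x ^^ j) v"
    by (simp only: h_x_power_lowest[OF v] h.scale scaleR_scaleR)
  ultimately have "casimir ((x ^^ j) v) = ((2 * real j - real m) * (2 * real j - real m) +
      2 * (real j * (real m - real j + 1)) + 2 * ((real j + 1) * (real m - real j))) *\<^sub>R (x ^^ j) v"
    unfolding casimir_def scaleR_left_distrib by (simp only: scaleR_scaleR)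
  also have "(2 * real j - real m) * (2 * real j - real m) +
      2 * (real j * (real m - real j + 1)) + 2 * ((real j + 1) * (real m - real j)) = real m * (real m + 2)"
    by (simp add: algebra_simps)
  finally show ?thesis .
qed

text \<open>On the kernel of \<open>y\<close> the Casimir operator is \<open>h (h - 2)\<close>, so
  the equation factors as \<open>(h - (m + 2)) (h + m) w = 0\<close>. The positive weight
  \<open>m + 2\<close> does not occur in this kernel.\<close>

lemma kernel_casimir_imp_lowest:
  assumes "y w = 0" "casimir w = (real m * (real m + 2)) *\<^sub>R w"
  shows "w \<in> lowest m"
proof -
  let ?u = "h w + real m *\<^sub>R w"
  have "y (x w) = - h w" using x_y[of w] assms(1) by (simp add: eq_neg_iff_add_eq_0)
  then have "h (h w) = 2 *\<^sub>R h w + (real m * (real m + 2)) *\<^sub>R w"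
    using assms by (simp add: casimir_def algebra_simps)
  then have "h ?u = (real m + 2) *\<^sub>R ?u"
    by (simp add: h.add h.scale algebra_simps)
  moreover have "y ?u = 0"
    using h_y[of w] assms(1) by (simp add: y.add y.scale)
  ultimately have "?u = 0"
    using kernel_eigenvalue[of ?u "real m + 2"] by force
  then show ?thesis using assms(1) by (simp add: lowest_def add_eq_0_iff)
qed

end

section \<open>Block diagonal matrices\<close>

text \<open>Row \<open>p\<close> of a block diagonal matrix is row \<open>i\<close> of the block for
  \<open>x\<close> when entry \<open>p\<close> of this list is \<open>(x, i)\<close>.\<close>

definition labels :: "'x list \<Rightarrow> ('x \<Rightarrow> nat) \<Rightarrow> ('x \<times> nat) list" where
  "labels xs n = concat (map (\<lambda>x. map (Pair x) [0..<n x]) xs)"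

lemma labels_simps [simp]: "labels [] n = []" "labels (x # xs) n = map (Pair x) [0..<n x] @ labels xs n"
  by (simp_all add: labels_def)

lemma set_labels: "set (labels xs n) = {(x, i). x \<in> set xs \<and> i < n x}"
  by (auto simp: labels_def)

lemma distinct_labels: "distinct xs \<Longrightarrow> distinct (labels xs n)"
  by (induction xs) (auto simp: distinct_map inj_on_def set_labels)

lemma diag_block_mat_carrier:
  assumes "\<And>x. x \<in> set xs \<Longrightarrow> M x \<in> carrier_mat (n x) (n x)"
  shows "diag_block_mat (map M xs) \<in> carrier_mat (length (labels xs n)) (length (labels xs n))"
  using assms by (induction xs) (auto simp: Let_def)

lemma diag_block_mat_entry:
  assumes "\<And>x. x \<in> set xs \<Longrightarrow> M x \<in> carrier_mat (n x) (n x)" and "distinct xs"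
    and "p < length (labels xs n)" "q < length (labels xs n)"
  shows "diag_block_mat (map M xs) $$ (p, q) =
    (if fst (labels xs n ! p) = fst (labels xs n ! q)
     then M (fst (labels xs n ! p)) $$ (snd (labels xs n ! p), snd (labels xs n ! q)) else 0)"
  using assms
proof (induction xs arbitrary: p q)
  case (Cons x xs)
  let ?D = "diag_block_mat (map M xs)" and ?L = "labels xs n"
  have D: "?D \<in> carrier_mat (length ?L) (length ?L)"
    using Cons.prems by (intro diag_block_mat_carrier) auto
  have Mx: "M x \<in> carrier_mat (n x) (n x)" using Cons.prems by simp
  have e: "diag_block_mat (map M (x # xs)) $$ (p, q) =
      (if p < n x then if q < n x then M x $$ (p, q) else 0
       else if q < n x then 0 else ?D $$ (p - n x, q - n x))"
    using D Mx Cons.prems(3,4) by (auto simp: Let_def)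
  have ne: "fst (?L ! r) \<noteq> x" if "r < length ?L" for r
    using nth_mem[OF that] Cons.prems(2) by (auto simp: set_labels)
  have "\<not> r < n x \<Longrightarrow> fst (?L ! (r - n x)) \<noteq> x" if "r < length (labels (x # xs) n)" for r
    using ne[of "r - n x"] that by auto
  note ne' = this[OF Cons.prems(3)] this[OF Cons.prems(4)]
  show ?case
  proof (cases "p < n x \<or> q < n x")
    case True
    then show ?thesis
      unfolding e using ne' by (auto simp: nth_append)
  next
    case False
    then have "p - n x < length ?L" "q - n x < length ?L" using Cons.prems(3,4) by auto
    then show ?thesis
      unfolding e using False Cons.prems(1,2) Cons.IH[of "p - n x" "q - n x"] by (simp add: nth_append)
  qed
qed simp

lemma det_diag_block_mat:
  assumes "\<And>x. x \<in> set xs \<Longrightarrow> M x \<in> carrier_mat (n x) (n x)"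
  shows "Determinant.det (diag_block_mat (map M xs)) = (\<Prod>x\<leftarrow>xs. Determinant.det (M x :: complex mat))"
  using assms
proof (induction xs)
  case (Cons x xs)
  have D: "diag_block_mat (map M xs) \<in> carrier_mat (length (labels xs n)) (length (labels xs n))"
    using Cons.prems by (intro diag_block_mat_carrier) auto
  have Mx: "M x \<in> carrier_mat (n x) (n x)" using Cons.prems by simp
  have "Determinant.det (diag_block_mat (map M (x # xs))) =
      Determinant.det (M x) * Determinant.det (diag_block_mat (map M xs))"
    unfolding list.map diag_block_mat.simps Let_def
    using D Mx by (intro det_four_block_mat_lower_left_zero[OF Mx _ _ D]) auto
  then show ?case using Cons by simp
qed simp

lemma strict_mono_idx: "i < j \<Longrightarrow> idx i < idx (j :: 'n::{finite,wellorder})"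
  unfolding idx_def by (intro psubset_card_mono) auto

lemma idx_less: "idx (i :: 'n::{finite,wellorder}) < CARD('n)"
  unfolding idx_def by (intro psubset_card_mono) auto

lemma inj_idx: "inj (idx :: 'n::{finite,wellorder} \<Rightarrow> nat)"
  by (rule injI) (metis neqE strict_mono_idx less_irrefl)

lemma bij_idx: "bij_betw (idx :: 'n::{finite,wellorder} \<Rightarrow> nat) UNIV {0..<CARD('n)}"
proof -
  have "range (idx :: 'n \<Rightarrow> nat) = {0..<CARD('n)}"
    by (rule card_subset_eq) (use idx_less in \<open>auto simp: card_image inj_idx\<close>)
  then show ?thesis by (simp add: bij_betw_def inj_idx)
qed

text \<open>The Leibniz formulas over the index type and over \<open>{0..<CARD('n)}\<close>
  correspond term by term: transport along \<open>idx\<close> is a bijection of permutations and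
  preserves the sign.\<close>

lemma det_idx:
  fixes A :: "complex mat"
  assumes A: "A \<in> carrier_mat CARD('n::{finite,wellorder}) CARD('n)"
  shows "Determinants.det (\<chi> (i :: 'n) (j :: 'n). A $$ (idx i, idx j)) = Determinant.det A"
proof -
  let ?N = "{0..<CARD('n)}" and ?f = "idx :: 'n \<Rightarrow> nat"
  let ?h = "map_permutation UNIV ?f"
  have surj: "\<exists>p. p permutes UNIV \<and> ?h p = q" if "q permutes ?N" for q
  proof -
    let ?g = "inv_into UNIV ?f"
    have g: "bij_betw ?g ?N UNIV" by (rule bij_betw_inv_into[OF bij_idx])
    have "map_permutation ?N ?g q permutes UNIV" by (rule map_permutation_permutes[OF g that])
    moreover have "range ?f = ?N" using bij_idx[where 'n='n] by (simp add: bij_betw_def)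
    then have "?h (map_permutation ?N ?g q) = q"
      by (intro map_permutation_compose_inv[OF g that] f_inv_into_f) simp
    ultimately show ?thesis by blast
  qed
  have inj: "inj_on ?h {p. p permutes UNIV}"
    by (rule inj_onI) (metis (no_types) UNIV_I ext inj_eq inj_idx map_permutation_apply)
  have img: "?h ` {p. p permutes UNIV} = {q. q permutes ?N}"
    using map_permutation_permutes[OF bij_idx] surj by auto
  have "Determinant.det A = (\<Sum>q\<in>{q. q permutes ?N}. signof q * (\<Prod>i = 0..<CARD('n). A $$ (i, q i)))"
    by (rule det_def'[OF A])
  also have "\<dots> = (\<Sum>p\<in>{p. p permutes (UNIV :: 'n set)}. signof (?h p) * (\<Prod>i = 0..<CARD('n). A $$ (i, ?h p i)))"
    unfolding img[symmetric] by (subst sum.reindex[OF inj]) simp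
  also have "\<dots> = (\<Sum>p\<in>{p. p permutes UNIV}. of_int (sign p) * (\<Prod>i\<in>(UNIV :: 'n set). A $$ (idx i, idx (p i))))"
  proof (intro sum.cong refl)
    fix p :: "'n \<Rightarrow> 'n" assume p: "p \<in> {p. p permutes UNIV}"
    have "(\<Prod>i = 0..<CARD('n). A $$ (i, ?h p i)) = (\<Prod>i\<in>UNIV. A $$ (?f i, ?h p (?f i)))"
      by (rule prod.reindex_bij_betw[OF bij_idx, symmetric])
    then show "signof (?h p) * (\<Prod>i = 0..<CARD('n). A $$ (i, ?h p i)) =
        of_int (sign p) * (\<Prod>i\<in>(UNIV :: 'n set). A $$ (idx i, idx (p i)))"
      using p by (simp add: map_permutation_apply[OF inj_idx] sign_map_permutation[OF inj_idx])
  qed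
  also have "\<dots> = Determinants.det (\<chi> (i :: 'n) (j :: 'n). A $$ (idx i, idx j))"
    by (simp add: Determinants.det_def)
  finally show ?thesis ..
qed

text \<open>One tag per copy of a block. The copies of \<open>g d\<close> are equal matrices, so the
  level is recorded to keep the list distinct, as \<open>diag_block_mat_entry\<close>
  requires.\<close>

definition tags :: "nat list \<Rightarrow> (nat \<times> nat) list" where
  "tags ds = concat (map (\<lambda>d. map (Pair d) [0..<d]) ds)"

lemma tags_eq_labels: "tags ds = labels ds (\<lambda>d. d)"
  by (simp add: tags_def labels_def)

lemma set_tags: "set (tags ds) = {(d, l). d \<in> set ds \<and> l < d}"
  by (simp add: tags_eq_labels set_labels)

lemma concat_replicate_eq_map_tags:
  "concat (map (\<lambda>d. replicate d (g d)) ds) = map (\<lambda>x. g (fst x)) (tags ds)"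
  by (induction ds) (auto simp: tags_def o_def map_replicate_const)

lemma prod_list_tags:
  assumes "distinct ds"
  shows "(\<Prod>x\<leftarrow>tags ds. (h (fst x) :: complex)) = (\<Prod>d\<in>set ds. h d ^ d)"
  using assms by (induction ds) (auto simp: tags_def o_def map_replicate_const)

section \<open>The centralizer of a triple\<close>

type_synonym 'n cvector = "(complex, 'n) Finite_Cartesian_Product.vec"

lemma funpow_matrix_vector_mult:
  "((*v) (A :: complex^'n^'n) ^^ k) v = (((**) A ^^ k) (mat 1)) *v v"
  by (induction k) (simp_all add: matrix_vector_mul_assoc[symmetric])

text \<open>The power \<open>k\<close> of \<open>Z\<close> is an eigenvector of
  \<open>m \<mapsto> H ** m - m ** H\<close> for the eigenvalue \<open>k c\<close>. If no power
  vanished there would be more independent matrices than the dimension allows.\<close>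

lemma ad_eigenvector_nilpotent:
  fixes H Z :: "complex^'n^'n"
  assumes HZ: "lie_bracket H Z = c *\<^sub>R Z" and "c \<noteq> 0"
  shows "\<exists>k. ((**) Z ^^ k) (mat 1) = 0"
proof (rule ccontr)
  assume nz: "\<nexists>k. ((**) Z ^^ k) (mat 1) = 0"
  define P where "P k = ((**) Z ^^ k) (mat 1)" for k
  define L where "L m = H ** m - m ** H" for m :: "complex^'n^'n"
  have linL: "linear L"
    unfolding L_def by (intro linear_compose_sub linear_cmatrix_mult)
  have L: "L (P k) = (real k * c) *\<^sub>R P k" for k
  proof (induction k)
    case 0
    then show ?case by (simp add: L_def P_def)
  next
    case (Suc k)
    have P: "P (Suc k) = Z ** P k" by (simp add: P_def)
    have 1: "H ** Z = Z ** H + c *\<^sub>R Z" using HZ by (simp add: lie_bracket_def algebra_simps)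
    have 2: "H ** P k = P k ** H + (real k * c) *\<^sub>R P k" using Suc by (simp add: L_def algebra_simps)
    have "H ** P (Suc k) = (H ** Z) ** P k" by (simp add: P matrix_mul_assoc)
    also have "\<dots> = Z ** (H ** P k) + c *\<^sub>R (Z ** P k)"
      unfolding 1 linear_add[OF linear_cmatrix_mult(2)] linear_scale[OF linear_cmatrix_mult(2)]
      by (simp add: matrix_mul_assoc)
    also have "\<dots> = P (Suc k) ** H + (real (Suc k) * c) *\<^sub>R P (Suc k)"
      unfolding 2 linear_add[OF linear_cmatrix_mult(1)] linear_scale[OF linear_cmatrix_mult(1)]
      by (simp add: P matrix_mul_assoc algebra_simps)
    finally show ?case by (simp add: L_def)
  qed
  have nz: "P k \<noteq> 0" for k using nz by (simp add: P_def)
  have inj: "inj P"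
  proof (rule injI)
    fix i j assume "P i = P j"
    then have "(real i * c) *\<^sub>R P i = (real j * c) *\<^sub>R P i" using L by metis
    then show "i = j" using nz \<open>c \<noteq> 0\<close> by simp
  qed
  let ?I = "{..DIM(complex^'n^'n)}"
  have "independent (P ` ?I)"
  proof (rule independent_if_scalars_zero)
    fix a w assume a: "(\<Sum>w\<in>P ` ?I. a w *\<^sub>R w) = 0" and "w \<in> P ` ?I"
    then obtain i where i: "i \<in> ?I" "w = P i" by blast
    have s: "(\<Sum>i\<in>?I. a (P i) *\<^sub>R P i) = 0"
      using a by (simp add: sum.reindex[OF inj_on_subset[OF inj subset_UNIV]])
    have "a (P i) *\<^sub>R P i = 0"
      by (rule eigenvectors_independent[OF linL _ _ _ s, where c = "\<lambda>k. real k * c"])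
        (use i L linL \<open>c \<noteq> 0\<close> in \<open>auto simp: linear_scale inj_on_def\<close>)
    then show "a w = 0" using nz i by simp
  qed simp
  then have "card (P ` ?I) \<le> DIM(complex^'n^'n)" using independent_bound by blast
  moreover have "card (P ` ?I) = Suc DIM(complex^'n^'n)"
    by (simp add: card_image inj_on_subset[OF inj])
  ultimately show False by simp
qed

lemma map_eq_map_nth: "map f xs = map (\<lambda>i. f (xs ! i)) [0..<length xs]"
  by (rule nth_equalityI) auto

lemma vec_independent_list:
  fixes vs :: "(complex^'n) list"
  assumes "distinct vs" "vec.independent (set vs)" and 0: "(\<Sum>i<length vs. a i *s vs ! i) = 0" and "i < length vs"
  shows "a i = 0"
proof -
  have bij: "bij_betw ((!) vs) {..<length vs} (set vs)" using assms(1) by (intro bij_betw_nth) auto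
  define b where "b w = a (the_inv_into {..<length vs} ((!) vs) w)" for w
  have b: "b (vs ! i) = a i" if "i < length vs" for i
    unfolding b_def using that bij by (simp add: the_inv_into_f_f bij_betw_def)
  have "(\<Sum>w\<in>set vs. b w *s w) = (\<Sum>i<length vs. b (vs ! i) *s vs ! i)"
    by (rule sum.reindex_bij_betw[OF bij, symmetric])
  also have "\<dots> = 0" using 0 b by simp
  finally have "b (vs ! i) = 0"
    using vec.independentD[OF assms(2), of "set vs" b "vs ! i"] assms(4) by simp
  then show ?thesis using b assms(4) by simp
qed

locale sl2_matrices =
  fixes X H Y :: "('n::{finite,wellorder}) cmatrix"
  assumes triple: "sl2_triple X H Y"
begin

definition nil_index :: nat where
  "nil_index = (SOME N. (\<forall>v. ((*v) X ^^ N) v = 0) \<and> (\<forall>v. ((*v) Y ^^ N) v = 0))"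

lemma nil_index: "((*v) X ^^ nil_index) v = 0" "((*v) Y ^^ nil_index) v = 0"
proof -
  obtain k where k: "((**) X ^^ k) (mat 1) = 0"
    using ad_eigenvector_nilpotent[of H X 2] triple by (auto simp: sl2_triple_def)
  obtain l where l: "((**) Y ^^ l) (mat 1) = 0"
    using ad_eigenvector_nilpotent[of H Y "- 2"] triple by (auto simp: sl2_triple_def)
  have "((*v) A ^^ m) v = 0" if "((**) A ^^ j) (mat 1) = 0" "j \<le> m" for A :: "'n cmatrix" and j m v
  proof -
    have "((*v) A ^^ m) v = ((*v) A ^^ j) (((*v) A ^^ (m - j)) v)"
      using that(2) by (simp add: funpow_add[symmetric, THEN fun_cong, unfolded o_apply])
    then show ?thesis by (simp add: funpow_matrix_vector_mult[where A = A and k = j] that(1))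
  qed
  then have "\<exists>N. (\<forall>v. ((*v) X ^^ N) v = 0) \<and> (\<forall>v. ((*v) Y ^^ N) v = 0)"
    using k l by (intro exI[of _ "max k l"]) auto
  from someI_ex[OF this] show "((*v) X ^^ nil_index) v = 0" "((*v) Y ^^ nil_index) v = 0"
    unfolding nil_index_def by blast+
qed

sublocale sl2_action "(*v) X" "(*v) Y" "(*v) H" nil_index
proof (rule sl2_action.intro)
  have br: "lie_bracket H X = 2 *\<^sub>R X" "lie_bracket H Y = (- 2) *\<^sub>R Y" "lie_bracket X Y = H"
    using triple by (auto simp: sl2_triple_def)
  then have eq: "H ** X = X ** H + 2 *\<^sub>R X" "H ** Y = Y ** H + (- 2) *\<^sub>R Y" "X ** Y = Y ** X + H"
    by (simp_all add: lie_bracket_def algebra_simps)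
  show "H *v (X *v v) = X *v (H *v v) + 2 *\<^sub>R (X *v v)" for v
    by (simp add: matrix_vector_mul_assoc eq matrix_vector_mult_add_rdistrib scaleR_cmatrix_vector_mult)
  show "H *v (Y *v v) = Y *v (H *v v) - 2 *\<^sub>R (Y *v v)" for v
    unfolding matrix_vector_mul_assoc eq(2) matrix_vector_mult_add_rdistrib scaleR_cmatrix_vector_mult by simp
  show "X *v (Y *v v) = Y *v (X *v v) + H *v v" for v
    by (simp add: matrix_vector_mul_assoc eq matrix_vector_mult_add_rdistrib)
qed (rule nil_index matrix_vector_mul_linear)+

lemma submodule_iff: "invariant_subspace (span {X, H, Y}) W \<longleftrightarrow> submodule W"
proof
  assume "invariant_subspace (span {X, H, Y}) W"
  then show "submodule W"
    unfolding invariant_subspace_def submodule_def by (auto intro: span_base)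
next
  assume W: "submodule W"
  then have sub: "subspace W" by (simp add: submodule_def)
  have "span {X, H, Y} \<subseteq> {A. \<forall>w\<in>W. A *v w \<in> W}"
  proof (rule span_minimal)
    show "subspace {A. \<forall>w\<in>W. A *v w \<in> W}"
      using sub by (auto intro!: subspaceI simp: matrix_vector_mult_add_rdistrib scaleR_cmatrix_vector_mult
          subspace_0 subspace_add subspace_scale)
  qed (use W in \<open>auto simp: submodule_def\<close>)
  then show "invariant_subspace (span {X, H, Y}) W"
    unfolding invariant_subspace_def using sub by blast
qed

lemma vec_subspace_lowest: "vec.subspace (lowest m)"
proof (rule vec.subspaceI)
  fix c v assume "v \<in> lowest m"
  moreover have "r *\<^sub>R (c *s v) = c *s (r *\<^sub>R v)" for r
    by (simp add: vec_eq_iff)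
  ultimately show "c *s v \<in> lowest m"
    by (simp add: lowest_def matrix_vector_scaleC)
qed (use subspace_lowest in \<open>auto intro: subspace_0 subspace_add\<close>)

text \<open>A nonzero lowest vector generates an irreducible chain of dimension \<open>d\<close>.
  Conversely, an element of \<open>M_space\<close> is only a sum of vectors from such chains; the
  Casimir operator is the same scalar on all of them, and together with \<open>Y *v w = 0\<close> it
  fixes the weight.\<close>

lemma L_space_eq:
  assumes "0 < d"
  shows "L_space X H Y d = lowest (d - 1)"
proof (intro equalityI subsetI)
  fix v assume v: "v \<in> lowest (d - 1)"
  have "v \<in> M_space X H Y d"
  proof (cases "v = 0")
    case True
    then show ?thesis by (simp add: M_space_def span_zero)
  next
    case False
    have vc: "((*v) X ^^ 0) v \<in> chain v (d - 1)"
      unfolding chain_def by (intro span_base imageI) simp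
    have "irreducible_submodule (span {X, H, Y}) (chain v (d - 1))"
      unfolding irreducible_submodule_def submodule_iff
    proof (intro conjI allI impI)
      show "chain v (d - 1) \<noteq> {0}" using vc False by auto
      show "W' = {0} \<or> W' = chain v (d - 1)" if "submodule W' \<and> W' \<subseteq> chain v (d - 1)" for W'
        using chain_irreducible[OF v False] that by blast
    qed (rule submodule_chain[OF v])
    moreover have "dim (chain v (d - 1)) = d" using dim_chain[OF v False] assms by simp
    ultimately have "chain v (d - 1) \<in> {W. irreducible_submodule (span {X, H, Y}) W \<and> dim W = d}"
      by simp
    then show ?thesis unfolding M_space_def using vc by (intro span_base UnionI) simp_all
  qed
  then show "v \<in> L_space X H Y d" using v by (simp add: L_space_def lowest_def)
next
  fix w assume w: "w \<in> L_space X H Y d"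
  let ?c = "real (d - 1) * (real (d - 1) + 2)"
  have "M_space X H Y d \<subseteq> {w. casimir w = ?c *\<^sub>R w}"
    unfolding M_space_def
  proof (rule span_minimal)
    show sub: "subspace {w. casimir w = ?c *\<^sub>R w}"
      using linear_casimir by (auto intro!: subspaceI simp: linear_0 linear_add linear_scale algebra_simps)
    show "\<Union> {W. irreducible_submodule (span {X, H, Y}) W \<and> dim W = d} \<subseteq> {w. casimir w = ?c *\<^sub>R w}"
    proof (rule Union_least)
      fix W assume "W \<in> {W. irreducible_submodule (span {X, H, Y}) W \<and> dim W = d}"
      then have W: "submodule W" "W \<noteq> {0}" "dim W = d"
        and irr: "\<And>W'. submodule W' \<Longrightarrow> W' \<subseteq> W \<Longrightarrow> W' = {0} \<or> W' = W"
        unfolding irreducible_submodule_def submodule_iff by auto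
      obtain v m where v: "v \<in> lowest m" "v \<noteq> 0" "W = chain v m"
        using irreducible_eq_chain[OF W(1,2) irr] by blast
      then have m: "m = d - 1" using dim_chain[OF v(1,2)] W(3) by simp
      show "W \<subseteq> {w. casimir w = ?c *\<^sub>R w}"
        unfolding v(3) chain_def
        by (rule span_minimal[OF _ sub]) (use casimir_x_power_lowest[OF v(1)] m in auto)
    qed
  qed
  then show "w \<in> lowest (d - 1)"
    using w kernel_casimir_imp_lowest[of w "d - 1"] unfolding L_space_def by blast
qed

abbreviation "ds \<equiv> part_sizes X H Y"
abbreviation "tt \<equiv> mult_t X H Y"

text \<open>\<open>part_sizes\<close> would be the empty list if infinitely many sizes occurred, so
  finiteness enters as a hypothesis, supplied by \<open>finite_part_sizes\<close>.\<close>

lemma lowest_eq_0: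
  assumes "Suc m \<notin> set ds \<or> nil_index \<le> m" and fin: "finite {d. 1 \<le> d \<and> 0 < tt d}"
  shows "lowest m = {0}"
proof -
  have "lowest m \<subseteq> {0}"
  proof (cases "nil_index \<le> m")
    case True
    then show ?thesis using lowest_bound by force
  next
    case False
    then have "tt (Suc m) = 0" using assms by (auto simp: part_sizes_def)
    then show ?thesis using L_space_eq[of "Suc m"] by (simp add: mult_t_def)
  qed
  then show ?thesis using vec.subspace_0[OF vec_subspace_lowest] by blast
qed

lemma finite_part_sizes: "finite {d. 1 \<le> d \<and> 0 < tt d}"
proof (rule finite_subset)
  show "{d. 1 \<le> d \<and> 0 < tt d} \<subseteq> {..nil_index}"
  proof
    fix d assume d: "d \<in> {d. 1 \<le> d \<and> 0 < tt d}"
    then have "vec.dim (lowest (d - 1)) \<noteq> 0" using L_space_eq[of d] by (simp add: mult_t_def del: vec.dim_eq_0)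
    then have "\<not> lowest (d - 1) \<subseteq> {0}" unfolding vec.dim_eq_0 .
    then obtain v where "v \<in> lowest (d - 1)" "v \<noteq> 0" by blast
    from lowest_bound[OF this] show "d \<in> {..nil_index}" by simp
  qed
qed simp

lemma set_ds: "set ds = {d. 1 \<le> d \<and> 0 < tt d}"
  using finite_part_sizes by (simp add: part_sizes_def)

lemma distinct_ds: "distinct ds"
  by (simp add: part_sizes_def)

lemma L_basesD:
  assumes "L_bases X H Y v" "d \<in> set ds"
  shows "distinct (v d)" "vec.independent (set (v d))" "vec.span (set (v d)) = lowest (d - 1)" "length (v d) = tt d"
proof -
  have b: "distinct (v d)" "vec.independent (set (v d))" "vec.span (set (v d)) = L_space X H Y d"
    using assms by (auto simp: L_bases_def ordered_basis_of_def)
  then show "distinct (v d)" "vec.independent (set (v d))" by auto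
  show "vec.span (set (v d)) = lowest (d - 1)" using b L_space_eq[of d] assms(2) set_ds by auto
  show "length (v d) = tt d"
    unfolding mult_t_def b(3)[symmetric] vec.dim_span_eq_card_independent[OF b(2)] using b(1)
    by (simp add: distinct_card)
qed

lemma L_bases_exists: "\<exists>v. L_bases X H Y v"
proof -
  have "\<exists>vs. ordered_basis_of vs (L_space X H Y d)" if "d \<in> set ds" for d
  proof -
    have L: "vec.subspace (L_space X H Y d)"
      using that set_ds L_space_eq[of d] vec_subspace_lowest by auto
    obtain B where B: "B \<subseteq> L_space X H Y d" "vec.independent B" "L_space X H Y d \<subseteq> vec.span B"
      by (rule vec.basis_exists[of "L_space X H Y d"]) (rule that)
    have "finite B" by (rule vec.finiteI_independent[OF B(2)])
    then obtain vs where vs: "set vs = B" "distinct vs" using finite_distinct_list by blast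
    have "vec.span B = L_space X H Y d" using vec.span_minimal[OF B(1) L] B(3) by blast
    then show ?thesis using B vs by (auto simp: ordered_basis_of_def)
  qed
  then show ?thesis unfolding L_bases_def by metis
qed

text \<open>The common order of \<open>basis_B\<close> and of the rows of \<open>block_D\<close>:
  block size, then level, then number.\<close>

definition lst :: "((nat \<times> nat) \<times> nat) list" where
  "lst = labels (tags ds) (\<lambda>x. tt (fst x))"

definition vec_of :: "(nat \<Rightarrow> 'n cvector list) \<Rightarrow> (nat \<times> nat) \<times> nat \<Rightarrow> 'n cvector" where
  "vec_of v \<tau> = ((*v) X ^^ snd (fst \<tau>)) (v (fst (fst \<tau>)) ! snd \<tau>)"

lemma set_lst: "((d, l), i) \<in> set lst \<longleftrightarrow> d \<in> set ds \<and> l < d \<and> i < tt d"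
  by (auto simp: lst_def set_labels set_tags)

lemma distinct_lst: "distinct lst"
  unfolding lst_def tags_eq_labels by (intro distinct_labels distinct_ds)

lemma basis_B_eq:
  assumes v: "L_bases X H Y v"
  shows "basis_B X H Y v = map (vec_of v) lst"
proof -
  have "concat (map (\<lambda>d. concat (map (\<lambda>l. map ((*v) X ^^ l) (v d)) [0..<d])) xs) =
      map (vec_of v) (labels (tags xs) (\<lambda>x. tt (fst x)))"
    if "\<And>d. d \<in> set xs \<Longrightarrow> length (v d) = tt d" for xs
    using that
  proof (induction xs)
    case (Cons d xs)
    have "map ((*v) X ^^ l) (v d) = map (\<lambda>i. ((*v) X ^^ l) (v d ! i)) [0..<tt d]" for l
      using map_eq_map_nth[of _ "v d"] Cons.prems by simp
    then show ?case
      using Cons by (simp add: tags_def labels_def map_concat o_def vec_of_def)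
  qed (simp add: tags_def)
  then show ?thesis
    unfolding basis_B_def lst_def using L_basesD(4)[OF v] by blast
qed

lemma X_power_scale: "((*v) X ^^ j) (c *s w) = c *s ((*v) X ^^ j) w"
  by (simp add: funpow_matrix_vector_mult matrix_vector_scaleC)

lemma X_power_sum: "((*v) X ^^ j) (sum f A) = (\<Sum>a\<in>A. ((*v) X ^^ j) (f a))"
  using linear_sum[OF linear_funpow[OF lin_x]] .

text \<open>Collecting the terms with the same \<open>d\<close> and \<open>l\<close> gives vectors
  of \<open>lowest (d - 1)\<close>, which vanish by \<open>lowest_decomposition_independent\<close>;
  independence of \<open>v d\<close> then separates the coefficients.\<close>

lemma vec_of_independent:
  assumes v: "L_bases X H Y v" and 0: "(\<Sum>\<tau>\<in>set lst. c \<tau> *s vec_of v \<tau>) = 0" and \<tau>: "\<tau> \<in> set lst"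
  shows "c \<tau> = 0"
proof -
  \<comment> \<open>A bound above every \<open>d - 1\<close>; for sizes that do not occur
    \<open>u m j\<close> is set to 0.\<close>
  define M where "M = Suc (sum_list ds)"
  have M: "d \<le> M" if "d \<in> set ds" for d
    using member_le_sum_list[OF that] by (simp add: M_def)
  define u where "u m j = (if Suc m \<in> set ds then \<Sum>i<tt (Suc m). c ((Suc m, j), i) *s (v (Suc m) ! i) else 0)" for m j
  have u: "u m j \<in> lowest m" for m j
  proof (cases "Suc m \<in> set ds")
    case True
    have "v (Suc m) ! i \<in> lowest m" if "i < tt (Suc m)" for i
      using L_basesD(3,4)[OF v True] vec.span_base[of "v (Suc m) ! i" "set (v (Suc m))"] that by simp
    then show ?thesis
      unfolding u_def using True by (auto intro!: vec.subspace_sum[OF vec_subspace_lowest] vec.subspace_scale[OF vec_subspace_lowest])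
  qed (simp add: u_def subspace_0[OF subspace_lowest])
  let ?f = "\<lambda>d l i. c ((d, l), i) *s vec_of v ((d, l), i)"
  have Xu: "((*v) X ^^ j) (u m j) = (if Suc m \<in> set ds then \<Sum>i<tt (Suc m). ?f (Suc m) j i else 0)" for m j
    using linear_0[OF linear_funpow[OF lin_x]] by (simp add: u_def X_power_sum X_power_scale vec_of_def)
  have S: "set lst = Sigma (Sigma (set ds) (\<lambda>d. {..<d})) (\<lambda>x. {..<tt (fst x)})"
    by (auto simp: set_lst)
  have bij: "bij_betw Suc {m \<in> {..<M}. Suc m \<in> set ds} (set ds)"
    unfolding bij_betw_def
  proof (intro conjI equalityI subsetI)
    fix d assume d: "d \<in> set ds"
    then have "0 < d" using set_ds by auto
    then obtain m where "d = Suc m" using gr0_conv_Suc by blast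
    then show "d \<in> Suc ` {m \<in> {..<M}. Suc m \<in> set ds}" using d M[OF d] by auto
  qed auto
  have "0 = (\<Sum>\<tau>\<in>Sigma (Sigma (set ds) (\<lambda>d. {..<d})) (\<lambda>x. {..<tt (fst x)}). c \<tau> *s vec_of v \<tau>)"
    using 0 unfolding S ..
  also have "\<dots> = (\<Sum>x\<in>Sigma (set ds) (\<lambda>d. {..<d}). \<Sum>i<tt (fst x). c (x, i) *s vec_of v (x, i))"
    by (subst sum.Sigma) (auto simp: split_def)
  also have "\<dots> = (\<Sum>d\<in>set ds. \<Sum>l<d. \<Sum>i<tt d. ?f d l i)"
    by (subst sum.Sigma) (auto simp: split_def)
  also have "\<dots> = (\<Sum>m\<in>{m \<in> {..<M}. Suc m \<in> set ds}. \<Sum>l<Suc m. \<Sum>i<tt (Suc m). ?f (Suc m) l i)"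
    by (rule sum.reindex_bij_betw[OF bij, symmetric])
  also have "\<dots> = (\<Sum>m<M. if Suc m \<in> set ds then \<Sum>l<Suc m. \<Sum>i<tt (Suc m). ?f (Suc m) l i else 0)"
    by (rule sum.inter_filter) simp
  also have "\<dots> = (\<Sum>m<M. \<Sum>j\<le>m. ((*v) X ^^ j) (u m j))"
    unfolding Xu lessThan_Suc_atMost by (intro sum.cong) auto
  finally have sum0: "(\<Sum>m<M. \<Sum>j\<le>m. ((*v) X ^^ j) (u m j)) = 0" by simp
  obtain d l i where t: "\<tau> = ((d, l), i)" "d \<in> set ds" "l < d" "i < tt d"
    using \<tau> set_lst by (metis prod.exhaust)
  then have "0 < d" by simp
  then obtain m where m: "d = Suc m" using gr0_conv_Suc by blast
  have "u m l = 0"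
    using lowest_decomposition_independent[OF u sum0, of l m] t m M[OF t(2)] by simp
  then have "(\<Sum>i<length (v d). c ((d, l), i) *s (v d ! i)) = 0"
    using t(2) L_basesD(4)[OF v t(2)] by (simp add: u_def m)
  from vec_independent_list[OF L_basesD(1,2)[OF v t(2)] this] show ?thesis
    using t L_basesD(4)[OF v t(2)] by simp
qed

text \<open>\<open>lowest_span\<close> is a real span, and a complex span is a real subspace, so it
  suffices that the latter contains the generators of the former.\<close>

lemma vec_of_span:
  assumes v: "L_bases X H Y v"
  shows "vec.span (vec_of v ` set lst) = UNIV"
proof -
  let ?V = "vec.span (vec_of v ` set lst)"
  have sub: "vec.subspace ?V" by (rule vec.subspace_span)
  have gen: "((*v) X ^^ j) w \<in> ?V" if w: "w \<in> lowest m" and j: "j \<le> m" for w j m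
  proof (cases "Suc m \<in> set ds")
    case True
    have "lowest m \<subseteq> {w. ((*v) X ^^ j) w \<in> ?V}"
      unfolding L_basesD(3)[OF v True, simplified, symmetric]
    proof (rule vec.span_minimal)
      show "set (v (Suc m)) \<subseteq> {w. ((*v) X ^^ j) w \<in> ?V}"
      proof
        fix w assume "w \<in> set (v (Suc m))"
        then obtain i where i: "i < tt (Suc m)" "w = v (Suc m) ! i"
          using L_basesD(4)[OF v True] by (metis in_set_conv_nth)
        have "vec_of v ((Suc m, j), i) \<in> ?V"
          by (intro vec.span_base imageI) (use True i j in \<open>simp add: set_lst\<close>)
        then show "w \<in> {w. ((*v) X ^^ j) w \<in> ?V}" using i by (simp add: vec_of_def)
      qed
      show "vec.subspace {w. ((*v) X ^^ j) w \<in> ?V}"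
        using linear_0[OF linear_funpow[OF lin_x]] linear_add[OF linear_funpow[OF lin_x]]
        by (intro vec.subspaceI) (auto simp: X_power_scale vec.subspace_0[OF sub] vec.subspace_add[OF sub] vec.subspace_scale[OF sub])
    qed
    then show ?thesis using w by blast
  next
    case False
    then have "w = 0" using lowest_eq_0 finite_part_sizes w by blast
    then show ?thesis using linear_0[OF linear_funpow[OF lin_x]] vec.subspace_0[OF sub] by simp
  qed
  have "lowest_span \<subseteq> ?V"
    unfolding lowest_span_def
    by (rule span_minimal[OF _ vec_subspace_imp_subspace[OF sub]]) (use gen in auto)
  then show ?thesis using lowest_span_UNIV by blast
qed

lemma inj_on_vec_of:
  assumes v: "L_bases X H Y v"
  shows "inj_on (vec_of v) (set lst)"
proof (rule inj_onI; rule ccontr)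
  fix \<sigma> \<tau> assume st: "\<sigma> \<in> set lst" "\<tau> \<in> set lst" "vec_of v \<sigma> = vec_of v \<tau>" "\<sigma> \<noteq> \<tau>"
  let ?c = "\<lambda>\<rho>. (if \<rho> = \<sigma> then 1 else 0) - (if \<rho> = \<tau> then 1 else 0) :: complex"
  have "(\<Sum>\<rho>\<in>set lst. ?c \<rho> *s vec_of v \<rho>) =
      (\<Sum>\<rho>\<in>set lst. if \<rho> = \<sigma> then vec_of v \<rho> else 0) - (\<Sum>\<rho>\<in>set lst. if \<rho> = \<tau> then vec_of v \<rho> else 0)"
    unfolding sum_subtractf[symmetric] by (intro sum.cong) (auto simp: vec.scale_left_diff_distrib)
  also have "\<dots> = 0" using st by simp
  finally show False using vec_of_independent[OF v, of ?c \<sigma>] st by simp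
qed

lemma independent_vec_of:
  assumes v: "L_bases X H Y v"
  shows "vec.independent (vec_of v ` set lst)"
proof (rule vec.independent_if_scalars_zero)
  fix f w assume f: "(\<Sum>w\<in>vec_of v ` set lst. f w *s w) = 0" and "w \<in> vec_of v ` set lst"
  then obtain \<tau> where \<tau>: "\<tau> \<in> set lst" "w = vec_of v \<tau>" by blast
  have "(\<Sum>\<tau>\<in>set lst. f (vec_of v \<tau>) *s vec_of v \<tau>) = 0"
    using f by (simp add: sum.reindex[OF inj_on_vec_of[OF v]])
  from vec_of_independent[OF v this \<tau>(1)] show "f w = 0" using \<tau> by simp
qed simp

text \<open>The list enumerates a basis. Its length is the sum of the \<open>tt d * d\<close>, so
  the block sizes form a partition of \<open>n\<close>.\<close>

lemma length_lst: "length lst = CARD('n)"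
proof -
  obtain v where v: "L_bases X H Y v" using L_bases_exists by blast
  have "length lst = card (vec_of v ` set lst)"
    by (simp add: card_image[OF inj_on_vec_of[OF v]] distinct_card[OF distinct_lst])
  also have "\<dots> = vec.dim (vec.span (vec_of v ` set lst))"
    by (rule vec.dim_span_eq_card_independent[OF independent_vec_of[OF v], symmetric])
  also have "\<dots> = CARD('n)" unfolding vec_of_span[OF v] by (rule vec_dim_card)
  finally show ?thesis .
qed

definition lab :: "'n \<Rightarrow> nat \<times> nat \<times> nat" where
  "lab a = (fst (fst (lst ! idx a)), snd (fst (lst ! idx a)), snd (lst ! idx a))"

lemma lst_idx_mem: "lst ! idx (a :: 'n) \<in> set lst"
  using idx_less[of a] length_lst by simp

lemma lst_idx_surj: "\<tau> \<in> set lst \<Longrightarrow> \<exists>a :: 'n. lst ! idx a = \<tau>"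
proof -
  assume "\<tau> \<in> set lst"
  then obtain p where p: "p < CARD('n)" "lst ! p = \<tau>" by (metis in_set_conv_nth length_lst)
  moreover have "p \<in> range (idx :: 'n \<Rightarrow> nat)" using bij_idx[where 'n='n] p(1) by (simp add: bij_betw_def)
  ultimately show ?thesis by blast
qed

sublocale ordered_shift_matrix lab
proof
  show "inj lab"
  proof (rule injI)
    fix a b :: 'n assume "lab a = lab b"
    then have "lst ! idx a = lst ! idx b" by (simp add: lab_def prod_eq_iff)
    then have "idx a = idx b"
      using nth_eq_iff_index_eq[OF distinct_lst] idx_less[of a] idx_less[of b] length_lst by simp
    then show "a = b" by (rule injD[OF inj_idx])
  qed
  show "fst (snd (lab a)) < fst (lab a)" for a
    using lst_idx_mem[of a] set_lst[of "fst (fst (lst ! idx a))" "snd (fst (lst ! idx a))" "snd (lst ! idx a)"]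
    by (simp add: lab_def)
  show "\<exists>b. lab b = (fst (lab a), l, snd (snd (lab a)))" if "l < fst (lab a)" for l a
  proof -
    have "((fst (fst (lst ! idx a)), l), snd (lst ! idx a)) \<in> set lst"
      using that lst_idx_mem[of a] set_lst[of "fst (fst (lst ! idx a))" "snd (fst (lst ! idx a))" "snd (lst ! idx a)"]
      by (simp add: lab_def set_lst)
    then obtain b :: 'n where "lst ! idx b = ((fst (fst (lst ! idx a)), l), snd (lst ! idx a))"
      using lst_idx_surj by blast
    then show ?thesis by (intro exI[of _ b]) (simp add: lab_def)
  qed
qed

lemma lst_idx: "lst ! idx a = ((blk a, lev a), num a)"
  by (simp add: blk_def lev_def num_def lab_def)

lemma blk_in_ds: "blk a \<in> set ds" and num_less: "num a < tt (blk a)"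
  using lst_idx_mem[of a] unfolding lst_idx set_lst by auto

end

lemma matrix_inv:
  assumes "invertible (A :: 'a::semiring_1^'n^'n)"
  shows "A ** matrix_inv A = mat 1" "matrix_inv A ** A = mat 1"
  using someI_ex[OF assms[unfolded invertible_def]] unfolding matrix_inv_def by auto

lemma matrix_inv_unique:
  fixes A B :: "complex^'n^'n"
  assumes "A ** B = mat 1"
  shows "matrix_inv A = B"
proof -
  have "B ** A = mat 1" using assms matrix_left_right_inverse by blast
  then have "invertible A" using assms unfolding invertible_def by blast
  from matrix_inv(1)[OF this] have "B ** A ** matrix_inv A = B" by (simp add: matrix_mul_assoc[symmetric])
  then show ?thesis using \<open>B ** A = mat 1\<close> by simp
qed

lemma Ad_eq_iff: "invertible (g :: complex^'n^'n) \<Longrightarrow> Ad g A = B \<longleftrightarrow> g ** A = B ** g"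
proof -
  assume g: "invertible g"
  have "Ad g A ** g = g ** A" by (simp add: Ad_def matrix_mul_assoc[symmetric] matrix_inv[OF g])
  moreover have "B ** g ** matrix_inv g = B" by (simp add: matrix_mul_assoc[symmetric] matrix_inv[OF g])
  ultimately show ?thesis unfolding Ad_def by metis
qed

text \<open>\<open>m_inv\<close> is a definite description over the carrier; the hypothesis provides
  an inverse inside \<open>C\<close>, which it must then equal.\<close>

lemma compact_subgroup_iff:
  fixes C :: "(complex^'n^'n) set"
  assumes "\<And>c. c \<in> C \<Longrightarrow> \<exists>c'\<in>C. c ** c' = mat 1"
  shows "compact_subgroup K C \<longleftrightarrow> K \<subseteq> C \<and> compact K \<and> mat 1 \<in> K \<and>
    (\<forall>j\<in>K. \<forall>k\<in>K. j ** k \<in> K) \<and> (\<forall>k\<in>K. \<exists>k'\<in>K. k ** k' = mat 1)"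
proof -
  let ?G = "matrix_group C"
  have inv: "m_inv ?G k = k'" if "k' \<in> C" "k ** k' = mat 1" for k k'
    unfolding m_inv_def
  proof (rule the_equality)
    have "k' ** k = mat 1" using that(2) matrix_left_right_inverse by blast
    then show "k' \<in> carrier ?G \<and> k \<otimes>\<^bsub>?G\<^esub> k' = \<one>\<^bsub>?G\<^esub> \<and> k' \<otimes>\<^bsub>?G\<^esub> k = \<one>\<^bsub>?G\<^esub>"
      using that by (simp add: matrix_group_def)
    fix y assume "y \<in> carrier ?G \<and> k \<otimes>\<^bsub>?G\<^esub> y = \<one>\<^bsub>?G\<^esub> \<and> y \<otimes>\<^bsub>?G\<^esub> k = \<one>\<^bsub>?G\<^esub>"
    then have "k ** y = mat 1" by (simp add: matrix_group_def)
    then show "y = k'" using matrix_inv_unique[of k] that(2) by metis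
  qed
  show ?thesis
  proof
    assume "compact_subgroup K C"
    then have K: "subgroup K ?G" "compact K" by (auto simp: compact_subgroup_def)
    have sub: "K \<subseteq> C" using subgroup.subset[OF K(1)] by (simp add: matrix_group_def)
    have "\<exists>k'\<in>K. k ** k' = mat 1" if "k \<in> K" for k
    proof -
      have "k \<in> C" using sub that by blast
      then obtain c where c: "c \<in> C" "k ** c = mat 1" using assms[of k] by blast
      then have "m_inv ?G k = c" by (rule inv)
      then show ?thesis using subgroup.m_inv_closed[OF K(1) that] c by auto
    qed
    then show "K \<subseteq> C \<and> compact K \<and> mat 1 \<in> K \<and>
        (\<forall>j\<in>K. \<forall>k\<in>K. j ** k \<in> K) \<and> (\<forall>k\<in>K. \<exists>k'\<in>K. k ** k' = mat 1)"
      using sub K(2) subgroup.one_closed[OF K(1)] subgroup.m_closed[OF K(1)]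
      by (simp add: matrix_group_def)
  next
    assume K: "K \<subseteq> C \<and> compact K \<and> mat 1 \<in> K \<and>
        (\<forall>j\<in>K. \<forall>k\<in>K. j ** k \<in> K) \<and> (\<forall>k\<in>K. \<exists>k'\<in>K. k ** k' = mat 1)"
    have "subgroup K ?G"
    proof
      show "m_inv ?G k \<in> K" if k: "k \<in> K" for k
      proof -
        obtain k' where "k' \<in> K" "k ** k' = mat 1" using K k by blast
        then show ?thesis using inv K by auto
      qed
    qed (use K in \<open>auto simp: matrix_group_def\<close>)
    then show "compact_subgroup K C" using K by (simp add: compact_subgroup_def)
  qed
qed

lemma unitary_group_iff:
  "A \<in> unitary_group t \<longleftrightarrow> A \<in> carrier_mat t t \<and>
    (\<forall>i<t. \<forall>k<t. (\<Sum>j<t. A $$ (i, j) * cnj (A $$ (k, j))) = (if i = k then 1 else 0))"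
proof -
  have "A * mat_adjoint A = 1\<^sub>m t \<longleftrightarrow>
      (\<forall>i<t. \<forall>k<t. (\<Sum>j<t. A $$ (i, j) * cnj (A $$ (k, j))) = (if i = k then 1 else 0))"
    if A: "A \<in> carrier_mat t t"
  proof -
    have adj: "mat_adjoint A \<in> carrier_mat t t" "\<And>j k. j < t \<Longrightarrow> k < t \<Longrightarrow> mat_adjoint A $$ (j, k) = cnj (A $$ (k, j))"
      using A by (auto simp: mat_adjoint_def mat_of_rows_def)
    have "(A * mat_adjoint A) $$ (i, k) = (\<Sum>j<t. A $$ (i, j) * cnj (A $$ (k, j)))" if "i < t" "k < t" for i k
      using A adj that by (auto simp: scalar_prod_def lessThan_atLeast0 intro!: sum.cong)
    then show ?thesis
      using A adj(1) by (auto simp: mat_eq_iff)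
  qed
  then show ?thesis by (auto simp: unitary_group_def)
qed

section \<open>The centralizer in the coordinates of \<open>basis_B\<close>\<close>

context sl2_matrices
begin

definition basis_matrix :: "(nat \<Rightarrow> 'n cvector list) \<Rightarrow> 'n cmatrix" where
  "basis_matrix v = (\<chi> r a. vec_of v (lst ! idx a) $ r)"

lemma basis_matrix_axis: "basis_matrix v *v axis a 1 = vec_of v (lst ! idx a)"
  unfolding vec_eq_iff cmatrix_vector_mult_axis by (simp add: basis_matrix_def)

lemma basis_matrix_axis': "basis_matrix v *v axis a 1 = ((*v) X ^^ lev a) (v (blk a) ! num a)"
  by (simp add: basis_matrix_axis lst_idx vec_of_def)

lemma basis_matrix_axis_pos:
  "basis_matrix v *v axis a 1 = ((*v) X ^^ lev a) (basis_matrix v *v axis (pos a 0) 1)"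
  using pos[OF blk_pos, of a] by (simp add: basis_matrix_axis')

lemma basis_matrix_gen:
  assumes "L_bases X H Y v" "lev a = 0"
  shows "basis_matrix v *v axis a 1 \<in> lowest (blk a - 1)"
proof -
  have "v (blk a) ! num a \<in> set (v (blk a))"
    using L_basesD(4)[OF assms(1) blk_in_ds] num_less by simp
  then show ?thesis
    using L_basesD(3)[OF assms(1) blk_in_ds, of a] vec.span_base assms(2)
    by (auto simp: basis_matrix_axis')
qed

lemma basis_matrix_expansion: "basis_matrix v *v y = (\<Sum>a\<in>UNIV. y $ a *s (basis_matrix v *v axis a 1))"
  by (subst cvec_expansion) (simp add: linear_sum[OF matrix_vector_mul_linear] matrix_vector_scaleC)

lemma bij_lst_idx: "bij_betw (\<lambda>a :: 'n. lst ! idx a) UNIV (set lst)"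
proof -
  have "inj (\<lambda>a :: 'n. lst ! idx a)"
    by (rule injI) (metis lst_idx lab_eqI prod.inject)
  moreover have "range (\<lambda>a :: 'n. lst ! idx a) = set lst"
  proof (intro equalityI subsetI)
    fix \<tau> assume "\<tau> \<in> set lst"
    then obtain a :: 'n where "lst ! idx a = \<tau>" using lst_idx_surj by blast
    then show "\<tau> \<in> range (\<lambda>a :: 'n. lst ! idx a)" by (metis rangeI)
  next
    fix \<tau> assume "\<tau> \<in> range (\<lambda>a :: 'n. lst ! idx a)"
    then obtain a :: 'n where "\<tau> = lst ! idx a" by (rule rangeE)
    then show "\<tau> \<in> set lst" using lst_idx_mem[of a] by simp
  qed
  ultimately show ?thesis unfolding bij_betw_def by (rule conjI)
qed

lemma invertible_basis_matrix:
  assumes v: "L_bases X H Y v"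
  shows "invertible (basis_matrix v)"
proof -
  have "y = 0" if y: "basis_matrix v *v y = 0" for y
  proof -
    define c where "c \<tau> = y $ (the_inv_into UNIV (\<lambda>a :: 'n. lst ! idx a) \<tau>)" for \<tau>
    have c: "c (lst ! idx a) = y $ a" for a :: 'n
      unfolding c_def the_inv_into_f_f[OF bij_betw_imp_inj_on[OF bij_lst_idx] UNIV_I] ..
    have "(\<Sum>\<tau>\<in>set lst. c \<tau> *s vec_of v \<tau>) = (\<Sum>a\<in>(UNIV :: 'n set). c (lst ! idx a) *s vec_of v (lst ! idx a))"
      by (rule sum.reindex_bij_betw[OF bij_lst_idx, symmetric])
    also have "\<dots> = 0" using y unfolding c basis_matrix_expansion[of v y] basis_matrix_axis .
    finally have "c (lst ! idx a) = 0" for a :: 'n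
      by (rule vec_of_independent[OF v _ lst_idx_mem])
    then show "y = 0" unfolding c by (simp add: vec_eq_iff)
  qed
  then obtain B where "B ** basis_matrix v = mat 1"
    using matrix_left_invertible_ker[of "basis_matrix v"] by blast
  then show ?thesis using invertible_left_inverse by blast
qed

abbreviation basis_inv :: "(nat \<Rightarrow> 'n cvector list) \<Rightarrow> 'n cmatrix" where
  "basis_inv v \<equiv> matrix_inv (basis_matrix v)"

lemmas basis_matrix_inv = matrix_inv[OF invertible_basis_matrix]

lemma basis_inv_axis: "L_bases X H Y v \<Longrightarrow> basis_inv v *v (basis_matrix v *v y) = y"
  by (simp add: matrix_vector_mul_assoc basis_matrix_inv)

lemma eq_on_basis_matrix:
  assumes v: "L_bases X H Y v" and "\<And>a. P *v (basis_matrix v *v axis a 1) = Q *v (basis_matrix v *v axis a 1)"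
  shows "P = Q"
proof -
  have "P ** basis_matrix v = Q ** basis_matrix v"
    by (rule cmatrix_eq_axis) (simp add: matrix_vector_mul_assoc[symmetric] assms(2))
  then have "P ** basis_matrix v ** basis_inv v = Q ** basis_matrix v ** basis_inv v" by simp
  then show ?thesis by (simp add: matrix_mul_assoc[symmetric] basis_matrix_inv[OF v])
qed

text \<open>The columns of one chain are successive images under \<open>X\<close> of a vector in
  \<open>lowest (blk a - 1)\<close>, and \<open>X\<close> applied \<open>blk a\<close> times kills
  this vector.\<close>

lemma X_basis_matrix:
  assumes v: "L_bases X H Y v"
  shows "X ** basis_matrix v = basis_matrix v ** shift"
proof (rule cmatrix_eq_axis)
  fix a
  let ?g = "basis_matrix v *v axis (pos a 0) 1"
  have 1: "(X ** basis_matrix v) *v axis a 1 = ((*v) X ^^ Suc (lev a)) ?g"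
    by (simp add: matrix_vector_mul_assoc[symmetric] basis_matrix_axis_pos[of v a])
  have g: "?g \<in> lowest (blk a - 1)"
    using basis_matrix_gen[OF v, of "pos a 0"] pos[OF blk_pos, of a] by simp
  show "(X ** basis_matrix v) *v axis a 1 = (basis_matrix v ** shift) *v axis a 1"
  proof (cases "Suc (lev a) < blk a")
    case True
    have "(basis_matrix v ** shift) *v axis a 1 = basis_matrix v *v axis (pos a (Suc (lev a))) 1"
      using True by (simp add: matrix_vector_mul_assoc[symmetric] shift_axis)
    also have "\<dots> = ((*v) X ^^ Suc (lev a)) ?g"
      using True blk_pos[of a] basis_matrix_axis_pos[of v "pos a (Suc (lev a))"] by (simp add: pos pos_pos del: funpow.simps)
    finally show ?thesis using 1 by simp
  next
    case False
    then have "blk a - 1 < Suc (lev a)" by linarith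
    then have "((*v) X ^^ Suc (lev a)) ?g = 0" by (rule x_power_lowest_eq_0[OF g])
    then show ?thesis using 1 False by (simp add: matrix_vector_mul_assoc[symmetric] shift_axis)
  qed
qed

definition comm :: "'n cmatrix \<Rightarrow> bool" where
  "comm A \<longleftrightarrow> A ** X = X ** A \<and> A ** H = H ** A \<and> A ** Y = Y ** A"

lemma commutes_X_power:
  assumes "A ** X = X ** A"
  shows "A *v ((*v) X ^^ k) w = ((*v) X ^^ k) (A *v w)"
  by (induction k) (simp_all add: matrix_vector_mul_assoc assms, simp add: matrix_vector_mul_assoc[symmetric])

text \<open>\<open>H\<close> and \<open>Y\<close> act on powers of \<open>X\<close> applied to a
  lowest vector with scalars depending only on exponent and weight, so commuting with
  \<open>X\<close> and keeping the weights of the generators is enough.\<close>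

lemma comm_if_lowest:
  assumes v: "L_bases X H Y v" and AX: "A ** X = X ** A"
    and low: "\<And>a. lev a = 0 \<Longrightarrow> A *v (basis_matrix v *v axis a 1) \<in> lowest (blk a - 1)"
  shows "comm A"
proof -
  have gen: "basis_matrix v *v axis (pos a 0) 1 \<in> lowest (blk a - 1)"
      "A *v (basis_matrix v *v axis (pos a 0) 1) \<in> lowest (blk a - 1)" for a
    using basis_matrix_gen[OF v, of "pos a 0"] low[of "pos a 0"] pos[OF blk_pos, of a] by simp_all
  have "A ** H = H ** A"
  proof (rule eq_on_basis_matrix[OF v])
    fix a
    show "(A ** H) *v (basis_matrix v *v axis a 1) = (H ** A) *v (basis_matrix v *v axis a 1)"
      unfolding basis_matrix_axis_pos[of v a] matrix_vector_mul_assoc[symmetric]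
        h_x_power_lowest[OF gen(1)] commutes_X_power[OF AX] h_x_power_lowest[OF gen(2)]
        linear_scale[OF matrix_vector_mul_linear] ..
  qed
  moreover have "A ** Y = Y ** A"
  proof (rule eq_on_basis_matrix[OF v])
    fix a
    show "(A ** Y) *v (basis_matrix v *v axis a 1) = (Y ** A) *v (basis_matrix v *v axis a 1)"
    proof (cases "lev a")
      case 0
      then show ?thesis
        using gen[of a] unfolding basis_matrix_axis_pos[of v a] matrix_vector_mul_assoc[symmetric]
        by (simp add: lowest_def)
    next
      case (Suc k)
      show ?thesis
        unfolding basis_matrix_axis_pos[of v a] matrix_vector_mul_assoc[symmetric] Suc
          y_x_power_lowest[OF gen(1)] commutes_X_power[OF AX] y_x_power_lowest[OF gen(2)]
          linear_scale[OF matrix_vector_mul_linear] commutes_X_power[OF AX] ..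
    qed
  qed
  ultimately show ?thesis using AX by (simp add: comm_def)
qed

lemma comm_lowest:
  assumes "comm A" "w \<in> lowest m"
  shows "A *v w \<in> lowest m"
proof -
  have w: "Y *v w = 0" "H *v w = (- real m) *\<^sub>R w" using assms(2) by (simp_all add: lowest_def)
  have "Y *v (A *v w) = A *v (Y *v w)" "H *v (A *v w) = A *v (H *v w)"
    using assms(1) by (simp_all add: comm_def matrix_vector_mul_assoc)
  then show ?thesis
    unfolding w linear_scale[OF matrix_vector_mul_linear] by (simp add: lowest_def)
qed

lemma basis_inv_X:
  assumes v: "L_bases X H Y v"
  shows "basis_inv v ** X = shift ** basis_inv v"
proof -
  have "basis_inv v ** (X ** basis_matrix v) ** basis_inv v = basis_inv v ** (basis_matrix v ** shift) ** basis_inv v"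
    by (simp only: X_basis_matrix[OF v])
  then show ?thesis by (simp add: matrix_mul_assoc[symmetric] basis_matrix_inv[OF v])
     (simp add: matrix_mul_assoc basis_matrix_inv[OF v])
qed

lemma block_form_comm:
  assumes v: "L_bases X H Y v" and z: "block_form z"
  shows "comm (basis_matrix v ** z ** basis_inv v)"
proof (rule comm_if_lowest[OF v])
  let ?b = "basis_matrix v" and ?A = "basis_matrix v ** z ** basis_inv v"
  have "?A ** X = ?b ** (z ** shift) ** basis_inv v"
    by (simp add: matrix_mul_assoc[symmetric] basis_inv_X[OF v])
  also have "\<dots> = (?b ** shift) ** z ** basis_inv v"
    by (simp add: block_form_commutes[OF z] matrix_mul_assoc)
  also have "\<dots> = X ** ?A"
    unfolding X_basis_matrix[OF v, symmetric] by (simp add: matrix_mul_assoc)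
  finally show "?A ** X = X ** ?A" .
  fix a assume a: "lev a = 0"
  have "?A *v (?b *v axis a 1) = ?b *v (z *v axis a 1)"
    by (simp add: matrix_vector_mul_assoc[symmetric] basis_inv_axis[OF v])
  also have "\<dots> = (\<Sum>c\<in>UNIV. z $ c $ a *s (?b *v axis c 1))"
    unfolding basis_matrix_expansion[of v "z *v axis a 1"] cmatrix_vector_mult_axis ..
  also have "\<dots> \<in> lowest (blk a - 1)"
  proof (rule vec.subspace_sum[OF vec_subspace_lowest])
    fix c
    show "z $ c $ a *s (?b *v axis c 1) \<in> lowest (blk a - 1)"
    proof (cases "z $ c $ a = 0")
      case True
      then show ?thesis using vec.subspace_0[OF vec_subspace_lowest] by simp
    next
      case False
      then have "blk c = blk a \<and> lev c = lev a" using z unfolding block_form_def by metis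
      then show ?thesis
        using basis_matrix_gen[OF v, of c] a vec.subspace_scale[OF vec_subspace_lowest] by simp
    qed
  qed
  finally show "?A *v (?b *v axis a 1) \<in> lowest (blk a - 1)" .
qed

text \<open>Only the spanning set \<open>v d\<close> has to be checked, and its members are level 0
  columns of \<open>basis_matrix v\<close>.\<close>

lemma lowest_coordinates:
  assumes v: "L_bases X H Y v" and d: "d \<in> set ds" and w: "w \<in> lowest (d - 1)"
  shows "(basis_inv v *v w) $ c \<noteq> 0 \<Longrightarrow> blk c = d \<and> lev c = 0"
proof -
  have "lowest (d - 1) \<subseteq> {w. basis_inv v *v w \<in> {x. \<forall>c. x $ c \<noteq> 0 \<longrightarrow> blk c = d \<and> lev c = 0}}"
    unfolding L_basesD(3)[OF v d, symmetric]
  proof (rule vec.span_minimal)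
    show "set (v d) \<subseteq> {w. basis_inv v *v w \<in> {x. \<forall>c. x $ c \<noteq> 0 \<longrightarrow> blk c = d \<and> lev c = 0}}"
    proof
      fix w assume "w \<in> set (v d)"
      then obtain i where i: "i < tt d" "w = v d ! i" using L_basesD(4)[OF v d] by (metis in_set_conv_nth)
      have "0 < d" using d set_ds by auto
      then have "((d, 0), i) \<in> set lst" using d i by (simp add: set_lst)
      then obtain a :: 'n where "lst ! idx a = ((d, 0), i)" using lst_idx_surj by blast
      then have a: "blk a = d" "lev a = 0" "num a = i" using lst_idx[of a] by auto
      then have "w = basis_matrix v *v axis a 1" using i by (simp add: basis_matrix_axis')
      then have "basis_inv v *v w = axis a 1" using basis_inv_axis[OF v] by simp
      then show "w \<in> {w. basis_inv v *v w \<in> {x. \<forall>c. x $ c \<noteq> 0 \<longrightarrow> blk c = d \<and> lev c = 0}}"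
        using a by (auto simp: axis_def)
    qed
    show "vec.subspace {w. basis_inv v *v w \<in> {x. \<forall>c. x $ c \<noteq> 0 \<longrightarrow> blk c = d \<and> lev c = 0}}"
      using vec_subspace_support[of "\<lambda>c. blk c = d \<and> lev c = 0"]
      by (auto intro!: vec.subspaceI simp: matrix_vector_right_distrib matrix_vector_scaleC
          dest: vec.subspace_add vec.subspace_scale)
  qed
  then show "(basis_inv v *v w) $ c \<noteq> 0 \<Longrightarrow> blk c = d \<and> lev c = 0" using w by blast
qed

text \<open>A matrix commuting with the triple preserves every \<open>lowest m\<close>, so it sends
  generators to combinations of generators of the same chain length.\<close>

lemma comm_block_form:
  assumes v: "L_bases X H Y v" and A: "comm A"
  shows "block_form (basis_inv v ** A ** basis_matrix v)"
proof (rule block_formI)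
  let ?b = "basis_matrix v" and ?z = "basis_inv v ** A ** basis_matrix v"
  have bz: "?b ** ?z = A ** ?b" by (simp add: matrix_mul_assoc basis_matrix_inv[OF v])
  have "?b ** (?z ** shift) = A ** (?b ** shift)" by (simp add: matrix_mul_assoc basis_matrix_inv[OF v])
  also have "\<dots> = A ** X ** ?b" by (simp add: X_basis_matrix[OF v, symmetric] matrix_mul_assoc)
  also have "\<dots> = X ** A ** ?b" using A by (simp only: comm_def)
  also have "\<dots> = X ** (A ** ?b)" by (simp only: matrix_mul_assoc)
  also have "\<dots> = X ** (?b ** ?z)" by (simp only: bz)
  also have "\<dots> = ?b ** (shift ** ?z)" by (simp add: matrix_mul_assoc X_basis_matrix[OF v])
  finally have "basis_inv v ** (?b ** (?z ** shift)) = basis_inv v ** (?b ** (shift ** ?z))" by (simp only:)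
  then have "(basis_inv v ** ?b) ** (?z ** shift) = (basis_inv v ** ?b) ** (shift ** ?z)"
    by (simp only: matrix_mul_assoc)
  then show "?z ** shift = shift ** ?z" unfolding basis_matrix_inv[OF v] matrix_mul_lid .
  fix a c assume a: "lev a = 0" and nz: "?z $ c $ a \<noteq> 0"
  have "A *v (?b *v axis a 1) \<in> lowest (blk a - 1)"
    by (rule comm_lowest[OF A basis_matrix_gen[OF v a]])
  moreover have "(basis_inv v *v (A *v (?b *v axis a 1))) $ c \<noteq> 0"
    using nz unfolding cmatrix_vector_mult_axis[of ?z, symmetric] by (simp add: matrix_vector_mul_assoc matrix_mul_assoc)
  ultimately show "blk c = blk a \<and> lev c = 0" using lowest_coordinates[OF v blk_in_ds] by blast
qed

lemma det_basis: "L_bases X H Y v \<Longrightarrow> Determinants.det (basis_matrix v) * Determinants.det (basis_inv v) = 1"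
  using arg_cong[OF basis_matrix_inv(1), of v Determinants.det] by (simp add: det_mul)

lemma det_basis_conj:
  assumes v: "L_bases X H Y v"
  shows "Determinants.det (basis_matrix v ** z ** basis_inv v) = Determinants.det z"
    "Determinants.det (basis_inv v ** z ** basis_matrix v) = Determinants.det z"
  using det_basis[OF v] by (simp_all add: det_mul mult.commute mult.left_commute)

lemma centralizer_iff: "g \<in> centralizer_triple X H Y \<longleftrightarrow> Determinants.det g = 1 \<and> comm g"
proof (cases "Determinants.det g = 1")
  case True
  then have "invertible g" by (simp add: invertible_det_nz)
  then show ?thesis using True by (simp add: centralizer_triple_def SL_def Ad_eq_iff comm_def)
qed (simp add: centralizer_triple_def SL_def)

lemma Lambda_eq:
  assumes v: "L_bases X H Y v"
  shows "Lambda (basis_B X H Y v) A = basis_inv v ** A ** basis_matrix v"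
proof -
  let ?b = "\<lambda>a. basis_matrix v *v axis a 1" and ?B = "set (basis_B X H Y v)"
  have nth: "basis_B X H Y v ! idx a = ?b a" for a
    using idx_less[of a] length_lst by (simp add: basis_B_eq[OF v] basis_matrix_axis)
  have B: "?B = vec_of v ` set lst" by (simp add: basis_B_eq[OF v])
  have bB: "?b a \<in> ?B" for a unfolding B basis_matrix_axis using lst_idx_mem by blast
  have ind: "vec.independent ?B" unfolding B by (rule independent_vec_of[OF v])
  have inj: "?b a = ?b c \<longleftrightarrow> a = c" for a c
    by (metis axis_eq_axis basis_inv_axis[OF v] zero_neq_one)
  have rep: "vec.representation ?B (basis_matrix v *v y) (?b i) = y $ i" for y i
  proof -
    have "vec.representation ?B (basis_matrix v *v y) = (\<lambda>w. \<Sum>a\<in>UNIV. vec.representation ?B (y $ a *s ?b a) w)"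
      unfolding basis_matrix_expansion[of v y]
      by (rule vec.representation_sum[OF ind]) (use bB vec.span_base vec.span_scale in blast)
    then have "vec.representation ?B (basis_matrix v *v y) (?b i) = (\<Sum>a\<in>UNIV. y $ a * vec.representation ?B (?b a) (?b i))"
      using vec.representation_scale[OF ind vec.span_base[OF bB]] by simp
    also have "\<dots> = (\<Sum>a\<in>UNIV. if a = i then y $ a else 0)"
      by (intro sum.cong) (auto simp: vec.representation_basis[OF ind bB] inj)
    finally show ?thesis by simp
  qed
  have "Lambda (basis_B X H Y v) A $ i $ j = (basis_inv v ** A ** basis_matrix v) $ i $ j" for i j
  proof -
    have "A *v ?b j = basis_matrix v *v ((basis_inv v ** A ** basis_matrix v) *v axis j 1)"
      by (simp add: matrix_vector_mul_assoc matrix_mul_assoc basis_matrix_inv[OF v])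
    then show ?thesis by (simp add: Lambda_def nth rep cmatrix_vector_mult_axis)
  qed
  then show ?thesis by (simp add: vec_eq_iff)
qed

text \<open>The arguments are exchanged because \<open>basis_inner\<close> is linear in its first
  argument and \<open>hinner\<close> in its second.\<close>

lemma basis_inner_basis_matrix:
  assumes v: "L_bases X H Y v" and d: "d \<in> set ds"
    and x: "\<And>c. x $ c \<noteq> 0 \<Longrightarrow> blk c = d \<and> lev c = 0" and y: "\<And>c. y $ c \<noteq> 0 \<Longrightarrow> blk c = d \<and> lev c = 0"
  shows "basis_inner (v d) (basis_matrix v *v x) (basis_matrix v *v y) = hinner y x"
proof -
  let ?b = "\<lambda>a. basis_matrix v *v axis a 1" and ?J = "{c. blk c = d \<and> lev c = 0}"
  have inj: "?b a = ?b c \<longleftrightarrow> a = c" for a c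
    by (metis axis_eq_axis basis_inv_axis[OF v] zero_neq_one)
  have bij: "bij_betw ?b ?J (set (v d))"
    unfolding bij_betw_def
  proof (intro conjI equalityI subsetI)
    show "inj_on ?b ?J" using inj by (simp add: inj_on_def)
    fix w assume "w \<in> ?b ` ?J"
    then obtain c where "blk c = d" "lev c = 0" "w = ?b c" by blast
    then show "w \<in> set (v d)" using num_less[of c] L_basesD(4)[OF v d] by (auto simp: basis_matrix_axis')
  next
    fix w assume "w \<in> set (v d)"
    then obtain i where i: "i < tt d" "w = v d ! i" using L_basesD(4)[OF v d] by (metis in_set_conv_nth)
    have "0 < d" using d set_ds by auto
    then have "((d, 0), i) \<in> set lst" using d i by (simp add: set_lst)
    then obtain a :: 'n where "lst ! idx a = ((d, 0), i)" using lst_idx_surj by blast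
    then have a: "blk a = d" "lev a = 0" "num a = i" using lst_idx[of a] by auto
    then have "w = ?b a" using i by (simp add: basis_matrix_axis')
    then show "w \<in> ?b ` ?J" using a by blast
  qed
  have ind: "vec.independent (set (v d))" by (rule L_basesD(2)[OF v d])
  have bB: "?b c \<in> set (v d)" if "c \<in> ?J" for c using bij that by (auto simp: bij_betw_def)
  have rep: "vec.representation (set (v d)) (basis_matrix v *v x) (?b i) = x $ i"
    if x: "\<And>c. x $ c \<noteq> 0 \<Longrightarrow> blk c = d \<and> lev c = 0" and i: "i \<in> ?J" for x i
  proof -
    have "basis_matrix v *v x = (\<Sum>c\<in>?J. x $ c *s ?b c)"
      unfolding basis_matrix_expansion[of v x] using x by (intro sum.mono_neutral_right) auto
    moreover have "vec.representation (set (v d)) (\<Sum>c\<in>?J. x $ c *s ?b c) =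
        (\<lambda>w. \<Sum>c\<in>?J. vec.representation (set (v d)) (x $ c *s ?b c) w)"
      by (rule vec.representation_sum[OF ind vec.span_scale[OF vec.span_base[OF bB]]])
    ultimately have "vec.representation (set (v d)) (basis_matrix v *v x) (?b i) =
        (\<Sum>c\<in>?J. x $ c * vec.representation (set (v d)) (?b c) (?b i))"
      using vec.representation_scale[OF ind vec.span_base[OF bB]] by simp
    also have "\<dots> = (\<Sum>c\<in>?J. if c = i then x $ c else 0)"
      by (intro sum.cong refl) (subst vec.representation_basis[OF ind bB], auto simp: inj)
    finally show ?thesis using i by simp
  qed
  have "basis_inner (v d) (basis_matrix v *v x) (basis_matrix v *v y) =
      (\<Sum>c\<in>?J. vec.representation (set (v d)) (basis_matrix v *v x) (?b c) *
        cnj (vec.representation (set (v d)) (basis_matrix v *v y) (?b c)))"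
    unfolding basis_inner_def by (rule sum.reindex_bij_betw[OF bij, symmetric])
  also have "\<dots> = (\<Sum>c\<in>?J. x $ c * cnj (y $ c))"
  proof (rule sum.cong[OF refl])
    fix c assume c: "c \<in> ?J"
    have "vec.representation (set (v d)) (basis_matrix v *v x) (?b c) = x $ c"
      by (rule rep[OF _ c]) (rule x)
    moreover have "vec.representation (set (v d)) (basis_matrix v *v y) (?b c) = y $ c"
      by (rule rep[OF _ c]) (rule y)
    ultimately show "vec.representation (set (v d)) (basis_matrix v *v x) (?b c) *
        cnj (vec.representation (set (v d)) (basis_matrix v *v y) (?b c)) = x $ c * cnj (y $ c)"
      by simp
  qed
  also have "\<dots> = (\<Sum>c\<in>UNIV. x $ c * cnj (y $ c))"
    using x by (intro sum.mono_neutral_left) auto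
  finally show ?thesis by (simp add: hinner_def mult.commute)
qed

section \<open>The group of unitary blocks\<close>

text \<open>The stabilizer of \<open>shift\<close> in \<open>SU\<close>, as it arises from the
  homotopy type of the orbit; \<open>unitary_block_group_eq\<close> identifies it with the group in
  the theorem.\<close>

definition unit_stab :: "'n cmatrix set" where
  "unit_stab = {u \<in> SU. u ** shift = shift ** u}"

lemma lst_obtain:
  assumes "d \<in> set ds" "l < d" "i < tt d"
  obtains a :: 'n where "blk a = d" "lev a = l" "num a = i"
proof -
  have "((d, l), i) \<in> set lst" using assms by (simp add: set_lst)
  then obtain a :: 'n where "lst ! idx a = ((d, l), i)" using lst_idx_surj by blast
  then have "blk a = d" "lev a = l" "num a = i" using lst_idx[of a] by simp_all
  then show thesis by (rule that)
qed

context
  fixes g :: "nat \<Rightarrow> complex mat"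
  assumes g: "\<And>d. d \<in> set ds \<Longrightarrow> g d \<in> carrier_mat (tt d) (tt d)"
begin

lemma carrier_tags: "x \<in> set (tags ds) \<Longrightarrow> g (fst x) \<in> carrier_mat (tt (fst x)) (tt (fst x))"
  using g by (auto simp: set_tags)

lemma block_D_entry:
  "(block_D ds g :: 'n cmatrix) $ a $ c =
    (if blk a = blk c \<and> lev a = lev c then g (blk a) $$ (num a, num c) else 0)"
proof -
  have dt: "distinct (tags ds)" unfolding tags_eq_labels by (intro distinct_labels distinct_ds)
  have len: "idx e < length (labels (tags ds) (\<lambda>x. tt (fst x)))" for e :: 'n
    using idx_less[of e] length_lst by (simp add: lst_def)
  have "(block_D ds g :: 'n cmatrix) $ a $ c = diag_block_mat (map (\<lambda>x. g (fst x)) (tags ds)) $$ (idx a, idx c)"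
    by (simp add: block_D_def concat_replicate_eq_map_tags)
  also have "\<dots> = (if fst (lst ! idx a) = fst (lst ! idx c)
      then g (fst (fst (lst ! idx a))) $$ (snd (lst ! idx a), snd (lst ! idx c)) else 0)"
    unfolding lst_def by (rule diag_block_mat_entry[OF carrier_tags dt len len])
  finally show ?thesis unfolding lst_idx by simp
qed

lemma det_block_D: "Determinants.det (block_D ds g :: 'n cmatrix) = chi_d ds g"
proof -
  let ?D = "diag_block_mat (map (\<lambda>x. g (fst x)) (tags ds))"
  have "?D \<in> carrier_mat (length lst) (length lst)"
    unfolding lst_def by (rule diag_block_mat_carrier[OF carrier_tags])
  then have D: "?D \<in> carrier_mat CARD('n) CARD('n)" by (simp only: length_lst)
  have "(block_D ds g :: 'n cmatrix) = (\<chi> i j. ?D $$ (idx i, idx j))"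
    by (simp add: block_D_def concat_replicate_eq_map_tags)
  then have "Determinants.det (block_D ds g :: 'n cmatrix) = Determinant.det ?D"
    using det_idx[OF D] by simp
  also have "\<dots> = (\<Prod>x\<leftarrow>tags ds. Determinant.det (g (fst x)))"
    by (rule det_diag_block_mat[OF carrier_tags])
  also have "\<dots> = chi_d ds g"
    unfolding chi_d_def by (rule prod_list_tags[OF distinct_ds])
  finally show ?thesis .
qed

end

lemma sum_same_level:
  "(\<Sum>b\<in>(UNIV :: 'n set). if blk b = blk a \<and> lev b = lev a then F (num b) else 0) = (\<Sum>j<tt (blk a). F j)"
proof -
  have "bij_betw num {b :: 'n. blk b = blk a \<and> lev b = lev a} {..<tt (blk a)}"
    unfolding bij_betw_def
  proof (intro conjI equalityI subsetI)
    show "inj_on num {b :: 'n. blk b = blk a \<and> lev b = lev a}"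
      by (rule inj_onI) (use lab_eqI in auto)
  next
    fix j assume "j \<in> num ` {b :: 'n. blk b = blk a \<and> lev b = lev a}"
    then obtain b :: 'n where "blk b = blk a" "j = num b" by blast
    then show "j \<in> {..<tt (blk a)}" using num_less[of b] by simp
  next
    fix j assume "j \<in> {..<tt (blk a)}"
    then obtain b :: 'n where "blk b = blk a" "lev b = lev a" "num b = j"
      using lst_obtain[OF blk_in_ds lev_less, of j a] by blast
    then show "j \<in> num ` {b :: 'n. blk b = blk a \<and> lev b = lev a}" by blast
  qed
  from sum.reindex_bij_betw[OF this, of F] show ?thesis
    by (simp add: sum.inter_filter[symmetric])
qed

lemma block_D_unitary_iff:
  fixes g :: "nat \<Rightarrow> complex mat"
  assumes g: "\<And>d. d \<in> set ds \<Longrightarrow> g d \<in> carrier_mat (tt d) (tt d)"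
  shows "(block_D ds g :: 'n cmatrix) ** conj_transpose (block_D ds g) = mat 1 \<longleftrightarrow>
    (\<forall>d\<in>set ds. g d \<in> unitary_group (tt d))"
proof -
  let ?B = "block_D ds g :: 'n cmatrix"
  let ?S = "\<lambda>d i k. \<Sum>j<tt d. g d $$ (i, j) * cnj (g d $$ (k, j))"
  have e: "(?B ** conj_transpose ?B) $ a $ c =
      (if blk a = blk c \<and> lev a = lev c then ?S (blk a) (num a) (num c) else 0)" for a c
  proof -
    have "(?B ** conj_transpose ?B) $ a $ c = (\<Sum>b\<in>(UNIV :: 'n set). ?B $ a $ b * cnj (?B $ c $ b))"
      by (simp add: matrix_matrix_mult_def conj_transpose_def)
    also have "\<dots> = (\<Sum>b\<in>(UNIV :: 'n set). if blk b = blk a \<and> lev b = lev a then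
        (if blk a = blk c \<and> lev a = lev c then g (blk a) $$ (num a, num b) * cnj (g (blk a) $$ (num c, num b)) else 0) else 0)"
      by (intro sum.cong refl) (auto simp: block_D_entry[OF g])
    also have "\<dots> = (\<Sum>j<tt (blk a). if blk a = blk c \<and> lev a = lev c then g (blk a) $$ (num a, j) * cnj (g (blk a) $$ (num c, j)) else 0)"
      by (rule sum_same_level)
    also have "\<dots> = (if blk a = blk c \<and> lev a = lev c then ?S (blk a) (num a) (num c) else 0)"
      by (cases "blk a = blk c \<and> lev a = lev c") (simp_all only: simp_thms if_True if_False sum.neutral_const)
    finally show ?thesis .
  qed
  show ?thesis
  proof
    assume B: "?B ** conj_transpose ?B = mat 1"
    show "\<forall>d\<in>set ds. g d \<in> unitary_group (tt d)"
    proof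
      fix d assume d: "d \<in> set ds"
      then have d0: "0 < d" using set_ds by auto
      have "?S d i k = (if i = k then 1 else 0)" if ik: "i < tt d" "k < tt d" for i k
      proof -
        obtain a :: 'n where a: "blk a = d" "lev a = 0" "num a = i" using lst_obtain[OF d d0 ik(1)] by blast
        obtain c :: 'n where c: "blk c = d" "lev c = 0" "num c = k" using lst_obtain[OF d d0 ik(2)] by blast
        have "?S d i k = mat 1 $ a $ c" using e[of a c] a c B by simp
        then show ?thesis using a c lab_eqI[of a c] by (auto simp: Finite_Cartesian_Product.mat_def)
      qed
      then show "g d \<in> unitary_group (tt d)" using g[OF d] by (simp add: unitary_group_iff)
    qed
  next
    assume u: "\<forall>d\<in>set ds. g d \<in> unitary_group (tt d)"
    have "(?B ** conj_transpose ?B) $ a $ c = mat 1 $ a $ c" for a c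
    proof (cases "blk a = blk c \<and> lev a = lev c")
      case True
      then have "?S (blk a) (num a) (num c) = (if num a = num c then 1 else 0)"
        using u blk_in_ds[of a] num_less[of a] num_less[of c] by (simp add: unitary_group_iff)
      then show ?thesis unfolding e using True lab_eqI[of a c] by (auto simp: Finite_Cartesian_Product.mat_def)
    next
      case False
      then show ?thesis unfolding e by (auto simp: Finite_Cartesian_Product.mat_def)
    qed
    then show "?B ** conj_transpose ?B = mat 1" by (simp only: vec_eq_iff) simp
  qed
qed

lemma block_form_eq_block_D:
  assumes "block_form u"
  obtains g where "g \<in> (\<Pi>\<^sub>E d\<in>set ds. carrier_mat (tt d) (tt d))" "u = block_D ds g"
proof -
  \<comment> \<open>The blocks are read off at level 0.\<close>
  define cell where "cell d i = (SOME a :: 'n. blk a = d \<and> lev a = 0 \<and> num a = i)" for d i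
  have cell: "cell (blk a) (num a) = pos a 0" for a
    unfolding cell_def using pos[OF blk_pos, of a] by (intro some_equality) (auto intro: lab_eqI)
  \<comment> \<open>Restriction to \<open>set ds\<close> makes \<open>g\<close> extensional, as
    membership in the product demands.\<close>
  define g where "g = (\<lambda>d\<in>set ds. Matrix.mat (tt d) (tt d) (\<lambda>(i, k). u $ cell d i $ cell d k))"
  have g: "g \<in> (\<Pi>\<^sub>E d\<in>set ds. carrier_mat (tt d) (tt d))" by (auto simp: g_def)
  have "u $ a $ c = (block_D ds g :: 'n cmatrix) $ a $ c" for a c
  proof (cases "blk a = blk c \<and> lev a = lev c")
    case True
    then have "(block_D ds g :: 'n cmatrix) $ a $ c = g (blk a) $$ (num a, num c)"
      by (subst block_D_entry) (use g in \<open>auto simp: PiE_mem\<close>)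
    also have "\<dots> = u $ cell (blk a) (num a) $ cell (blk a) (num c)"
      using True blk_in_ds[of a] num_less[of a] num_less[of c] by (simp add: g_def)
    also have "\<dots> = u $ pos a 0 $ pos c 0" using True cell[of a] cell[of c] by simp
    also have "\<dots> = u $ a $ c" using assms True unfolding block_form_def by metis
    finally show ?thesis by simp
  next
    case False
    then have "(block_D ds g :: 'n cmatrix) $ a $ c = 0"
      by (subst block_D_entry) (use g in \<open>auto simp: PiE_mem\<close>)
    moreover have "u $ a $ c = 0" using assms False unfolding block_form_def by metis
    ultimately show ?thesis by simp
  qed
  then have "u = block_D ds g" by (simp only: vec_eq_iff) simp
  with g that show thesis by blast
qed

lemma block_form_block_D:
  assumes g: "\<And>d. d \<in> set ds \<Longrightarrow> g d \<in> carrier_mat (tt d) (tt d)"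
  shows "block_form (block_D ds g :: 'n cmatrix)"
  unfolding block_form_def
proof (intro allI)
  fix c b
  show "(block_D ds g :: 'n cmatrix) $ c $ b =
      (if blk c = blk b \<and> lev c = lev b then (block_D ds g :: 'n cmatrix) $ pos c 0 $ pos b 0 else 0)"
    by (auto simp: block_D_entry[OF g] pos blk_pos)
qed

text \<open>A unitary matrix commuting with \<open>shift\<close> has block form; for block matrices
  unitarity holds blockwise and the determinant is \<open>chi_d\<close>.\<close>

lemma unitary_block_group_eq: "unitary_block_group X H Y = unit_stab"
proof (intro equalityI subsetI)
  fix u assume "u \<in> unitary_block_group X H Y"
  then obtain g where u: "u = block_D ds g" and g: "g \<in> (\<Pi>\<^sub>E d\<in>set ds. unitary_group (tt d))" and chi: "chi_d ds g = 1"
    by (auto simp: unitary_block_group_def)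
  have gu: "\<forall>d\<in>set ds. g d \<in> unitary_group (tt d)" using g by (auto simp: PiE_mem)
  have gc: "\<And>d. d \<in> set ds \<Longrightarrow> g d \<in> carrier_mat (tt d) (tt d)" using gu by (simp add: unitary_group_iff)
  show "u \<in> unit_stab"
    unfolding unit_stab_def u mem_Collect_eq SU_def
    using block_form_commutes[OF block_form_block_D[OF gc]] block_D_unitary_iff[OF gc] gu det_block_D[OF gc] chi by simp
next
  fix u assume "u \<in> unit_stab"
  then have u: "conj_transpose u ** u = mat 1" "u ** conj_transpose u = mat 1" "Determinants.det u = 1" "u ** shift = shift ** u"
    by (simp_all add: unit_stab_def SU_iff unitary_left_right[symmetric])
  obtain g where g: "g \<in> (\<Pi>\<^sub>E d\<in>set ds. carrier_mat (tt d) (tt d))" "u = block_D ds g"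
    using block_form_eq_block_D[OF unitary_commutes_block_form[OF u(1,4)]] .
  have gc: "\<And>d. d \<in> set ds \<Longrightarrow> g d \<in> carrier_mat (tt d) (tt d)" using g(1) by (auto simp: PiE_mem)
  have "\<forall>d\<in>set ds. g d \<in> unitary_group (tt d)" using block_D_unitary_iff[OF gc] u(2) g(2) by simp
  then have "g \<in> (\<Pi>\<^sub>E d\<in>set ds. unitary_group (tt d))" using g(1) by (auto simp: PiE_iff)
  moreover have "chi_d ds g = 1" using det_block_D[OF gc] u(3) g(2) by simp
  ultimately show "u \<in> unitary_block_group X H Y" unfolding unitary_block_group_def using g(2) by blast
qed

end

lemma commutes_mult:
  assumes "A ** Z = Z ** A" "B ** Z = Z ** B"
  shows "(A ** B) ** Z = Z ** (A ** B :: complex^'n^'n)"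
proof -
  have "(A ** B) ** Z = A ** (B ** Z)" by (simp only: matrix_mul_assoc)
  also have "\<dots> = (A ** Z) ** B" by (simp only: assms(2) matrix_mul_assoc)
  finally show ?thesis by (simp only: assms(1) matrix_mul_assoc)
qed

lemma commutes_inverse:
  fixes A A' Z :: "complex^'n^'n"
  assumes "A ** A' = mat 1" "A' ** A = mat 1" "A ** Z = Z ** A"
  shows "A' ** Z = Z ** A'"
proof -
  have "A' ** Z = A' ** (Z ** A) ** A'" by (simp add: matrix_mul_assoc[symmetric] assms(1))
  also have "\<dots> = A' ** (A ** Z) ** A'" by (simp only: assms(3))
  also have "\<dots> = Z ** A'" by (simp add: matrix_mul_assoc assms(2))
  finally show ?thesis .
qed

section \<open>Maximal compact subgroups of the centralizer\<close>

context sl2_matrices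
begin

abbreviation "C \<equiv> centralizer_triple X H Y"

lemma comm_mult: "comm A \<Longrightarrow> comm B \<Longrightarrow> comm (A ** B)"
  unfolding comm_def using commutes_mult by blast

lemma centralizer_mult: "g \<in> C \<Longrightarrow> k \<in> C \<Longrightarrow> g ** k \<in> C"
  using comm_mult by (simp add: centralizer_iff det_mul)

lemma centralizer_inv:
  assumes "g \<in> C"
  shows "matrix_inv g \<in> C" "g ** matrix_inv g = mat 1" "matrix_inv g ** g = mat 1"
proof -
  have g: "Determinants.det g = 1" "comm g" using assms by (simp_all add: centralizer_iff)
  then have "invertible g" by (simp add: invertible_det_nz)
  note i = matrix_inv[OF this]
  have "Determinants.det (matrix_inv g) = 1"
    using arg_cong[OF i(1), of Determinants.det] g(1) by (simp add: det_mul)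
  moreover have "comm (matrix_inv g)"
    using g(2) commutes_inverse[OF i] unfolding comm_def by blast
  ultimately show "matrix_inv g \<in> C" by (simp add: centralizer_iff)
  show "g ** matrix_inv g = mat 1" "matrix_inv g ** g = mat 1" by (rule i)+
qed

lemma subgroup_iff:
  "compact_subgroup K C \<longleftrightarrow> K \<subseteq> C \<and> compact K \<and> mat 1 \<in> K \<and>
    (\<forall>j\<in>K. \<forall>k\<in>K. j ** k \<in> K) \<and> (\<forall>k\<in>K. \<exists>k'\<in>K. k ** k' = mat 1)"
proof (rule compact_subgroup_iff)
  fix g assume "g \<in> C"
  then show "\<exists>g'\<in>C. g ** g' = mat 1" by (intro bexI[of _ "matrix_inv g"] centralizer_inv)
qed

lemma compact_unit_stab: "compact unit_stab"
proof -
  have "closed {u. u ** shift = shift ** u}" by (intro closed_Collect_eq continuous_intros)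
  then have "compact (SU \<inter> {u. u ** shift = shift ** u})" by (rule compact_Int_closed[OF compact_SU])
  then show ?thesis by (simp add: unit_stab_def Int_def)
qed

lemma unit_stab_mult: "u \<in> unit_stab \<Longrightarrow> u' \<in> unit_stab \<Longrightarrow> u ** u' \<in> unit_stab"
  by (simp add: unit_stab_def SU_mult commutes_mult)

lemma unit_stab_conj_transpose: "u \<in> unit_stab \<Longrightarrow> conj_transpose u \<in> unit_stab"
  using commutes_inverse[of u "conj_transpose u" shift] SU_conj_transpose[of u]
  by (simp add: unit_stab_def) (simp add: SU_def unitary_left_right)

lemma unit_stab_1: "mat 1 \<in> unit_stab"
  by (simp add: unit_stab_def SU_iff)

definition standard_compact :: "(nat \<Rightarrow> 'n cvector list) \<Rightarrow> 'n cmatrix set" where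
  "standard_compact v = (\<lambda>u. basis_matrix v ** u ** basis_inv v) ` unit_stab"

lemma Lambda_standard_compact:
  assumes v: "L_bases X H Y v"
  shows "Lambda (basis_B X H Y v) ` standard_compact v = unit_stab"
proof -
  have "basis_inv v ** (basis_matrix v ** u ** basis_inv v) ** basis_matrix v = u" for u
    by (simp add: matrix_mul_assoc[symmetric] basis_matrix_inv[OF v])
       (simp add: matrix_mul_assoc basis_matrix_inv[OF v])
  then show ?thesis by (simp add: standard_compact_def image_image Lambda_eq[OF v])
qed

lemma compact_subgroup_standard:
  assumes v: "L_bases X H Y v"
  shows "compact_subgroup (standard_compact v) C"
  unfolding subgroup_iff
proof (intro conjI ballI)
  let ?c = "\<lambda>u. basis_matrix v ** u ** basis_inv v"
  have mult: "?c u ** ?c u' = ?c (u ** u')" for u u'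
  proof -
    have "?c u ** ?c u' = basis_matrix v ** u ** (basis_inv v ** basis_matrix v) ** u' ** basis_inv v"
      by (simp only: matrix_mul_assoc)
    then show ?thesis by (simp add: basis_matrix_inv[OF v] matrix_mul_assoc)
  qed
  have one: "?c (mat 1) = mat 1" by (simp add: basis_matrix_inv[OF v])
  show "standard_compact v \<subseteq> C"
    unfolding standard_compact_def
  proof (rule image_subsetI)
    fix u assume "u \<in> unit_stab"
    then have u: "conj_transpose u ** u = mat 1" "Determinants.det u = 1" "u ** shift = shift ** u"
      by (simp_all add: unit_stab_def SU_iff)
    show "?c u \<in> C"
      using block_form_comm[OF v unitary_commutes_block_form[OF u(1,3)]] det_basis_conj(1)[OF v] u(2)
      by (simp add: centralizer_iff)
  qed
  show "compact (standard_compact v)"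
    unfolding standard_compact_def
    by (rule compact_continuous_image[OF _ compact_unit_stab]) (intro continuous_intros)
  show "mat 1 \<in> standard_compact v"
    unfolding standard_compact_def using imageI[OF unit_stab_1, of ?c] one by simp
  fix j assume "j \<in> standard_compact v"
  then obtain u where u: "u \<in> unit_stab" "j = ?c u" unfolding standard_compact_def by (rule imageE)
  show "j ** k \<in> standard_compact v" if k: "k \<in> standard_compact v" for k
  proof -
    obtain u' where u': "u' \<in> unit_stab" "k = ?c u'" using k unfolding standard_compact_def by (rule imageE)
    show ?thesis unfolding u(2) u'(2) mult standard_compact_def by (intro imageI unit_stab_mult u u')
  qed
  have "u ** conj_transpose u = mat 1" using u(1) by (simp add: unit_stab_def SU_def)
  then have "j ** ?c (conj_transpose u) = mat 1" unfolding u(2) mult using one by simp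
  moreover have "?c (conj_transpose u) \<in> standard_compact v"
    unfolding standard_compact_def by (intro imageI unit_stab_conj_transpose u)
  ultimately show "\<exists>k\<in>standard_compact v. j ** k = mat 1" by blast
qed

text \<open>Adapted generators are orthonormal for a form that \<open>k\<close> preserves, so the
  level 0 columns of its matrix are orthonormal within each block size and
  \<open>block_form_unitary\<close> applies.\<close>

lemma adapted_subset_standard:
  assumes ad: "adapted_bases X H Y K v" and K: "K \<subseteq> C"
  shows "K \<subseteq> standard_compact v"
proof
  fix k assume k: "k \<in> K"
  then have kc: "Determinants.det k = 1" "comm k" using K centralizer_iff by blast+
  have v: "L_bases X H Y v" using ad by (simp add: adapted_bases_def)
  let ?b = "basis_matrix v" and ?z = "basis_inv v ** k ** basis_matrix v"
  have bf: "block_form ?z" by (rule comm_block_form[OF v kc(2)])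
  have kb: "k *v (?b *v x) = ?b *v (?z *v x)" for x
  proof -
    have "?b *v (?z *v x) = ((?b ** basis_inv v) ** k ** ?b) *v x"
      by (simp only: matrix_vector_mul_assoc matrix_mul_assoc)
    then show ?thesis by (simp add: basis_matrix_inv[OF v] matrix_vector_mul_assoc)
  qed
  have "conj_transpose ?z ** ?z = mat 1"
  proof (rule block_form_unitary[OF bf])
    fix a b assume ab: "lev a = 0" "lev b = 0" "blk a = blk b"
    have d: "blk b \<in> set ds" by (rule blk_in_ds)
    have L: "L_space X H Y (blk b) = lowest (blk b - 1)" by (rule L_space_eq[OF blk_pos])
    have mem: "?b *v axis a 1 \<in> L_space X H Y (blk b)" "?b *v axis b 1 \<in> L_space X H Y (blk b)"
      unfolding L using basis_matrix_gen[OF v, of a] basis_matrix_gen[OF v, of b] ab by simp_all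
    have ax: "blk c = blk b \<and> lev c = 0" if "axis e (1::complex) $ c \<noteq> 0" "e = a \<or> e = b" for c e
      using that ab by (auto simp: axis_def split: if_splits)
    have zx: "blk c = blk b \<and> lev c = 0" if nz: "(?z *v axis e 1) $ c \<noteq> 0" and e: "e = a \<or> e = b" for c e
    proof -
      have "?z $ c $ e \<noteq> 0" using nz unfolding cmatrix_vector_mult_axis .
      then have "blk c = blk e \<and> lev c = lev e" using bf unfolding block_form_def by metis
      then show ?thesis using e ab by auto
    qed
    have "basis_inner (v (blk b)) (k *v (?b *v axis b 1)) (k *v (?b *v axis a 1)) =
        basis_inner (v (blk b)) (?b *v axis b 1) (?b *v axis a 1)"
      using ad k d mem unfolding adapted_bases_def by blast
    moreover have "basis_inner (v (blk b)) (?b *v axis b 1) (?b *v axis a 1) = hinner (axis a 1) (axis b 1)"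
      by (rule basis_inner_basis_matrix[OF v d]) (use ax in blast)+
    moreover have "basis_inner (v (blk b)) (?b *v (?z *v axis b 1)) (?b *v (?z *v axis a 1)) =
        hinner (?z *v axis a 1) (?z *v axis b 1)"
      by (rule basis_inner_basis_matrix[OF v d]) (use zx in blast)+
    ultimately show "hinner (?z *v axis a 1) (?z *v axis b 1) = (if a = b then 1 else 0)"
      unfolding kb hinner_axis_axis by simp
  qed
  moreover have "Determinants.det ?z = 1" using det_basis_conj(2)[OF v] kc(1) by simp
  ultimately have "?z \<in> unit_stab"
    using block_form_commutes[OF bf] by (simp add: unit_stab_def SU_iff)
  then have "?b ** ?z ** basis_inv v \<in> standard_compact v" unfolding standard_compact_def by (rule imageI)
  moreover have "?b ** ?z ** basis_inv v = (?b ** basis_inv v) ** k ** (?b ** basis_inv v)"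
    by (simp only: matrix_mul_assoc)
  ultimately show "k \<in> standard_compact v" by (simp add: basis_matrix_inv[OF v])
qed

text \<open>The inclusion is an equality because \<open>standard_compact v\<close> is itself a
  compact subgroup and \<open>K\<close> is maximal.\<close>

lemma adapted_eq_standard:
  assumes ad: "adapted_bases X H Y K v" and K: "maximal_compact_subgroup K C"
  shows "K = standard_compact v"
proof -
  have v: "L_bases X H Y v" using ad by (simp add: adapted_bases_def)
  have c: "compact_subgroup K C" using K by (simp add: maximal_compact_subgroup_def)
  then have "K \<subseteq> C" unfolding subgroup_iff by (rule conjunct1)
  from adapted_subset_standard[OF ad this] show ?thesis
    using K compact_subgroup_standard[OF v] unfolding maximal_compact_subgroup_def by blast
qed

text \<open>\<open>w'\<close> turns the form \<open>hinner (w' *v x) (w' *v y)\<close> into the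
  standard one. Orthonormal vectors are found in the preimage of \<open>lowest (d - 1)\<close> under
  \<open>w\<close> and carried back by \<open>w\<close>.\<close>

lemma orthonormal_basis_lowest:
  fixes w w' :: "'n cmatrix"
  assumes d: "d \<in> set ds" and w: "w' ** w = mat 1" "w ** w' = mat 1"
  shows "\<exists>vs. ordered_basis_of vs (L_space X H Y d) \<and> length vs = tt d \<and>
    (\<forall>i<tt d. \<forall>j<tt d. hinner (w' *v vs ! i) (w' *v vs ! j) = (if i = j then 1 else 0))"
proof -
  have L: "L_space X H Y d = lowest (d - 1)" using L_space_eq[of d] d set_ds by auto
  obtain v where v: "L_bases X H Y v" using L_bases_exists by blast
  note vd = L_basesD[OF v d]
  have ww: "w *v (w' *v x) = x" "w' *v (w *v x) = x" for x
    by (simp_all add: matrix_vector_mul_assoc w)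
  let ?R = "{x. w *v x \<in> lowest (d - 1)}"
  have "\<exists>\<omega>. (\<forall>i\<in>{..<tt d}. \<omega> i \<in> ?R \<and> (\<forall>t\<in>{0}. hinner (\<omega> i) t = 0)) \<and>
      (\<forall>i\<in>{..<tt d}. \<forall>j\<in>{..<tt d}. hinner (\<omega> i) (\<omega> j) = (if i = j then 1 else 0))"
  proof (rule orthonormal_family_exists[where u = "\<lambda>i. w' *v (v d ! i)"])
    show "vec.subspace ?R"
      using vec_subspace_lowest[of "d - 1"]
      by (intro vec.subspaceI)
        (simp_all add: matrix_vector_right_distrib matrix_vector_scaleC vec.subspace_0 vec.subspace_add vec.subspace_scale)
    then show "{0} \<subseteq> ?R" using vec.subspace_0 by blast
    show "w' *v (v d ! i) \<in> ?R" if "i \<in> {..<tt d}" for i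
      using vd(3,4) vec.span_base[of "v d ! i" "set (v d)"] that by (simp add: ww)
    fix c i assume s: "(\<Sum>i\<in>{..<tt d}. c i *s (w' *v (v d ! i))) \<in> {0}" and i: "i \<in> {..<tt d}"
    have "w' *v (\<Sum>i<tt d. c i *s (v d ! i)) = (\<Sum>i\<in>{..<tt d}. c i *s (w' *v (v d ! i)))"
      by (simp only: linear_sum[OF matrix_vector_mul_linear] matrix_vector_scaleC)
    then have "w' *v (\<Sum>i<tt d. c i *s (v d ! i)) = 0" using s by simp
    then have "(\<Sum>i<tt d. c i *s (v d ! i)) = 0" using ww(1)[of "\<Sum>i<tt d. c i *s (v d ! i)"] by simp
    then show "c i = 0" using vec_independent_list[OF vd(1,2), of c i] i vd(4) by simp
  qed simp_all
  then obtain \<omega> where \<omega>: "\<And>i. i < tt d \<Longrightarrow> w *v \<omega> i \<in> lowest (d - 1)"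
      "\<And>i j. i < tt d \<Longrightarrow> j < tt d \<Longrightarrow> hinner (\<omega> i) (\<omega> j) = (if i = j then 1 else 0)"
    by auto
  define vs where "vs = map (\<lambda>i. w *v \<omega> i) [0..<tt d]"
  have len: "length vs = tt d" by (simp add: vs_def)
  have nth: "w' *v vs ! i = \<omega> i" if "i < tt d" for i using that by (simp add: vs_def ww)
  have dist: "distinct vs"
    unfolding distinct_conv_nth len
  proof (intro allI impI notI)
    fix i j assume ij: "i < tt d" "j < tt d" "i \<noteq> j" "vs ! i = vs ! j"
    then have "\<omega> i = \<omega> j" using nth by metis
    then show False using \<omega>(2)[of i j] \<omega>(2)[of i i] ij by simp
  qed
  have ortho: "hinner (w' *v x) (w' *v y) = (if x = y then 1 else 0)" if xy: "x \<in> set vs" "y \<in> set vs" for x y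
  proof -
    obtain i where i: "i < tt d" "x = vs ! i" using xy(1) len by (metis in_set_conv_nth)
    obtain j where j: "j < tt d" "y = vs ! j" using xy(2) len by (metis in_set_conv_nth)
    show ?thesis using i j \<omega>(2)[of i j] nth nth_eq_iff_index_eq[OF dist, of i j] len by simp
  qed
  have ind: "vec.independent (set vs)"
  proof (rule vec.independent_if_scalars_zero)
    fix f x assume f: "(\<Sum>y\<in>set vs. f y *s y) = 0" and x: "x \<in> set vs"
    have "hinner (w' *v x) (w' *v (\<Sum>y\<in>set vs. f y *s y)) = (\<Sum>y\<in>set vs. f y * hinner (w' *v x) (w' *v y))"
      by (simp only: linear_sum[OF matrix_vector_mul_linear] matrix_vector_scaleC hinner_sum_right hinner_scale_right)
    also have "\<dots> = (\<Sum>y\<in>set vs. if y = x then f y else 0)"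
      by (intro sum.cong refl) (auto simp: ortho x)
    finally show "f x = 0" using f x by simp
  qed simp
  have sub: "set vs \<subseteq> lowest (d - 1)" using \<omega>(1) by (auto simp: vs_def)
  have "lowest (d - 1) \<subseteq> vec.span (set vs)"
  proof (rule vec.card_ge_dim_independent[OF sub ind])
    show "vec.dim (lowest (d - 1)) \<le> card (set vs)"
      using distinct_card[OF dist] len by (simp add: mult_t_def L)
  qed
  moreover have "vec.span (set vs) \<subseteq> lowest (d - 1)"
    by (rule vec.span_minimal[OF sub vec_subspace_lowest])
  ultimately have "ordered_basis_of vs (L_space X H Y d)"
    using dist ind by (simp add: ordered_basis_of_def L)
  then show ?thesis using len nth \<omega>(2) by (intro exI[of _ vs]) simp
qed

text \<open>An invariant form \<open>P\<close> is the standard form pulled back by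
  \<open>w' = conj_transpose (chol P) ** P\<close>. For bases of the \<open>lowest (d - 1)\<close>
  that are orthonormal for \<open>P\<close>, \<open>basis_inner\<close> equals this form with its
  arguments exchanged, hence is invariant.\<close>

lemma adapted_exists:
  assumes K: "compact_subgroup K C"
  shows "\<exists>v. adapted_bases X H Y K v"
proof -
  have K': "K \<subseteq> C" "compact K" "mat 1 \<in> K" "\<And>j k. j \<in> K \<Longrightarrow> k \<in> K \<Longrightarrow> j ** k \<in> K"
    using K unfolding subgroup_iff by blast+
  have inv: "invertible k" if "k \<in> K" for k
    using K'(1) that by (auto simp: centralizer_iff invertible_det_nz)
  obtain P where P: "posdef P" "\<And>k. k \<in> K \<Longrightarrow> conj_transpose k ** P ** k = P"
    using invariant_posdef_form[OF K'(2,3,4) inv] by blast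
  define w where "w = chol P"
  define w' where "w' = conj_transpose w ** P"
  have w: "w' ** w = mat 1" unfolding w'_def w_def by (rule chol[OF P(1)])
  then have w2: "w ** w' = mat 1" using matrix_left_right_inverse by blast
  have "conj_transpose P = P" using P(1) by (simp add: posdef_def)
  then have "conj_transpose w' ** w' = P ** (w ** w')"
    by (simp add: w'_def conj_transpose_mult matrix_mul_assoc)
  then have ww: "conj_transpose w' ** w' = P" by (simp add: w2)
  have form: "hinner (w' *v x) (w' *v y) = hinner x (P *v y)" for x y
    by (simp add: hinner_conj_transpose matrix_vector_mul_assoc ww)
  have invar: "hinner (w' *v (k *v x)) (w' *v (k *v y)) = hinner (w' *v x) (w' *v y)" if k: "k \<in> K" for k x y
  proof -
    have "hinner (k *v x) (P *v (k *v y)) = hinner x ((conj_transpose k ** P ** k) *v y)"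
      by (simp add: hinner_conj_transpose matrix_vector_mul_assoc matrix_mul_assoc)
    then show ?thesis unfolding form P(2)[OF k] .
  qed
  obtain v where v: "\<And>d. d \<in> set ds \<Longrightarrow> ordered_basis_of (v d) (L_space X H Y d) \<and> length (v d) = tt d \<and>
      (\<forall>i<tt d. \<forall>j<tt d. hinner (w' *v v d ! i) (w' *v v d ! j) = (if i = j then 1 else 0))"
    using orthonormal_basis_lowest[OF _ w w2] by metis
  have Lv: "L_bases X H Y v" using v by (simp add: L_bases_def)
  have inner: "basis_inner (v d) x y = hinner (w' *v y) (w' *v x)"
    if d: "d \<in> set ds" and xy: "x \<in> lowest (d - 1)" "y \<in> lowest (d - 1)" for d x y
  proof -
    let ?b = "basis_matrix v" and ?S = "{c. blk c = d \<and> lev c = 0}"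
    have bb: "?b *v (basis_inv v *v x) = x" for x
      by (simp add: matrix_vector_mul_assoc basis_matrix_inv[OF Lv])
    have g: "(w' ** ?b) *v x = w' *v (?b *v x)" for x by (simp add: matrix_vector_mul_assoc)
    note sx = lowest_coordinates[OF Lv d xy(1)] and sy = lowest_coordinates[OF Lv d xy(2)]
    have "basis_inner (v d) (?b *v (basis_inv v *v x)) (?b *v (basis_inv v *v y)) = hinner (basis_inv v *v y) (basis_inv v *v x)"
      by (rule basis_inner_basis_matrix[OF Lv d]) (fact sx sy)+
    also have "\<dots> = hinner ((w' ** ?b) *v (basis_inv v *v y)) ((w' ** ?b) *v (basis_inv v *v x))"
    proof (rule isometric_on_support[symmetric, where S = ?S])
      fix i j :: 'n assume ij: "i \<in> ?S" "j \<in> ?S"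
      have "num i < tt d" "num j < tt d" using num_less[of i] num_less[of j] ij by auto
      then have "hinner (w' *v v d ! num i) (w' *v v d ! num j) = (if num i = num j then 1 else 0)"
        using v[OF d] by blast
      moreover have "num i = num j \<longleftrightarrow> i = j" using ij lab_eqI[of i j] by auto
      ultimately show "hinner ((w' ** ?b) *v axis i 1) ((w' ** ?b) *v axis j 1) = (if i = j then 1 else 0)"
        unfolding g using ij by (simp add: basis_matrix_axis')
    qed (use sx sy in blast)+
    finally show ?thesis unfolding g bb .
  qed
  have "adapted_bases X H Y K v"
    unfolding adapted_bases_def
  proof (intro conjI ballI Lv)
    fix d k x y assume d: "d \<in> set ds" and k: "k \<in> K" and xy: "x \<in> L_space X H Y d" "y \<in> L_space X H Y d"
    have L: "L_space X H Y d = lowest (d - 1)" using L_space_eq[of d] d set_ds by auto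
    have kc: "comm k" using K'(1) k centralizer_iff by blast
    show "basis_inner (v d) (k *v x) (k *v y) = basis_inner (v d) x y"
      using xy unfolding L
      by (simp only: inner[OF d] comm_lowest[OF kc] invar[OF k])
  qed
  then show ?thesis by blast
qed

lemma compact_subgroup_conj:
  assumes K: "compact_subgroup K C" and z: "z \<in> C"
  shows "compact_subgroup (Ad z ` K) C"
proof -
  have K': "K \<subseteq> C" "compact K" "mat 1 \<in> K" "\<And>j k. j \<in> K \<Longrightarrow> k \<in> K \<Longrightarrow> j ** k \<in> K"
      "\<And>k. k \<in> K \<Longrightarrow> \<exists>k'\<in>K. k ** k' = mat 1"
    using K unfolding subgroup_iff by blast+
  note zi = centralizer_inv[OF z]
  have mult: "Ad z j ** Ad z k = Ad z (j ** k)" for j k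
  proof -
    have "Ad z j ** Ad z k = z ** j ** (matrix_inv z ** z) ** k ** matrix_inv z"
      by (simp only: Ad_def matrix_mul_assoc)
    then show ?thesis by (simp add: zi Ad_def matrix_mul_assoc)
  qed
  have one: "Ad z (mat 1) = mat 1" by (simp add: Ad_def zi)
  show ?thesis
    unfolding subgroup_iff
  proof (intro conjI ballI)
    show "Ad z ` K \<subseteq> C"
      using K'(1) z zi(1) by (auto simp: Ad_def intro!: centralizer_mult)
    show "compact (Ad z ` K)"
      unfolding Ad_def by (rule compact_continuous_image[OF _ K'(2)]) (intro continuous_intros)
    show "mat 1 \<in> Ad z ` K" using imageI[OF K'(3), of "Ad z"] one by simp
    fix j assume "j \<in> Ad z ` K"
    then obtain j' where j: "j' \<in> K" "j = Ad z j'" by (rule imageE)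
    show "j ** k \<in> Ad z ` K" if k: "k \<in> Ad z ` K" for k
    proof -
      obtain k' where "k' \<in> K" "k = Ad z k'" using k by (rule imageE)
      then show ?thesis unfolding j(2) using K'(4)[OF j(1)] by (simp add: mult)
    qed
    obtain k where k: "k \<in> K" "j' ** k = mat 1" using K'(5)[OF j(1)] by blast
    have "j ** Ad z k = mat 1" unfolding j(2) mult k(2) by (rule one)
    then show "\<exists>k\<in>Ad z ` K. j ** k = mat 1" using k(1) by blast
  qed
qed

lemma maximal_compact_subgroup_conj:
  assumes K: "maximal_compact_subgroup K C" and z: "z \<in> C"
  shows "maximal_compact_subgroup (Ad z ` K) C"
  unfolding maximal_compact_subgroup_def
proof (intro conjI allI impI)
  note zi = centralizer_inv[OF z]
  have izi: "matrix_inv (matrix_inv z) = z" by (rule matrix_inv_unique[OF zi(3)])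
  have c1: "Ad (matrix_inv z) (Ad z k) = k" for k
  proof -
    have "Ad (matrix_inv z) (Ad z k) = (matrix_inv z ** z) ** k ** (matrix_inv z ** z)"
      by (simp only: Ad_def izi matrix_mul_assoc)
    then show ?thesis by (simp add: zi)
  qed
  have c2: "Ad z (Ad (matrix_inv z) k) = k" for k
  proof -
    have "Ad z (Ad (matrix_inv z) k) = (z ** matrix_inv z) ** k ** (z ** matrix_inv z)"
      by (simp only: Ad_def izi matrix_mul_assoc)
    then show ?thesis by (simp add: zi)
  qed
  show "compact_subgroup (Ad z ` K) C"
    using K z compact_subgroup_conj by (simp add: maximal_compact_subgroup_def)
  fix K' assume K': "compact_subgroup K' C \<and> Ad z ` K \<subseteq> K'"
  have "compact_subgroup (Ad (matrix_inv z) ` K') C"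
    by (rule compact_subgroup_conj[OF _ zi(1)]) (use K' in blast)
  moreover have "K \<subseteq> Ad (matrix_inv z) ` K'"
  proof
    fix k assume "k \<in> K"
    then have "Ad z k \<in> K'" using K' by blast
    from imageI[OF this, of "Ad (matrix_inv z)"] show "k \<in> Ad (matrix_inv z) ` K'" by (simp only: c1)
  qed
  ultimately have "Ad (matrix_inv z) ` K' = K"
    using K by (simp add: maximal_compact_subgroup_def)
  then have "Ad z ` K = Ad z ` Ad (matrix_inv z) ` K'" by simp
  also have "\<dots> = K'" by (simp add: image_image c2)
  finally show "K' = Ad z ` K" ..
qed

text \<open>The change from one basis to the other sends generators to lowest vectors of the same
  weight, so it commutes with the triple; a scalar factor brings its determinant to 1 and does not
  affect the conjugation.\<close>

lemma standard_compact_conj: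
  assumes v: "L_bases X H Y v" and v0: "L_bases X H Y v0"
  shows "\<exists>z\<in>C. Ad z ` standard_compact v0 = standard_compact v"
proof -
  define z0 where "z0 = basis_matrix v ** basis_inv v0"
  have z0b: "z0 ** basis_matrix v0 = basis_matrix v"
    by (simp add: z0_def matrix_mul_assoc[symmetric] basis_matrix_inv[OF v0])
  have "Determinants.det z0 \<noteq> 0"
    using det_basis[OF v] det_basis[OF v0] by (auto simp: z0_def det_mul)
  then obtain c where c: "Determinants.det (mat c ** z0) = 1" using scale_to_det_1 by blast
  have "comm z0"
  proof (rule comm_if_lowest[OF v0])
    have "z0 ** X = (basis_matrix v ** shift) ** basis_inv v0"
      by (simp add: z0_def matrix_mul_assoc[symmetric] basis_inv_X[OF v0])
    also have "\<dots> = X ** z0" unfolding X_basis_matrix[OF v, symmetric] by (simp add: z0_def matrix_mul_assoc)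
    finally show "z0 ** X = X ** z0" .
    show "z0 *v (basis_matrix v0 *v axis a 1) \<in> lowest (blk a - 1)" if "lev a = 0" for a
      unfolding matrix_vector_mul_assoc z0b by (rule basis_matrix_gen[OF v that])
  qed
  moreover have "comm (mat c)" by (simp add: comm_def mat_mult_commute)
  ultimately have z: "mat c ** z0 \<in> C" using c comm_mult by (simp add: centralizer_iff)
  have inv: "invertible (mat c ** z0)" using c by (simp add: invertible_det_nz)
  have "Ad (mat c ** z0) (basis_matrix v0 ** u ** basis_inv v0) = basis_matrix v ** u ** basis_inv v" for u
    unfolding Ad_eq_iff[OF inv]
  proof -
    have "(mat c ** z0) ** (basis_matrix v0 ** u ** basis_inv v0) = mat c ** (z0 ** basis_matrix v0) ** u ** basis_inv v0"
      by (simp only: matrix_mul_assoc)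
    also have "\<dots> = mat c ** (basis_matrix v ** u ** basis_inv v0)" by (simp only: z0b matrix_mul_assoc)
    also have "\<dots> = (basis_matrix v ** u ** basis_inv v0) ** mat c" by (rule mat_mult_commute)
    also have "\<dots> = (basis_matrix v ** u ** basis_inv v) ** (z0 ** mat c)"
    proof -
      have "(basis_matrix v ** u ** basis_inv v) ** (z0 ** mat c) =
          basis_matrix v ** u ** (basis_inv v ** basis_matrix v) ** basis_inv v0 ** mat c"
        by (simp only: z0_def matrix_mul_assoc)
      then show ?thesis by (simp add: basis_matrix_inv[OF v])
    qed
    finally show "(mat c ** z0) ** (basis_matrix v0 ** u ** basis_inv v0) =
        (basis_matrix v ** u ** basis_inv v) ** (mat c ** z0)"
      by (simp only: mat_mult_commute)
  qed
  then have "Ad (mat c ** z0) ` standard_compact v0 = standard_compact v"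
    by (simp add: standard_compact_def image_image)
  then show ?thesis using z by blast
qed

section \<open>The adjoint orbit of \<open>X\<close>\<close>

text \<open>\<open>shift\<close> is \<open>X\<close> in the basis \<B>, so both sets consist of the
  matrices similar to \<open>X\<close>; a scalar adjusts the determinant of the similarity.\<close>

lemma adjoint_orbit_eq: "adjoint_orbit X = orb"
proof -
  obtain v where v: "L_bases X H Y v" using L_bases_exists by blast
  show ?thesis
  proof (intro equalityI subsetI)
    fix N assume "N \<in> adjoint_orbit X"
    then obtain g where g: "Determinants.det g = 1" "N = Ad g X" by (auto simp: adjoint_orbit_def SL_def)
    have ig: "invertible g" using g(1) by (simp add: invertible_det_nz)
    then have gX: "g ** X = N ** g" using Ad_eq_iff[of g X N] g(2) by simp
    have "N ** (g ** basis_matrix v) = g ** (X ** basis_matrix v)"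
      by (simp only: gX matrix_mul_assoc)
    also have "\<dots> = (g ** basis_matrix v) ** shift" by (simp only: X_basis_matrix[OF v] matrix_mul_assoc)
    finally show "N \<in> orb"
      unfolding orb_def using invertible_mult[OF ig invertible_basis_matrix[OF v]] by blast
  next
    fix N assume "N \<in> orb"
    then obtain f where f: "invertible f" "N ** f = f ** shift" by (auto simp: orb_def)
    define g where "g = f ** basis_inv v"
    have gX: "N ** g = g ** X"
    proof -
      have "N ** g = f ** (shift ** basis_inv v)" by (simp only: g_def matrix_mul_assoc f(2))
      also have "\<dots> = g ** X" by (simp only: basis_inv_X[OF v, symmetric] g_def matrix_mul_assoc)
      finally show ?thesis .
    qed
    have "Determinants.det g \<noteq> 0"
      using f(1) det_basis[OF v] by (auto simp: g_def det_mul invertible_det_nz)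
    then obtain c where c: "Determinants.det (mat c ** g) = 1" using scale_to_det_1 by blast
    then have inv: "invertible (mat c ** g)" by (simp add: invertible_det_nz)
    have "(mat c ** g) ** X = mat c ** (N ** g)" by (simp only: gX matrix_mul_assoc)
    also have "\<dots> = (N ** g) ** mat c" by (rule mat_mult_commute)
    also have "\<dots> = N ** (g ** mat c)" by (simp only: matrix_mul_assoc)
    also have "\<dots> = N ** (mat c ** g)" by (simp only: mat_mult_commute)
    finally have "Ad (mat c ** g) X = N" by (simp only: Ad_eq_iff[OF inv])
    then show "N \<in> adjoint_orbit X" unfolding adjoint_orbit_def SL_def using c by blast
  qed
qed

lemma orbit_homotopy_equivalent:
  "top_of_set (adjoint_orbit X) homotopy_equivalent_space coset_space (matrix_group SU) unit_stab"
  unfolding adjoint_orbit_eq unit_stab_def by (rule orb_homotopy_equivalent_coset_space)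

end

theorem theorem3p2:
  fixes X H Y :: "complex^('n::{finite,wellorder})^('n::{finite,wellorder})"
    and K :: "(complex^('n::{finite,wellorder})^('n::{finite,wellorder})) set"
  assumes "X \<in> sl" and "nilpotent_matrix X" and "X \<noteq> 0"
    and "sl2_triple X H Y"
    and "maximal_compact_subgroup K (centralizer_triple X H Y)"
  shows
    "(\<exists>v. adapted_bases X H Y K v) \<and>
     (\<forall>v. adapted_bases X H Y K v \<longrightarrow>
        Lambda (basis_B X H Y v) ` K = unitary_block_group X H Y \<and>
        top_of_set (adjoint_orbit X) homotopy_equivalent_space
          coset_space (matrix_group SU) (Lambda (basis_B X H Y v) ` K)) \<and>
     (\<forall>v. L_bases X H Y v \<longrightarrow>
        (\<exists>z \<in> centralizer_triple X H Y.
           let K' = Ad z ` K in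
             maximal_compact_subgroup K' (centralizer_triple X H Y) \<and>
             Lambda (basis_B X H Y v) ` K' = unitary_block_group X H Y \<and>
             top_of_set (adjoint_orbit X) homotopy_equivalent_space
               coset_space (matrix_group SU) (Lambda (basis_B X H Y v) ` K')))"
proof -
  interpret sl2_matrices X H Y by (rule sl2_matrices.intro) fact
  note max = assms(5)
  \<comment> \<open>Every standard compact subgroup has the same image \<open>unit_stab\<close>,
    which settles both claims for it.\<close>
  have std: "Lambda (basis_B X H Y v) ` standard_compact v = unitary_block_group X H Y \<and>
      top_of_set (adjoint_orbit X) homotopy_equivalent_space
        coset_space (matrix_group SU) (Lambda (basis_B X H Y v) ` standard_compact v)"
    if "L_bases X H Y v" for v
    unfolding Lambda_standard_compact[OF that] unitary_block_group_eq
    using orbit_homotopy_equivalent by simp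
  \<comment> \<open>An adapted choice identifies \<open>K\<close> with the standard compact subgroup
    for \<open>v0\<close>; for any other bases the standard subgroup is a conjugate of this
    one.\<close>
  obtain v0 where v0: "adapted_bases X H Y K v0"
    using adapted_exists max unfolding maximal_compact_subgroup_def by blast
  have L0: "L_bases X H Y v0" using v0 by (simp add: adapted_bases_def)
  show ?thesis
  proof (intro conjI allI impI)
    show "\<exists>v. adapted_bases X H Y K v" using v0 by blast
    fix v assume ad: "adapted_bases X H Y K v"
    then have "L_bases X H Y v" by (simp add: adapted_bases_def)
    note s = std[OF this, folded adapted_eq_standard[OF ad max]]
    show "Lambda (basis_B X H Y v) ` K = unitary_block_group X H Y" by (rule conjunct1[OF s])
    show "top_of_set (adjoint_orbit X) homotopy_equivalent_space
        coset_space (matrix_group SU) (Lambda (basis_B X H Y v) ` K)" by (rule conjunct2[OF s])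
  next
    fix v assume v: "L_bases X H Y v"
    obtain z where z: "z \<in> centralizer_triple X H Y" "Ad z ` K = standard_compact v"
      using standard_compact_conj[OF v L0] adapted_eq_standard[OF v0 max] by blast
    show "\<exists>z \<in> centralizer_triple X H Y.
       let K' = Ad z ` K in
         maximal_compact_subgroup K' (centralizer_triple X H Y) \<and>
         Lambda (basis_B X H Y v) ` K' = unitary_block_group X H Y \<and>
         top_of_set (adjoint_orbit X) homotopy_equivalent_space
           coset_space (matrix_group SU) (Lambda (basis_B X H Y v) ` K')"
      unfolding Let_def
    proof (rule bexI[OF _ z(1)], rule conjI)
      show "maximal_compact_subgroup (Ad z ` K) (centralizer_triple X H Y)"
        by (rule maximal_compact_subgroup_conj[OF max z(1)])
      show "Lambda (basis_B X H Y v) ` Ad z ` K = unitary_block_group X H Y \<and>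
         top_of_set (adjoint_orbit X) homotopy_equivalent_space
           coset_space (matrix_group SU) (Lambda (basis_B X H Y v) ` Ad z ` K)"
        unfolding z(2) by (rule std[OF v])
    qed
  qed
qed

end
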